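(* Let $d\ge 2$ and let $\Xi$ be an $\mathbb{R}^{d-1}$-stationary and ergodic random closed set in $\mathbb{R}^d$. Suppose that $\mathbb{E}\big[\gamma_{\Xi}(o,H_{\mathsf O})\,\mathbf 1\{o\in\mathcal C_{\Xi}(H_{\mathsf O})\}\big]<\infty$. Then $$\widehat\tau_N=\frac{1}{\mathcal H_{d-1}(\mathcal C_{\Xi}(H_{\mathsf O})\cap H_{\mathsf I,N})}\int_{\mathcal C_{\Xi}(H_{\mathsf O})\cap H_{\mathsf I,N}}\gamma_{\Xi}(x,H_{\mathsf O})\,\mathcal H_{d-1}(\mathrm dx)$$ defines a strongly consistent estimator of the mean geodesic tortuosity $\tau$ of $\Xi$; that is, $\widehat\tau_N$ converges almost surely to $\tau$ as $N\to\infty$ ($N$ a positive integer).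
   Context: $o$ is the origin of $\mathbb R^d$; $\mathcal H_k$ is the $k$-dimensional Hausdorff measure; $\mathcal F$ is the family of closed subsets of $\mathbb R^d$ with the Borel $\sigma$-algebra of the Fell topology. The underlying probability space $(\Omega,\mathcal A,\mathbb P)$ is complete. $H_{\mathsf I}=\{x\in\mathbb R^d:x_d=0\}$, $H_{\mathsf O}=\{x\in\mathbb R^d:x_d=1\}$, $W_N=[-N/2,N/2]^{d-1}\times[0,1]$, $H_{\mathsf I,N}=H_{\mathsf I}\cap W_N$. For $F_0,F_1\in\mathcal F$ and $x\in\mathbb R^d$, $\mathcal P_{F_0}(x,F_1)$ is the set of Lipschitz maps $f:[0,1]\to\mathring F_0$ (the interior of $F_0$) with $f(0)=x$ and $f(1)\in F_1$. Put $\mathcal C_{F_0}(F_1)=\{x\in\mathbb R^d:\mathcal P_{F_0}(x,F_1)\ne\emptyset\}$ and $\gamma_{F_0}(x,F_1)=\inf_{f\in\mathcal P_{F_0}(x,F_1)}\mathcal H_1(f([0,1]))$ (with $\inf\emptyset=\infty$). $\mathbb R^{d-1}$-stationary and ergodic: there is a group $\{\mathbf T_x\}_{x\in H_{\mathsf I}}$ of $\mathbb P$-preserving maps $\mathbf T_x:\Omega\to\Omega$ with $\Xi(\mathbf T_x\omega)=\Xi(\omega)-x$, and $\Xi$ is stationary and ergodic with respect to this group of translations by vectors of $H_{\mathsf I}$. Mean geodesic tortuosity: $\tau=\mathbb E[\gamma_\Xi(o,H_{\mathsf O})\mid o\in\mathcal C_\Xi(H_{\mathsf O})]$ if $\mathbb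 P(o\in\mathcal C_\Xi(H_{\mathsf O}))>0$, and $\tau=\infty$ otherwise. *)

theory Defs
  imports "HOL-Probability.Probability"
begin

section \<open>Hausdorff measure\<close>

text \<open>
  The normalisation is by the volume of the \<open>k\<close>-dimensional ball of the given diameter, so that
  the one-dimensional measure of a segment is its length. The covering sets have to be required
  bounded, because \<^const>\<open>diameter\<close> has no meaningful value on unbounded sets. The case
  distinction on \<open>{}\<close> only matters for \<open>k = 0\<close>, where \<open>0 ^ 0 = 1\<close>.
\<close>

definition hausdorff_gauge :: "nat \<Rightarrow> 'a::metric_space set \<Rightarrow> ennreal" where
  "hausdorff_gauge k U =
     (if U = {} then 0 else ennreal (unit_ball_vol (real k) * (diameter U / 2) ^ k))"

definition hausdorff_pre :: "nat \<Rightarrow> real \<Rightarrow> 'a::metric_space set \<Rightarrow> ennreal" where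
  "hausdorff_pre k \<delta> A =
     (INF U \<in> {U :: nat \<Rightarrow> 'a set. A \<subseteq> (\<Union>i. U i) \<and> (\<forall>i. bounded (U i) \<and> diameter (U i) \<le> \<delta>)}.
        \<Sum>i. hausdorff_gauge k (U i))"

definition hausdorff_outer :: "nat \<Rightarrow> 'a::metric_space set \<Rightarrow> ennreal" where
  "hausdorff_outer k A = (SUP \<delta> \<in> {0<..}. hausdorff_pre k \<delta> A)"

definition hausdorff_measure :: "nat \<Rightarrow> 'a::metric_space measure" where
  "hausdorff_measure k = measure_of UNIV (sets borel) (hausdorff_outer k)"

section \<open>Random closed sets\<close>

definition fell_topology :: "'a::topological_space set topology" where
  "fell_topology = topology_generated_by
     ({{F. closed F \<and> F \<inter> K = {}} | K. compact K} \<union> {{F. closed F \<and> F \<inter> G \<noteq> {}} | G. open G})"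

definition fell_borel :: "'a::topological_space set measure" where
  "fell_borel = sigma {F. closed F} {\<U>. openin fell_topology \<U>}"

definition random_closed_set :: "'w measure \<Rightarrow> ('w \<Rightarrow> 'a::topological_space set) \<Rightarrow> bool" where
  "random_closed_set M \<Xi> \<longleftrightarrow> \<Xi> \<in> measurable M fell_borel"

section \<open>Hyperplanes and windows\<close>

text \<open>
  The space \<open>\<real>\<^sup>d\<close> is \<^typ>\<open>real ^ 'n\<close> for a finite linearly ordered index type with
  \<open>d = CARD('n)\<close>; the \<open>d\<close>-th coordinate is the one with the largest index.
\<close>

definition last_coord :: "real ^ 'n::{finite,linorder} \<Rightarrow> real" where
  "last_coord x = x $ Max UNIV"

definition H_in :: "(real ^ 'n::{finite,linorder}) set" where
  "H_in = {x. last_coord x = 0}"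

definition H_out :: "(real ^ 'n::{finite,linorder}) set" where
  "H_out = {x. last_coord x = 1}"

definition window :: "nat \<Rightarrow> (real ^ 'n::{finite,linorder}) set" where
  "window N = {x. (\<forall>i. i \<noteq> Max UNIV \<longrightarrow> x $ i \<in> {- (real N / 2) .. real N / 2}) \<and>
                  last_coord x \<in> {0..1}}"

definition H_in_window :: "nat \<Rightarrow> (real ^ 'n::{finite,linorder}) set" where
  "H_in_window N = H_in \<inter> window N"

section \<open>Stationarity and ergodicity along the inlet hyperplane\<close>

definition shift :: "'a::ab_group_add \<Rightarrow> 'a set \<Rightarrow> 'a set" where
  "shift x F = (\<lambda>y. y - x) ` F"

definition measure_preserving_group ::
  "'w measure \<Rightarrow> 'a::ab_group_add set \<Rightarrow> ('a \<Rightarrow> 'w \<Rightarrow> 'w) \<Rightarrow> bool" where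
  "measure_preserving_group M H T \<longleftrightarrow>
     (\<forall>x\<in>H. T x \<in> measurable M M \<and> distr M M (T x) = M) \<and>
     (\<forall>\<omega>\<in>space M. T 0 \<omega> = \<omega>) \<and>
     (\<forall>x\<in>H. \<forall>y\<in>H. \<forall>\<omega>\<in>space M. T (x + y) \<omega> = T x (T y \<omega>))"

definition stationary_along ::
  "'w measure \<Rightarrow> 'a::{topological_space,ab_group_add} set \<Rightarrow> ('w \<Rightarrow> 'a set) \<Rightarrow> bool" where
  "stationary_along M H \<Xi> \<longleftrightarrow>
     (\<forall>x\<in>H. distr M fell_borel (\<lambda>\<omega>. shift x (\<Xi> \<omega>)) = distr M fell_borel \<Xi>)"

definition ergodic_along ::
  "'w measure \<Rightarrow> 'a::{topological_space,ab_group_add} set \<Rightarrow> ('w \<Rightarrow> 'a set) \<Rightarrow> bool" where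
  "ergodic_along M H \<Xi> \<longleftrightarrow>
     (\<forall>B\<in>sets fell_borel. (\<forall>x\<in>H. shift x ` B = B) \<longrightarrow>
        measure M {\<omega> \<in> space M. \<Xi> \<omega> \<in> B} \<in> {0, 1})"

text \<open>
  Stationarity follows from the covariance under a measure preserving group; it is listed because
  it is part of the notion.
\<close>

definition stationary_ergodic ::
  "'w measure \<Rightarrow> ('w \<Rightarrow> (real ^ 'n::{finite,linorder}) set) \<Rightarrow> bool" where
  "stationary_ergodic M \<Xi> \<longleftrightarrow>
     (\<exists>T. measure_preserving_group M H_in T \<and>
          (\<forall>x\<in>H_in. \<forall>\<omega>\<in>space M. \<Xi> (T x \<omega>) = shift x (\<Xi> \<omega>))) \<and>
     stationary_along M H_in \<Xi> \<and> ergodic_along M H_in \<Xi>"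

section \<open>Geodesic tortuosity\<close>

text \<open>
  Paths are total functions on the reals of which only the restriction to \<open>{0..1}\<close> matters.
\<close>

definition paths :: "'a::metric_space set \<Rightarrow> 'a \<Rightarrow> 'a set \<Rightarrow> (real \<Rightarrow> 'a) set" where
  "paths F0 x F1 =
     {f. (\<exists>L. L-lipschitz_on {0..1} f) \<and> f ` {0..1} \<subseteq> interior F0 \<and> f 0 = x \<and> f 1 \<in> F1}"

definition connected_points :: "'a::metric_space set \<Rightarrow> 'a set \<Rightarrow> 'a set" where
  "connected_points F0 F1 = {x. paths F0 x F1 \<noteq> {}}"

definition geodesic_length :: "'a::metric_space set \<Rightarrow> 'a \<Rightarrow> 'a set \<Rightarrow> ennreal" where
  "geodesic_length F0 x F1 = (INF f \<in> paths F0 x F1. emeasure (hausdorff_measure 1) (f ` {0..1}))"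

definition origin_connected ::
  "'w measure \<Rightarrow> ('w \<Rightarrow> (real ^ 'n::{finite,linorder}) set) \<Rightarrow> 'w set" where
  "origin_connected M \<Xi> = {\<omega> \<in> space M. 0 \<in> connected_points (\<Xi> \<omega>) H_out}"

definition mean_tortuosity ::
  "'w measure \<Rightarrow> ('w \<Rightarrow> (real ^ 'n::{finite,linorder}) set) \<Rightarrow> ennreal" where
  "mean_tortuosity M \<Xi> =
     (if measure M (origin_connected M \<Xi>) > 0
      then (\<integral>\<^sup>+ \<omega>. geodesic_length (\<Xi> \<omega>) 0 H_out \<partial>uniform_measure M (origin_connected M \<Xi>))
      else \<infinity>)"

text \<open>
  The estimator for one realisation \<open>F\<close>. When no part of the inlet window is connected to the outlet
  hyperplane, the quotient is \<open>0 / 0\<close>; its value is then set to \<open>\<infinity>\<close>, in accordance with the value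
  of \<^const>\<open>mean_tortuosity\<close> in the case of a null event, whereas \<open>0 / 0 = 0\<close> in
  \<^typ>\<open>ennreal\<close>.
\<close>

definition tortuosity_estimator :: "nat \<Rightarrow> (real ^ 'n::{finite,linorder}) set \<Rightarrow> ennreal" where
  "tortuosity_estimator N F =
     (let A = connected_points F H_out \<inter> H_in_window N;
          \<H> = hausdorff_measure (CARD('n) - 1)
      in if emeasure \<H> A = 0 then \<infinity>
         else (\<integral>\<^sup>+ x \<in> A. geodesic_length F x H_out \<partial>\<H>) / emeasure \<H> A)"

end

theory Submission
  imports Defs "HOL-Real_Asymp.Real_Asymp"
begin

text \<open>
  The estimator is the ratio of the averages over \<open>H_in_window N\<close> of two functions of the translated set: the geodesic
  length from the origin, restricted to the event that the origin is connected to the outlet, and the indicator of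
  that event. Both averages converge almost surely to their means by a multiparameter ergodic theorem. As only a
  ratio is involved, it suffices to know that the Hausdorff measure on the inlet hyperplane is translation invariant, scales
  with the correct power, and is positive and finite on the unit window.

  The ergodic theorem combines the mean ergodic theorem with a maximal inequality. If \<open>A\<^sub>N\<close> denotes averaging over the
  \<open>N\<close>-th window, then \<open>A\<^sub>N g\<close> and \<open>A\<^sub>N (A\<^sub>K g)\<close> are asymptotically equal for nonnegative \<open>g\<close>, since the windows grow slowly
  near their boundary; and \<open>A\<^sub>K g\<close> is close to the constant \<open>\<integral>g\<close> in mean for some \<open>K\<close>, so that Wiener's maximal inequality
  bounds the probability that \<open>A\<^sub>N (A\<^sub>K g)\<close> ever deviates much from it.

  The geodesic length is jointly measurable in the starting point and the set because each path runs inside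
  one of countably many finite unions of rational balls.
\<close>

section \<open>Hausdorff measure\<close>

text \<open>Almost sure convergence is wanted for a merely integrable function of a random set,
  while ergodicity concerns Borel sets of closed sets. Hence the argument takes place on the law of
  \<open>\<Xi>\<close>, with translation itself acting, and deals with functions \<open>g\<close>
  for which \<open>g (T x F)\<close> is measurable in \<open>x\<close> and \<open>F\<close>
  together; averaging preserves this class. Smoothing takes the place of the usual dense class of
  functions with evident convergence: the distance of \<open>A\<^sub>K g\<close> from its mean is
  controlled by a nonnegative \<open>D\<close> whose integral becomes arbitrarily small by
  truncating \<open>g\<close> and then choosing \<open>K\<close>. The exceptional event for a
  tolerance \<open>t\<close> does not depend on \<open>D\<close>, so the maximal inequality makes it
  null. The mean ergodic theorem for the truncated function follows the pattern of the projection
  theorem: averages over large windows nearly minimise the mean square, and the parallelogram law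
  makes them a Cauchy family. If the origin is connected with probability 0, no limit of ratios is
  available; then the denominators vanish almost surely and the estimator has its default value for
  every \<open>N\<close>.\<close>

lemma hausdorff_gauge_empty [simp]: "hausdorff_gauge k {} = 0"
  by (simp add: hausdorff_gauge_def)

lemma hausdorff_pre_le:
  assumes "A \<subseteq> (\<Union>i. U i)" "\<And>i. bounded (U i)" "\<And>i. diameter (U i) \<le> \<delta>"
  shows "hausdorff_pre k \<delta> A \<le> (\<Sum>i. hausdorff_gauge k (U i))"
  unfolding hausdorff_pre_def using assms by (intro INF_lower) auto

lemma hausdorff_pre_lessE:
  assumes "hausdorff_pre k \<delta> A < c"
  obtains U where "A \<subseteq> (\<Union>i. U i)" "\<And>i. bounded (U i)" "\<And>i. diameter (U i) \<le> \<delta>"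
    "(\<Sum>i. hausdorff_gauge k (U i)) < c"
  using assms unfolding hausdorff_pre_def INF_less_iff by auto

lemma hausdorff_pre_mono:
  assumes "A \<subseteq> B"
  shows "hausdorff_pre k \<delta> A \<le> hausdorff_pre k \<delta> B"
  unfolding hausdorff_pre_def using assms by (intro INF_superset_mono) auto

lemma hausdorff_pre_antimono:
  assumes "\<delta> \<le> \<epsilon>"
  shows "hausdorff_pre k \<epsilon> A \<le> hausdorff_pre k \<delta> A"
  unfolding hausdorff_pre_def using assms by (intro INF_superset_mono) (auto intro: order_trans)

text \<open>Padding with empty sets, of gauge 0 even for \<open>k = 0\<close>, turns a finite cover
  into a sequence; \<open>0 \<le> \<delta>\<close> makes the padding admissible.\<close>

lemma hausdorff_pre_finite_le:
  assumes "finite I" "A \<subseteq> (\<Union>i\<in>I. V i)" "\<And>i. i \<in> I \<Longrightarrow> bounded (V i)"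
    "\<And>i. i \<in> I \<Longrightarrow> diameter (V i) \<le> \<delta>" "0 \<le> \<delta>"
  shows "hausdorff_pre k \<delta> A \<le> (\<Sum>i\<in>I. hausdorff_gauge k (V i))"
proof -
  obtain h where h: "bij_betw h {..<card I} I"
    using ex_bij_betw_nat_finite[OF assms(1)] by (auto simp: atLeast0LessThan)
  define U where "U n = (if n < card I then V (h n) else {})" for n
  have hI: "h n \<in> I" if "n < card I" for n using h that by (auto simp: bij_betw_def)
  have "A \<subseteq> (\<Union>n. U n)"
  proof
    fix x assume "x \<in> A"
    then obtain i where "i \<in> I" "x \<in> V i" using assms by blast
    have "i \<in> h ` {..<card I}" using h \<open>i \<in> I\<close> by (simp add: bij_betw_def)
    then obtain n where "n < card I" "h n = i" by auto
    then show "x \<in> (\<Union>n. U n)" using \<open>x \<in> V i\<close> by (auto simp: U_def)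
  qed
  then have "hausdorff_pre k \<delta> A \<le> (\<Sum>n. hausdorff_gauge k (U n))"
    by (rule hausdorff_pre_le) (use assms hI in \<open>auto simp: U_def\<close>)
  also have "\<dots> = (\<Sum>n<card I. hausdorff_gauge k (U n))"
    by (rule suminf_finite) (auto simp: U_def)
  also have "\<dots> = (\<Sum>n<card I. hausdorff_gauge k (V (h n)))"
    by (rule sum.cong) (auto simp: U_def)
  also have "\<dots> = (\<Sum>i\<in>I. hausdorff_gauge k (V i))"
    by (rule sum.reindex_bij_betw[OF h])
  finally show ?thesis .
qed

lemma hausdorff_pre_empty:
  assumes "0 \<le> \<delta>"
  shows "hausdorff_pre k \<delta> {} = 0"
  using hausdorff_pre_finite_le[of "{}" "{}" "\<lambda>_. {}" \<delta> k] assms by simp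

text \<open>Covers of the \<open>A n\<close> that are optimal up to \<open>e * (1/2)^Suc n\<close>
  are merged into one sequence by the pairing function; the errors add up to
  \<open>e\<close>.\<close>

lemma hausdorff_pre_UN_le:
  "hausdorff_pre k \<delta> (\<Union>n. A n) \<le> (\<Sum>n. hausdorff_pre k \<delta> (A n))"
proof (rule ennreal_le_epsilon)
  fix e :: real assume fin: "(\<Sum>n. hausdorff_pre k \<delta> (A n)) < top" and e: "0 < e"
  have "\<exists>U. A n \<subseteq> (\<Union>i. U i) \<and> (\<forall>i. bounded (U i) \<and> diameter (U i) \<le> \<delta>) \<and>
      (\<Sum>i. hausdorff_gauge k (U i)) \<le> hausdorff_pre k \<delta> (A n) + e * (1/2)^Suc n" for n
  proof -
    have "hausdorff_pre k \<delta> (A n) < top"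
      using fin ennreal_suminf_lessD by blast
    then have "hausdorff_pre k \<delta> (A n) < hausdorff_pre k \<delta> (A n) + e * (1/2)^Suc n"
      using e by (auto simp: ennreal_zero_less_mult_iff ennreal_less_zero_iff less_top)
    then show ?thesis by (rule hausdorff_pre_lessE) (metis less_imp_le)
  qed
  then obtain U where U: "\<And>n. A n \<subseteq> (\<Union>i. U n i)" "\<And>n i. bounded (U n i)"
    "\<And>n i. diameter (U n i) \<le> \<delta>"
    "\<And>n. (\<Sum>i. hausdorff_gauge k (U n i)) \<le> hausdorff_pre k \<delta> (A n) + e * (1/2)^Suc n"
    by metis
  define W where "W j = (case prod_decode j of (n, i) \<Rightarrow> U n i)" for j
  have "hausdorff_pre k \<delta> (\<Union>n. A n) \<le> (\<Sum>j. hausdorff_gauge k (W j))"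
  proof (rule hausdorff_pre_le)
    show "(\<Union>n. A n) \<subseteq> (\<Union>j. W j)"
    proof
      fix x assume "x \<in> (\<Union>n. A n)"
      then obtain n i where "x \<in> U n i" using U(1) by blast
      then have "x \<in> W (prod_encode (n, i))" by (simp add: W_def)
      then show "x \<in> (\<Union>j. W j)" by blast
    qed
  qed (auto simp: W_def U split: prod.split)
  also have "\<dots> = (\<Sum>j. (\<lambda>(n, i). hausdorff_gauge k (U n i)) (prod_decode j))"
    by (simp add: W_def case_prod_unfold)
  also have "\<dots> = (\<Sum>n. \<Sum>i. hausdorff_gauge k (U n i))"
    by (rule suminf_ennreal_2dimen) auto
  also have "\<dots> \<le> (\<Sum>n. hausdorff_pre k \<delta> (A n) + e * (1/2)^Suc n)"
    using U by (intro suminf_le) auto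
  also have "\<dots> = (\<Sum>n. hausdorff_pre k \<delta> (A n)) + (\<Sum>n. ennreal e * ennreal ((1/2) ^ Suc n))"
    using \<open>0 < e\<close> by (subst suminf_add[symmetric])
      (auto simp del: ennreal_suminf_cmult simp add: ennreal_mult[symmetric])
  also have "\<dots> = (\<Sum>n. hausdorff_pre k \<delta> (A n)) + e"
    unfolding ennreal_suminf_cmult
    by (subst suminf_ennreal_eq[OF zero_le_power power_half_series]) auto
  finally show "hausdorff_pre k \<delta> (\<Union>n. A n) \<le> (\<Sum>n. hausdorff_pre k \<delta> (A n)) + ennreal e" .
qed

section \<open>Hausdorff outer measure and the Caratheodory criterion\<close>

lemma hausdorff_pre_le_outer: "0 < \<delta> \<Longrightarrow> hausdorff_pre k \<delta> A \<le> hausdorff_outer k A"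
  unfolding hausdorff_outer_def by (rule SUP_upper) simp

lemma hausdorff_outer_le:
  assumes "\<And>\<delta>. 0 < \<delta> \<Longrightarrow> hausdorff_pre k \<delta> A \<le> c"
  shows "hausdorff_outer k A \<le> c"
  unfolding hausdorff_outer_def using assms by (intro SUP_least) auto

lemma hausdorff_outer_mono: "A \<subseteq> B \<Longrightarrow> hausdorff_outer k A \<le> hausdorff_outer k B"
  by (meson hausdorff_outer_le hausdorff_pre_le_outer hausdorff_pre_mono order_trans)

lemma hausdorff_outer_empty [simp]: "hausdorff_outer k {} = 0"
proof -
  have "hausdorff_outer k ({} :: 'a set) \<le> 0"
    by (rule hausdorff_outer_le) (simp add: hausdorff_pre_empty)
  then show ?thesis by simp
qed

lemma hausdorff_outer_UN_le:
  "hausdorff_outer k (\<Union>n. A n) \<le> (\<Sum>n::nat. hausdorff_outer k (A n))"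
proof (rule hausdorff_outer_le)
  fix \<delta> :: real assume "0 < \<delta>"
  then show "hausdorff_pre k \<delta> (\<Union>n. A n) \<le> (\<Sum>n. hausdorff_outer k (A n))"
    by (intro order_trans[OF hausdorff_pre_UN_le] suminf_le) (auto intro: hausdorff_pre_le_outer)
qed

lemma hausdorff_outer_Un_le: "hausdorff_outer k (A \<union> B) \<le> hausdorff_outer k A + hausdorff_outer k B"
proof -
  define f where "f n = (if n = 0 then A else if n = Suc 0 then B else {})" for n :: nat
  have "A \<union> B = (\<Union>n. f n)" by (auto simp: f_def split: if_splits)
  also have "hausdorff_outer k \<dots> \<le> (\<Sum>n. hausdorff_outer k (f n))"
    by (rule hausdorff_outer_UN_le)
  also have "\<dots> = (\<Sum>n\<in>{0, Suc 0}. hausdorff_outer k (f n))"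
    by (rule suminf_finite) (auto simp: f_def)
  finally show ?thesis by (simp add: f_def)
qed

text \<open>A covering set of diameter below \<open>\<eta>\<close> cannot meet both \<open>A\<close>
  and \<open>B\<close>, so a fine cover of the union splits into a cover of \<open>A\<close> and one
  of \<open>B\<close>.\<close>

lemma hausdorff_outer_separated:
  assumes "0 < \<eta>" and sep: "\<And>x y. x \<in> A \<Longrightarrow> y \<in> B \<Longrightarrow> \<eta> \<le> dist x y"
  shows "hausdorff_outer k (A \<union> B) = hausdorff_outer k A + hausdorff_outer k B"
proof (rule antisym[OF hausdorff_outer_Un_le])
  have key: "hausdorff_pre k \<delta> A + hausdorff_pre k \<delta> B \<le> hausdorff_outer k (A \<union> B)"
    if \<delta>: "0 < \<delta>" "\<delta> < \<eta>" for \<delta>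
  proof (rule order_trans[OF _ hausdorff_pre_le_outer[OF \<delta>(1)]])
    show "hausdorff_pre k \<delta> A + hausdorff_pre k \<delta> B \<le> hausdorff_pre k \<delta> (A \<union> B)"
    proof (rule ccontr)
      assume "\<not> ?thesis"
      then obtain U where U: "A \<union> B \<subseteq> (\<Union>i. U i)" "\<And>i. bounded (U i)" "\<And>i. diameter (U i) \<le> \<delta>"
        "(\<Sum>i. hausdorff_gauge k (U i)) < hausdorff_pre k \<delta> A + hausdorff_pre k \<delta> B"
        using hausdorff_pre_lessE by (metis not_le)
      define UA where "UA i = (if U i \<inter> A = {} then {} else U i)" for i
      define UB where "UB i = (if U i \<inter> B = {} then {} else U i)" for i
      have disj: "U i \<inter> A = {} \<or> U i \<inter> B = {}" for i
      proof (rule ccontr)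
        assume "\<not> ?thesis"
        then obtain x y where "x \<in> U i" "x \<in> A" "y \<in> U i" "y \<in> B" by blast
        then show False
          using sep[of x y] diameter_bounded_bound[OF U(2), of x i y] U(3)[of i] \<delta> by simp
      qed
      have "hausdorff_pre k \<delta> A \<le> (\<Sum>i. hausdorff_gauge k (UA i))"
        by (rule hausdorff_pre_le) (use U \<delta> in \<open>fastforce simp: UA_def\<close>)+
      moreover have "hausdorff_pre k \<delta> B \<le> (\<Sum>i. hausdorff_gauge k (UB i))"
        by (rule hausdorff_pre_le) (use U \<delta> in \<open>fastforce simp: UB_def\<close>)+
      moreover have "(\<Sum>i. hausdorff_gauge k (UA i)) + (\<Sum>i. hausdorff_gauge k (UB i)) =
          (\<Sum>i. hausdorff_gauge k (UA i) + hausdorff_gauge k (UB i))"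
        by (rule suminf_add) auto
      moreover have "\<dots> \<le> (\<Sum>i. hausdorff_gauge k (U i))"
      proof (intro suminf_le allI)
        fix i show "hausdorff_gauge k (UA i) + hausdorff_gauge k (UB i) \<le> hausdorff_gauge k (U i)"
          using disj[of i] by (auto simp: UA_def UB_def)
      qed auto
      ultimately show False using U(4) by (metis add_mono leD order_trans)
    qed
  qed
  \<comment> \<open>A finer mesh only increases the pre-measure, so meshes below
    \<open>\<eta>\<close> determine the supremum. The same monotonicity makes the suprema directed,
    so that their sum is a supremum of sums.\<close>
  have eq: "hausdorff_outer k C = (SUP \<delta>\<in>{0<..<\<eta>}. hausdorff_pre k \<delta> C)" for C :: "'a set"
  proof (rule antisym)
    show "hausdorff_outer k C \<le> (SUP \<delta>\<in>{0<..<\<eta>}. hausdorff_pre k \<delta> C)"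
    proof (rule hausdorff_outer_le)
      fix \<delta> :: real assume "0 < \<delta>"
      then have "hausdorff_pre k \<delta> C \<le> hausdorff_pre k (min \<delta> (\<eta> / 2)) C"
        by (intro hausdorff_pre_antimono) auto
      also have "\<dots> \<le> (SUP \<delta>\<in>{0<..<\<eta>}. hausdorff_pre k \<delta> C)"
        using \<open>0 < \<delta>\<close> \<open>0 < \<eta>\<close> by (intro SUP_upper) auto
      finally show "hausdorff_pre k \<delta> C \<le> (SUP \<delta>\<in>{0<..<\<eta>}. hausdorff_pre k \<delta> C)" .
    qed
  qed (auto intro!: SUP_least hausdorff_pre_le_outer)
  have "hausdorff_outer k A + hausdorff_outer k B =
      (SUP \<delta>\<in>{0<..<\<eta>}. hausdorff_pre k \<delta> A + hausdorff_pre k \<delta> B)"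
    unfolding eq
  proof (rule SUP_add_directed_ennreal[symmetric])
    fix \<delta> \<epsilon> assume "\<delta> \<in> {0<..<\<eta>}" "\<epsilon> \<in> {0<..<\<eta>}"
    then show "\<exists>m\<in>{0<..<\<eta>}. hausdorff_pre k \<delta> A + hausdorff_pre k \<epsilon> B
            \<le> hausdorff_pre k m A + hausdorff_pre k m B"
      by (intro bexI[of _ "min \<delta> \<epsilon>"] add_mono hausdorff_pre_antimono) auto
  qed
  also have "\<dots> \<le> hausdorff_outer k (A \<union> B)"
    using key by (intro SUP_least) auto
  finally show "hausdorff_outer k A + hausdorff_outer k B \<le> hausdorff_outer k (A \<union> B)" .
qed

lemma hausdorff_outer_sum_separated:
  fixes R :: "nat \<Rightarrow> 'a::metric_space set"
  assumes "\<And>N. \<exists>\<eta>>0. \<forall>i<N. \<forall>x\<in>R i. \<forall>y\<in>R N. \<eta> \<le> dist x y"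
  shows "(\<Sum>i<N. hausdorff_outer k (R i)) = hausdorff_outer k (\<Union>i<N. R i)"
proof (induction N)
  case (Suc N)
  obtain \<eta> where "\<eta> > 0" "\<forall>i<N. \<forall>x\<in>R i. \<forall>y\<in>R N. \<eta> \<le> dist x y"
    using assms by blast
  then have "hausdorff_outer k ((\<Union>i<N. R i) \<union> R N) =
      hausdorff_outer k (\<Union>i<N. R i) + hausdorff_outer k (R N)"
    by (intro hausdorff_outer_separated[of \<eta>]) auto
  moreover have "(\<Union>i<Suc N. R i) = (\<Union>i<N. R i) \<union> R N" by (auto simp: less_Suc_eq)
  ultimately show ?case using Suc by simp
qed simp

lemma infdist_diff_le_dist: "infdist x A - infdist y A \<le> dist x y"
  using infdist_triangle[of x A y] by simp

text \<open>
  Caratheodory's criterion for a closed set \<open>C\<close>: the layers of \<open>X - C\<close> at distance about \<open>1 / n\<close> from \<open>C\<close> with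
  even (odd) indices are mutually separated, so the measures of all layers are summable.
\<close>

lemma hausdorff_outer_closed_split:
  fixes C X :: "'a::metric_space set"
  assumes "closed C"
  shows "hausdorff_outer k (X \<inter> C) + hausdorff_outer k (X - C) = hausdorff_outer k X"
proof (cases "C = {} \<or> hausdorff_outer k X = \<infinity>")
  case True
  moreover have "hausdorff_outer k X \<le> hausdorff_outer k (X \<inter> C) + hausdorff_outer k (X - C)"
    using hausdorff_outer_Un_le[of k "X \<inter> C" "X - C"] by (simp add: Int_Diff_Un)
  ultimately show ?thesis by (auto simp: top_unique)
next
  case False
  then have C: "C \<noteq> {}" and fin: "hausdorff_outer k X < \<infinity>" by (auto simp: less_top)
  define D where "D n = {x \<in> X. 1 / real (Suc n) \<le> infdist x C}" for n
  define R where "R n = {x \<in> X. 1 / real (Suc (Suc n)) \<le> infdist x C \<and> infdist x C < 1 / real (Suc n)}" for n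
  have sep_D: "1 / real (Suc n) - 1 / real (Suc (Suc n)) \<le> dist x y"
    if "x \<in> D n" "y \<in> R (Suc n)" for x y n
    using infdist_diff_le_dist[of x C y] that by (auto simp: D_def R_def)
  have R_D: "R i \<subseteq> D n" if "i < n" for i n
  proof
    fix x assume "x \<in> R i"
    moreover have "1 / real (Suc n) \<le> 1 / real (Suc (Suc i))"
      using that by (intro divide_left_mono) auto
    ultimately show "x \<in> D n" by (auto simp: R_def D_def)
  qed
  \<comment> \<open>The parity \<open>p\<close> selects every second layer. Between two consecutive
    selected layers lies a whole skipped one, whose width is the separation
    \<open>\<eta>\<close>.\<close>
  have layers: "(\<Sum>i<N. hausdorff_outer k (R (2 * i + p))) \<le> hausdorff_outer k X" for N p
  proof (subst hausdorff_outer_sum_separated)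
    fix N
    show "\<exists>\<eta>>0. \<forall>i<N. \<forall>x\<in>R (2 * i + p). \<forall>y\<in>R (2 * N + p). \<eta> \<le> dist x y"
    proof (cases N)
      case (Suc M)
      define n where "n = 2 * M + p + 1"
      have "\<forall>i<N. \<forall>x\<in>R (2 * i + p). \<forall>y\<in>R (2 * N + p). 1 / real (Suc n) - 1 / real (Suc (Suc n)) \<le> dist x y"
      proof (intro allI impI ballI)
        fix i x y assume i: "i < N" "x \<in> R (2 * i + p)" "y \<in> R (2 * N + p)"
        have N: "2 * N + p = Suc n" using Suc by (simp add: n_def)
        have "2 * i + p < n" using Suc i(1) by (simp add: n_def)
        then have "x \<in> D n" using R_D i(2) by blast
        then show "1 / real (Suc n) - 1 / real (Suc (Suc n)) \<le> dist x y"
          using i(3) unfolding N by (rule sep_D)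
      qed
      moreover have "1 / real (Suc n) - 1 / real (Suc (Suc n)) > 0"
        using divide_strict_left_mono[of "real (Suc n)" "real (Suc (Suc n))" 1] by simp
      ultimately show ?thesis by blast
    qed (auto intro!: exI[of _ "1::real"])
  qed (rule hausdorff_outer_mono, auto simp: R_def)
  have "(\<Sum>i<2 * N. hausdorff_outer k (R i)) =
      (\<Sum>i<N. hausdorff_outer k (R (2 * i))) + (\<Sum>i<N. hausdorff_outer k (R (2 * i + 1)))" for N
    by (induction N) (auto simp: algebra_simps)
  then have "(\<Sum>i<2 * N. hausdorff_outer k (R i)) \<le> 2 * hausdorff_outer k X" for N
    using add_mono[OF layers[where p = 0] layers[where p = 1]] by (simp add: mult_2)
  moreover have "(\<Sum>i<N. hausdorff_outer k (R i)) \<le> (\<Sum>i<2 * N. hausdorff_outer k (R i))" for N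
    by (intro sum_mono2) auto
  ultimately have "(\<Sum>i<N. hausdorff_outer k (R i)) \<le> 2 * hausdorff_outer k X" for N
    by (rule order_trans[rotated])
  then have "(\<Sum>i. hausdorff_outer k (R i)) \<le> 2 * hausdorff_outer k X"
    unfolding suminf_eq_SUP by (intro SUP_least)
  also have "\<dots> < \<infinity>" using fin by (simp add: ennreal_mult_less_top)
  finally have sfin: "(\<Sum>i. hausdorff_outer k (R i)) < \<infinity>" .
  define a where "a i = enn2real (hausdorff_outer k (R i))" for i
  have "hausdorff_outer k (R i) < \<infinity>" for i
    using sfin ennreal_suminf_lessD[of "\<lambda>i. hausdorff_outer k (R i)"] by auto
  then have a: "hausdorff_outer k (R i) = ennreal (a i)" "0 \<le> a i" for i
    by (auto simp: a_def)
  have summ: "summable a"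
    using sfin a by (intro summable_suminf_not_top) auto
  show ?thesis
  proof (rule antisym)
    show "hausdorff_outer k X \<le> hausdorff_outer k (X \<inter> C) + hausdorff_outer k (X - C)"
      using hausdorff_outer_Un_le[of k "X \<inter> C" "X - C"] by (simp add: Int_Diff_Un)
    show "hausdorff_outer k (X \<inter> C) + hausdorff_outer k (X - C) \<le> hausdorff_outer k X"
    proof (rule ennreal_le_epsilon)
      fix e :: real assume "0 < e"
      obtain N where N: "\<And>n. N \<le> n \<Longrightarrow> norm (\<Sum>i. a (i + n)) < e"
        using suminf_exist_split[OF \<open>0 < e\<close> summ] by blast
      \<comment> \<open>As \<open>C\<close> is closed, a point of \<open>X - C\<close> has positive
        distance from it. Outside \<open>D N\<close>, the least \<open>j\<close> with
        \<open>1 / (j + 1)\<close> below that distance exceeds \<open>N\<close>, and the point lies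
        in the layer \<open>R (j - 1)\<close>.\<close>
      have "X - C \<subseteq> D N \<union> (\<Union>i. R (i + N))"
      proof
        fix x assume x: "x \<in> X - C"
        then have pos: "0 < infdist x C"
          using in_closed_iff_infdist_zero[OF assms C] infdist_nonneg[of x C] by force
        show "x \<in> D N \<union> (\<Union>i. R (i + N))"
        proof (cases "x \<in> D N")
          case False
          obtain m where m: "1 / real (Suc m) \<le> infdist x C"
            using nat_approx_posE[OF pos] by (metis less_imp_le)
          define j where "j = (LEAST m. 1 / real (Suc m) \<le> infdist x C)"
          have j: "1 / real (Suc j) \<le> infdist x C" unfolding j_def
            by (rule LeastI[of "\<lambda>m. 1 / real (Suc m) \<le> infdist x C", OF m])
          have jmin: "infdist x C < 1 / real (Suc i)" if "i < j" for i
            using not_less_Least[of i "\<lambda>m. 1 / real (Suc m) \<le> infdist x C", folded j_def, OF that]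
            by (rule not_le_imp_less)
          have "N < j"
          proof (rule ccontr)
            assume "\<not> N < j"
            then have "1 / real (Suc N) \<le> 1 / real (Suc j)" by (intro divide_left_mono) auto
            then show False using j False x by (simp add: D_def)
          qed
          then obtain i where i: "j = Suc (i + N)" by (metis add.commute less_imp_Suc_add)
          have "x \<in> R (i + N)"
            using j[unfolded i] jmin[unfolded i, of "i + N"] x unfolding R_def by blast
          then show ?thesis by blast
        qed simp
      qed
      then have "hausdorff_outer k (X - C) \<le> hausdorff_outer k (D N) + hausdorff_outer k (\<Union>i. R (i + N))"
        by (rule order_trans[OF hausdorff_outer_mono hausdorff_outer_Un_le])
      also have "hausdorff_outer k (\<Union>i. R (i + N)) \<le> (\<Sum>i. hausdorff_outer k (R (i + N)))"
        by (rule hausdorff_outer_UN_le)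
      also have "\<dots> = ennreal (\<Sum>i. a (i + N))"
        using a summable_ignore_initial_segment[OF summ] by (simp add: suminf_ennreal2)
      also have "\<dots> \<le> ennreal e" using N[of N] by (intro ennreal_leI) auto
      finally have le: "hausdorff_outer k (X - C) \<le> hausdorff_outer k (D N) + ennreal e"
        by (simp add: add_left_mono)
      have "hausdorff_outer k (X \<inter> C) + hausdorff_outer k (D N) = hausdorff_outer k (X \<inter> C \<union> D N)"
      proof (rule hausdorff_outer_separated[symmetric])
        show "0 < 1 / real (Suc N)" by simp
        fix x y assume "x \<in> X \<inter> C" "y \<in> D N"
        then show "1 / real (Suc N) \<le> dist x y"
          using infdist_le[of x C y] by (auto simp: D_def dist_commute)
      qed
      also have "\<dots> \<le> hausdorff_outer k X" by (rule hausdorff_outer_mono) (auto simp: D_def)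
      finally show "hausdorff_outer k (X \<inter> C) + hausdorff_outer k (X - C) \<le> hausdorff_outer k X + ennreal e"
        by (intro order_trans[OF add_left_mono[OF le]]) (subst add.assoc[symmetric], rule add_right_mono)
    qed
  qed
qed

text \<open>\<open>measure_of\<close> yields the prescribed function only if it is a measure on the
  given algebra, and 0 otherwise. Caratheodory's lemma makes it a measure on the sets that split
  every set additively; the closed sets, hence all Borel sets, are among these.\<close>

lemma emeasure_hausdorff_measure:
  fixes A :: "'a::metric_space set"
  assumes "A \<in> sets borel"
  shows "emeasure (hausdorff_measure k) A = hausdorff_outer k A"
proof -
  let ?f = "hausdorff_outer k :: 'a set \<Rightarrow> ennreal"
  let ?L = "lambda_system UNIV UNIV ?f"
  interpret S: sigma_algebra UNIV "UNIV :: 'a set set" using sigma_algebra_Pow[of UNIV] by simp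
  have "outer_measure_space UNIV ?f"
    unfolding outer_measure_space_def positive_def increasing_def countably_subadditive_def
    by (auto intro: hausdorff_outer_mono hausdorff_outer_UN_le)
  then have L: "measure_space UNIV ?L ?f" by (rule S.caratheodory_lemma)
  have "closed C \<Longrightarrow> C \<in> ?L" for C
    unfolding S.lambda_system_eq using hausdorff_outer_closed_split by auto
  then have "sigma_sets UNIV (Collect closed) \<subseteq> ?L"
    using L by (intro sigma_algebra.sigma_sets_subset) (auto simp: measure_space_def)
  then have sub: "sets (borel :: 'a measure) \<subseteq> ?L" by (simp add: borel_eq_closed)
  have "measure_space UNIV (sets (borel :: 'a measure)) ?f"
    by (rule measure_down[OF L _ sub]) (use sets.sigma_algebra_axioms[of "borel :: 'a measure"] in simp)
  then show ?thesis
    using assms unfolding hausdorff_measure_def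
    by (subst emeasure_measure_of_sigma) (auto simp: measure_space_def)
qed

lemma sets_hausdorff_measure [simp, measurable_cong]: "sets (hausdorff_measure k) = sets borel"
  unfolding hausdorff_measure_def
  by (subst sets_measure_of) (use sets.sigma_sets_eq[of borel] in auto)

lemma space_hausdorff_measure [simp]: "space (hausdorff_measure k) = UNIV"
  unfolding hausdorff_measure_def by (simp add: space_measure_of_conv)

section \<open>Lipschitz images and one-dimensional measure\<close>

lemma ennreal_inverse_mult_cancel:
  assumes "0 < c"
  shows "ennreal (inverse c) * (ennreal c * x) = x" "ennreal c * (ennreal (inverse c) * x) = x"
proof -
  have "ennreal (inverse c) * ennreal c = 1"
    using assms by (subst ennreal_mult[symmetric]) auto
  moreover have "ennreal c * ennreal (inverse c) = 1"
    using assms by (subst ennreal_mult[symmetric]) auto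
  ultimately show "ennreal (inverse c) * (ennreal c * x) = x" "ennreal c * (ennreal (inverse c) * x) = x"
    by (simp_all only: mult.assoc[symmetric] mult_1)
qed

text \<open>A cover of \<open>A\<close> of mesh \<open>\<delta> / L\<close> is carried to a cover of
  the image of mesh \<open>\<delta>\<close>, and gauges grow by at most \<open>L ^ k\<close>. The
  sets are cut down to \<open>A\<close> because \<open>f\<close> is Lipschitz only there.\<close>

lemma hausdorff_outer_lipschitz_image:
  fixes f :: "'a::metric_space \<Rightarrow> 'b::metric_space"
  assumes lip: "L-lipschitz_on A f" and "0 < L"
  shows "hausdorff_outer k (f ` A) \<le> ennreal (L ^ k) * hausdorff_outer k A"
proof (rule hausdorff_outer_le)
  fix \<delta> :: real assume "0 < \<delta>"
  have "hausdorff_pre k \<delta> (f ` A) \<le> ennreal (L ^ k) * hausdorff_pre k (\<delta> / L) A"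
  proof -
    \<comment> \<open>With the factor on the left the claim is a lower bound over all covers, and no
      infimum has to be pulled out of a product; cancellation moves the factor back
      afterwards.\<close>
    have "ennreal (inverse (L ^ k)) * hausdorff_pre k \<delta> (f ` A) \<le> hausdorff_pre k (\<delta> / L) A"
      unfolding hausdorff_pre_def[of k "\<delta> / L"]
    proof (rule INF_greatest)
      fix U :: "nat \<Rightarrow> 'a set"
      assume "U \<in> {U. A \<subseteq> (\<Union>i. U i) \<and> (\<forall>i. bounded (U i) \<and> diameter (U i) \<le> \<delta> / L)}"
      then have U: "A \<subseteq> (\<Union>i. U i)" "\<And>i. bounded (U i)" "\<And>i. diameter (U i) \<le> \<delta> / L" by auto
    define V where "V i = f ` (U i \<inter> A)" for i
    have bdU: "bounded (U i \<inter> A)" for i using U(2) by (meson bounded_Int)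
    have dV: "dist x y \<le> L * diameter (U i)" if "x \<in> V i" "y \<in> V i" for x y i
    proof -
      obtain u v where uv: "x = f u" "y = f v" "u \<in> U i" "v \<in> U i" "u \<in> A" "v \<in> A"
        using \<open>x \<in> V i\<close> \<open>y \<in> V i\<close> unfolding V_def by blast
      have "dist x y \<le> L * dist u v" using lipschitz_onD[OF lip] uv by blast
      also have "dist u v \<le> diameter (U i)" using diameter_bounded_bound U(2) uv by blast
      finally show ?thesis using \<open>0 < L\<close> by simp
    qed
    have bdV: "bounded (V i)" for i unfolding bounded_two_points using dV by blast
    have diamV: "diameter (V i) \<le> L * diameter (U i)" for i
    proof (cases "V i = {}")
      case False
      then show ?thesis
        unfolding diameter_def[of "V i"] using dV by (auto intro!: cSUP_least)
    next
      case True
      then show ?thesis using diameter_ge_0[OF U(2)] \<open>0 < L\<close> by simp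
    qed
    have gauge: "hausdorff_gauge k (V i) \<le> ennreal (L ^ k) * hausdorff_gauge k (U i)" for i
    proof (cases "V i = {}")
      case False
      then have "U i \<noteq> {}" by (auto simp: V_def)
      have "(diameter (V i) / 2) ^ k \<le> (L * diameter (U i) / 2) ^ k"
        using diamV[of i] diameter_ge_0[OF bdV] by (intro power_mono) auto
      then have "unit_ball_vol (real k) * (diameter (V i) / 2) ^ k
          \<le> unit_ball_vol (real k) * (L * diameter (U i) / 2) ^ k"
        by (intro mult_left_mono) auto
      also have "\<dots> = L ^ k * (unit_ball_vol (real k) * (diameter (U i) / 2) ^ k)"
        by (simp add: power_mult_distrib power_divide)
      finally show ?thesis
        using False \<open>U i \<noteq> {}\<close> \<open>0 < L\<close> diameter_ge_0[OF U(2)]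
        by (simp add: hausdorff_gauge_def ennreal_mult[symmetric])
    qed simp
    have "hausdorff_pre k \<delta> (f ` A) \<le> (\<Sum>i. hausdorff_gauge k (V i))"
    proof (rule hausdorff_pre_le)
      show "f ` A \<subseteq> (\<Union>i. V i)" using U(1) by (fastforce simp: V_def)
      fix i
      have "L * diameter (U i) \<le> \<delta>" using U(3)[of i] \<open>0 < L\<close> by (simp add: field_simps)
      then show "diameter (V i) \<le> \<delta>" using diamV[of i] by simp
    qed (rule bdV)
    also have "\<dots> \<le> (\<Sum>i. ennreal (L ^ k) * hausdorff_gauge k (U i))"
      using gauge by (intro suminf_le) auto
    finally have "ennreal (inverse (L ^ k)) * hausdorff_pre k \<delta> (f ` A)
        \<le> ennreal (inverse (L ^ k)) * (ennreal (L ^ k) * (\<Sum>i. hausdorff_gauge k (U i)))"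
        by (simp add: mult_left_mono)
      also have "\<dots> = (\<Sum>i. hausdorff_gauge k (U i))"
        using \<open>0 < L\<close> by (intro ennreal_inverse_mult_cancel) simp
      finally show "ennreal (inverse (L ^ k)) * hausdorff_pre k \<delta> (f ` A) \<le> (\<Sum>i. hausdorff_gauge k (U i))" .
    qed
    then have "ennreal (L ^ k) * (ennreal (inverse (L ^ k)) * hausdorff_pre k \<delta> (f ` A))
        \<le> ennreal (L ^ k) * hausdorff_pre k (\<delta> / L) A"
      by (rule mult_left_mono) simp
    then show ?thesis
      using \<open>0 < L\<close> by (subst (asm) ennreal_inverse_mult_cancel) simp_all
  qed
  also have "\<dots> \<le> ennreal (L ^ k) * hausdorff_outer k A"
    using \<open>0 < \<delta>\<close> \<open>0 < L\<close> by (intro mult_left_mono hausdorff_pre_le_outer) auto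
  finally show "hausdorff_pre k \<delta> (f ` A) \<le> ennreal (L ^ k) * hausdorff_outer k A" .
qed

text \<open>The index \<open>\<lfloor>x * (n + 1)\<rfloor>\<close> reaches \<open>n + 1\<close> at
  \<open>x = 1\<close>, so \<open>n + 2\<close> intervals of length \<open>1 / (n + 1)\<close> are
  used; \<open>(n + 2) / (n + 1) \<le> 2\<close> gives the crude constant.\<close>

lemma hausdorff_outer_1_unit_interval: "hausdorff_outer 1 {0..1::real} \<le> 2"
proof (rule hausdorff_outer_le)
  fix \<delta> :: real assume "0 < \<delta>"
  then obtain n where n: "1 / real (Suc n) < \<delta>" using nat_approx_posE by blast
  define V where "V i = {real i / real (Suc n) .. (real i + 1) / real (Suc n)}" for i
  have diam: "diameter (V i) = 1 / real (Suc n)" for i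
    unfolding V_def
    by (subst diameter_closed_interval) (auto simp: divide_right_mono not_less add_divide_distrib)
  have "{0..1} \<subseteq> (\<Union>i\<le>Suc n. V i)"
  proof
    fix x :: real assume x: "x \<in> {0..1}"
    define i where "i = nat \<lfloor>x * real (Suc n)\<rfloor>"
    have i: "real i \<le> x * real (Suc n)" "x * real (Suc n) \<le> real i + 1"
      using x by (auto simp: i_def)
    have "x * real (Suc n) \<le> real (Suc n)"
      using x mult_right_mono[of x 1 "real (Suc n)"] by simp
    then have "i \<le> Suc n" using i by linarith
    moreover have "x \<in> V i" using i by (simp add: V_def divide_simps)
    ultimately show "x \<in> (\<Union>i\<le>Suc n. V i)" by blast
  qed
  then have "hausdorff_pre 1 \<delta> {0..1::real} \<le> (\<Sum>i\<le>Suc n. hausdorff_gauge 1 (V i))"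
    using n \<open>0 < \<delta>\<close> by (intro hausdorff_pre_finite_le) (auto simp: diam, simp add: V_def)
  also have "\<dots> \<le> (\<Sum>i\<le>Suc n. ennreal (1 / real (Suc n)))"
  proof (rule sum_mono)
    fix i
    have "unit_ball_vol (real 1) * (diameter (V i) / 2) ^ 1 = 1 / real (Suc n)"
      by (simp add: diam unit_ball_vol_1 field_simps)
    then show "hausdorff_gauge 1 (V i) \<le> ennreal (1 / real (Suc n))"
      by (cases "V i = {}") (simp_all only: hausdorff_gauge_def if_True if_False simp_thms order_refl zero_le)
  qed
  also have "\<dots> = ennreal (real (Suc (Suc n)) / real (Suc n))"
    by (simp add: ennreal_of_nat_eq_real_of_nat ennreal_mult[symmetric] del: of_nat_Suc)
  also have "\<dots> \<le> ennreal 2" by (intro ennreal_leI) (simp add: field_simps)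
  finally show "hausdorff_pre 1 \<delta> {0..1::real} \<le> 2" by simp
qed

text \<open>The Lipschitz constant may be 0, hence \<open>L + e\<close> with \<open>e\<close>
  tending to 0. The factor 2 comes from the unit interval; finiteness and linearity in
  \<open>L\<close> are what later arguments rely on.\<close>

lemma emeasure_hausdorff_1_lipschitz_image:
  fixes f :: "real \<Rightarrow> 'a::metric_space"
  assumes "L-lipschitz_on {0..1} f"
  shows "emeasure (hausdorff_measure 1) (f ` {0..1}) \<le> ennreal (2 * L)"
proof -
  have L: "0 \<le> L" using assms by (rule lipschitz_on_nonneg)
  have "compact (f ` {0..1})"
    using assms by (intro compact_continuous_image lipschitz_on_continuous_on) auto
  then have eq: "emeasure (hausdorff_measure 1) (f ` {0..1}) = hausdorff_outer 1 (f ` {0..1})"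
    by (intro emeasure_hausdorff_measure borel_compact)
  have "hausdorff_outer 1 (f ` {0..1}) \<le> ennreal (2 * (L + e))" if "0 < e" for e
  proof -
    have "hausdorff_outer 1 (f ` {0..1}) \<le> ennreal ((L + e) ^ 1) * hausdorff_outer 1 {0..1::real}"
      using L that by (intro hausdorff_outer_lipschitz_image lipschitz_on_mono[OF assms]) auto
    also have "\<dots> \<le> ennreal ((L + e) ^ 1) * 2"
      by (intro mult_left_mono hausdorff_outer_1_unit_interval) auto
    also have "\<dots> = ennreal (2 * (L + e))" using L that by (simp add: ennreal_mult mult.commute)
    finally show ?thesis .
  qed
  note * = this
  show ?thesis unfolding eq
  proof (rule ennreal_le_epsilon)
    fix e :: real assume "0 < e"
    then show "hausdorff_outer 1 (f ` {0..1}) \<le> ennreal (2 * L) + ennreal e"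
      using *[of "e / 2"] L by (simp add: ennreal_plus[symmetric] algebra_simps del: ennreal_plus)
  qed
qed

section \<open>The Hausdorff measure of inlet windows\<close>

lemma closed_last_coord: "closed {x :: real ^ 'n::{finite,linorder}. last_coord x = c}"
  unfolding last_coord_def by (intro closed_Collect_eq continuous_intros)

lemma closed_H_in [simp]: "closed (H_in :: (real ^ 'n::{finite,linorder}) set)"
  unfolding H_in_def by (rule closed_last_coord)

text \<open>On the inlet hyperplane the last coordinate is 0 and satisfies the bound as well, so all
  coordinates can be treated alike.\<close>

lemma H_in_window_eq:
  "H_in_window N = {x :: real ^ 'n::{finite,linorder}. x \<in> H_in \<and> (\<forall>i. \<bar>x $ i\<bar> \<le> real N / 2)}"
proof -
  have "\<bar>a\<bar> \<le> real N / 2 \<longleftrightarrow> a \<in> {- (real N / 2)..real N / 2}" for a :: real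
    by auto
  note abs_iff = this
  have "(\<forall>i. i \<noteq> Max UNIV \<longrightarrow> \<bar>x $ i\<bar> \<le> real N / 2) \<longleftrightarrow> (\<forall>i. \<bar>x $ i\<bar> \<le> real N / 2)"
    if "x $ Max UNIV = 0" for x :: "(real, 'n) vec"
    using that by (metis abs_zero divide_nonneg_nonneg of_nat_0_le_iff zero_le_numeral)
  then show ?thesis
    unfolding H_in_window_def window_def H_in_def last_coord_def abs_iff[symmetric] by auto
qed

lemma closed_H_in_window [simp]: "closed (H_in_window N :: (real ^ 'n::{finite,linorder}) set)"
proof -
  have "closed {x :: (real, 'n) vec. \<forall>i. \<bar>x $ i\<bar> \<le> real N / 2}"
    by (intro closed_Collect_all closed_Collect_le continuous_intros)
  then show ?thesis
    unfolding H_in_window_eq Collect_conj_eq by (intro closed_Int) auto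
qed

lemma H_in_window_add:
  assumes "x \<in> H_in_window M" "y \<in> H_in_window N"
  shows "x + y \<in> H_in_window (M + N)"
proof -
  have "\<bar>(x + y) $ i\<bar> \<le> real (M + N) / 2" for i
  proof -
    have "\<bar>x $ i\<bar> \<le> real M / 2" "\<bar>y $ i\<bar> \<le> real N / 2"
      using assms unfolding H_in_window_eq by blast+
    then show ?thesis
      using abs_triangle_ineq[of "x $ i" "y $ i"] by (simp add: add_divide_distrib)
  qed
  then show ?thesis using assms by (auto simp: H_in_window_eq H_in_def last_coord_def)
qed

lemma H_in_window_uminus: "x \<in> H_in_window N \<Longrightarrow> - x \<in> H_in_window N"
  by (auto simp: H_in_window_eq H_in_def last_coord_def)

lemma H_in_eq_Union_windows: "(H_in :: (real ^ 'n::{finite,linorder}) set) = (\<Union>N. H_in_window N)"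
proof
  show "(H_in :: (real, 'n) vec set) \<subseteq> (\<Union>N. H_in_window N)"
  proof
    fix x :: "(real, 'n) vec" assume x: "x \<in> H_in"
    obtain N where "2 * norm x \<le> real N" using real_arch_simple by blast
    then have "\<bar>x $ i\<bar> \<le> real N / 2" for i using component_le_norm_cart[of x i] by linarith
    then show "x \<in> (\<Union>N. H_in_window N)" using x by (auto simp: H_in_window_eq)
  qed
qed (auto simp: H_in_window_eq)

lemma norm_le_H_in_window:
  assumes "x \<in> H_in_window N"
  shows "norm (x :: real ^ 'n::{finite,linorder}) \<le> real CARD('n) * real N"
proof -
  have "norm x \<le> (\<Sum>i\<in>UNIV. \<bar>x $ i\<bar>)" by (rule norm_le_l1_cart)
  also have "\<dots> \<le> (\<Sum>i\<in>(UNIV :: 'n set). real N / 2)"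
    using assms by (intro sum_mono) (auto simp: H_in_window_eq)
  also have "\<dots> \<le> real CARD('n) * real N" by (simp add: field_simps)
  finally show ?thesis .
qed

lemma H_in_window_if_norm_le:
  assumes "x \<in> H_in" "norm x \<le> real N / 2"
  shows "x \<in> H_in_window N"
  using assms order_trans[OF component_le_norm_cart] unfolding H_in_window_eq by blast

section \<open>Translation, scaling, and the measure of the unit window\<close>

lemma hausdorff_outer_translate:
  "hausdorff_outer k ((+) (x :: 'a::real_normed_vector) ` A) = hausdorff_outer k A"
proof (rule antisym)
  have *: "hausdorff_outer k ((+) y ` B) \<le> hausdorff_outer k B" for y :: 'a and B
    using hausdorff_outer_lipschitz_image[of 1 B "(+) y" k]
    by (auto simp: lipschitz_on_def dist_norm)
  show "hausdorff_outer k ((+) x ` A) \<le> hausdorff_outer k A" by (rule *)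
  show "hausdorff_outer k A \<le> hausdorff_outer k ((+) x ` A)"
    using *[of "- x" "(+) x ` A"] by (simp add: image_image)
qed

lemma hausdorff_outer_scale_le:
  assumes "0 < c"
  shows "hausdorff_outer k ((*\<^sub>R) c ` (A :: 'a::real_normed_vector set)) \<le> ennreal (c ^ k) * hausdorff_outer k A"
  using assms
  by (intro hausdorff_outer_lipschitz_image)
    (auto simp: lipschitz_on_def dist_norm scaleR_diff_right[symmetric])

lemma hausdorff_outer_scale:
  assumes "0 < c"
  shows "hausdorff_outer k ((*\<^sub>R) c ` (A :: 'a::real_normed_vector set)) = ennreal (c ^ k) * hausdorff_outer k A"
proof (rule antisym)
  have "hausdorff_outer k A = hausdorff_outer k ((*\<^sub>R) (inverse c) ` (*\<^sub>R) c ` A)"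
    using assms by (simp add: image_image)
  also have "\<dots> \<le> ennreal (inverse c ^ k) * hausdorff_outer k ((*\<^sub>R) c ` A)"
    using assms by (intro hausdorff_outer_scale_le) simp
  finally have "ennreal (c ^ k) * hausdorff_outer k A
      \<le> ennreal (c ^ k) * (ennreal (inverse (c ^ k)) * hausdorff_outer k ((*\<^sub>R) c ` A))"
    by (intro mult_left_mono) (auto simp: power_inverse)
  also have "\<dots> = hausdorff_outer k ((*\<^sub>R) c ` A)"
    using assms by (intro ennreal_inverse_mult_cancel) simp
  finally show "ennreal (c ^ k) * hausdorff_outer k A \<le> hausdorff_outer k ((*\<^sub>R) c ` A)" .
qed (rule hausdorff_outer_scale_le[OF assms])

lemma scaleR_H_in_window:
  assumes "0 < N"
  shows "H_in_window N = (*\<^sub>R) (real N) ` (H_in_window 1 :: (real ^ 'n::{finite,linorder}) set)"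
proof
  show "H_in_window N \<subseteq> (*\<^sub>R) (real N) ` (H_in_window 1 :: (real, 'n) vec set)"
  proof
    fix x :: "(real, 'n) vec" assume "x \<in> H_in_window N"
    then have "(1 / real N) *\<^sub>R x \<in> H_in_window 1"
      using assms by (auto simp: H_in_window_eq H_in_def last_coord_def abs_mult field_simps)
    moreover have "x = real N *\<^sub>R ((1 / real N) *\<^sub>R x)" using assms by simp
    ultimately show "x \<in> (*\<^sub>R) (real N) ` H_in_window 1" by blast
  qed
qed (use assms in \<open>auto simp: H_in_window_eq H_in_def last_coord_def abs_mult field_simps\<close>)

definition inlet_unit :: "'n::{finite,linorder} itself \<Rightarrow> ennreal" where
  "inlet_unit _ = hausdorff_outer (CARD('n) - 1) (H_in_window 1 :: (real ^ 'n::{finite,linorder}) set)"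

text \<open>For \<open>N > 0\<close> this is scaling of the unit window. The window for
  \<open>N = 0\<close> is a single point, of gauge 0 because the dimension
  \<open>CARD('n) - 1\<close> is at least 1.\<close>

lemma hausdorff_outer_H_in_window:
  assumes "CARD('n) \<ge> 2"
  shows "hausdorff_outer (CARD('n) - 1) (H_in_window N :: (real ^ 'n::{finite,linorder}) set) =
    ennreal (real N ^ (CARD('n) - 1)) * inlet_unit TYPE('n)"
proof (cases "N = 0")
  case True
  have "H_in_window 0 = {0 :: (real, 'n) vec}"
    by (auto simp: H_in_window_eq H_in_def last_coord_def vec_eq_iff)
  moreover have "hausdorff_outer (CARD('n) - 1) {0 :: (real, 'n) vec} \<le> 0"
  proof (rule hausdorff_outer_le)
    fix \<delta> :: real assume "0 < \<delta>"
    then have "hausdorff_pre (CARD('n) - 1) \<delta> {0 :: (real, 'n) vec}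
        \<le> (\<Sum>i\<in>{()}. hausdorff_gauge (CARD('n) - 1) {0 :: (real, 'n) vec})"
      by (intro hausdorff_pre_finite_le) auto
    also have "\<dots> = 0" using assms by (simp add: hausdorff_gauge_def)
    finally show "hausdorff_pre (CARD('n) - 1) \<delta> {0 :: (real, 'n) vec} \<le> 0" .
  qed
  ultimately show ?thesis using True assms by simp
next
  case False
  then show ?thesis
    unfolding inlet_unit_def by (subst scaleR_H_in_window) (auto simp: hausdorff_outer_scale)
qed

text \<open>The window is cut into cells of side \<open>1 / j\<close>, with \<open>j\<close> adapted
  to the mesh. There are \<open>(j + 1) ^ m\<close> of them, of diameter at most
  \<open>CARD('n) / j\<close>, and \<open>(j + 1) / (2 * j) \<le> 1\<close> makes the total
  independent of \<open>j\<close>.\<close>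

lemma inlet_unit_finite: "inlet_unit TYPE('n::{finite,linorder}) < \<infinity>"
proof -
  define m where "m = CARD('n) - 1"
  let ?W = "H_in_window 1 :: (real, 'n) vec set"
  have bound: "hausdorff_pre m \<delta> ?W \<le> ennreal (unit_ball_vol (real m) * real CARD('n) ^ m)" if "0 < \<delta>" for \<delta>
  proof -
    obtain j0 where "real CARD('n) / \<delta> \<le> real j0" using real_arch_simple by blast
    define j where "j = max 1 j0"
    have j: "1 \<le> j" "real CARD('n) / real j \<le> \<delta>"
    proof -
      have "real CARD('n) / \<delta> \<le> real j" using \<open>_ \<le> real j0\<close> by (simp add: j_def)
      moreover show "1 \<le> j" by (simp add: j_def)
      ultimately show "real CARD('n) / real j \<le> \<delta>" using \<open>0 < \<delta>\<close> by (simp add: field_simps)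
    qed
    define g where "g x = (\<lambda>i. \<lfloor>real j * (x $ i + 1 / 2)\<rfloor>)" for x :: "(real, 'n) vec"
    define V where "V k = {x \<in> ?W. g x = k}" for k
    \<comment> \<open>The index \<open>j\<close> occurs at the right end \<open>1 / 2\<close> of a
      coordinate, whence \<open>j + 1\<close> values. The last coordinate is constantly 0 and
      contributes one value, so the cardinality has exponent \<open>m\<close>.\<close>
    define K where "K = (\<Pi>\<^sub>E i\<in>(UNIV :: 'n set). if i = Max UNIV then {\<lfloor>real j / 2\<rfloor>} else {0..int j})"
    have finK: "finite K" unfolding K_def by (intro finite_PiE) auto
    have "card K = (\<Prod>i\<in>(UNIV :: 'n set). if i = Max UNIV then 1 else Suc j)"
      unfolding K_def by (subst card_PiE) (auto intro!: prod.cong)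
    also have "\<dots> = Suc j ^ m"
      by (subst prod.remove[of _ "Max UNIV"]) (auto simp: m_def card_Diff_singleton)
    finally have cardK: "card K = Suc j ^ m" .
    have cover: "?W \<subseteq> (\<Union>k\<in>K. V k)"
    proof
      fix x assume x: "x \<in> ?W"
      have "g x i \<in> (if i = Max UNIV then {\<lfloor>real j / 2\<rfloor>} else {0..int j})" for i
      proof (cases "i = Max UNIV")
        case True
        then show ?thesis using x by (simp add: g_def H_in_window_eq H_in_def last_coord_def)
      next
        case False
        have "\<bar>x $ i\<bar> \<le> 1 / 2" using x by (auto simp: H_in_window_eq)
        then have "0 \<le> x $ i + 1 / 2" "x $ i + 1 / 2 \<le> 1" by (auto simp: abs_le_iff)
        then have "0 \<le> real j * (x $ i + 1 / 2)" "real j * (x $ i + 1 / 2) \<le> real j"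
          using mult_left_mono[of "x $ i + 1 / 2" 1 "real j"] by auto
        then show ?thesis using False by (simp add: g_def le_floor_iff floor_le_iff)
      qed
      then have "g x \<in> K" by (auto simp: K_def)
      then show "x \<in> (\<Union>k\<in>K. V k)" using x by (auto simp: V_def)
    qed
    have dist: "dist x y \<le> real CARD('n) / real j" if "x \<in> V k" "y \<in> V k" for x y k
    proof -
      have "\<bar>(x - y) $ i\<bar> \<le> 1 / real j" for i
      proof -
        have "\<lfloor>real j * (x $ i + 1 / 2)\<rfloor> = \<lfloor>real j * (y $ i + 1 / 2)\<rfloor>"
          using that by (auto simp: V_def g_def dest: fun_cong[of _ _ i])
        then have "\<bar>real j * (x $ i + 1 / 2) - real j * (y $ i + 1 / 2)\<bar> \<le> 1" by linarith
        then have "\<bar>real j * (x $ i - y $ i)\<bar> \<le> 1" by (simp add: algebra_simps)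
        then show ?thesis using j unfolding abs_mult by (simp add: field_simps)
      qed
      then have "(\<Sum>i\<in>(UNIV :: 'n set). \<bar>(x - y) $ i\<bar>) \<le> (\<Sum>i\<in>(UNIV :: 'n set). 1 / real j)"
        by (intro sum_mono)
      then show ?thesis using norm_le_l1_cart[of "x - y"] by (simp add: dist_norm)
    qed
    have bdV: "bounded (V k)" for k using dist unfolding bounded_two_points by blast
    have diam: "diameter (V k) \<le> real CARD('n) / real j" for k
      using dist by (intro diameter_le) (auto simp: dist_norm)
    have "hausdorff_pre m \<delta> ?W \<le> (\<Sum>k\<in>K. hausdorff_gauge m (V k))"
      using finK cover bdV diam j(2) \<open>0 < \<delta>\<close>
      by (intro hausdorff_pre_finite_le) (auto intro: order_trans)
    also have "\<dots> \<le> (\<Sum>k\<in>K. ennreal (unit_ball_vol (real m) * (real CARD('n) / real j / 2) ^ m))"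
    proof (rule sum_mono)
      fix k
      show "hausdorff_gauge m (V k) \<le> ennreal (unit_ball_vol (real m) * (real CARD('n) / real j / 2) ^ m)"
        using diam[of k] diameter_ge_0[OF bdV[of k]] unfolding hausdorff_gauge_def
        by (auto intro!: ennreal_leI mult_left_mono power_mono divide_right_mono)
    qed
    also have "\<dots> = ennreal (real (Suc j) ^ m * (unit_ball_vol (real m) * (real CARD('n) / real j / 2) ^ m))"
      by (simp add: cardK ennreal_of_nat_eq_real_of_nat ennreal_mult[symmetric] del: of_nat_Suc)
    also have "\<dots> \<le> ennreal (unit_ball_vol (real m) * real CARD('n) ^ m)"
    proof (rule ennreal_leI)
      have "real (Suc j) * (real CARD('n) / real j / 2) \<le> real CARD('n)"
        using j(1) by (simp add: field_simps)
      then have "(real (Suc j) * (real CARD('n) / real j / 2)) ^ m \<le> real CARD('n) ^ m"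
        by (intro power_mono) auto
      then have "unit_ball_vol (real m) * (real (Suc j) * (real CARD('n) / real j / 2)) ^ m
          \<le> unit_ball_vol (real m) * real CARD('n) ^ m"
        by (intro mult_left_mono) auto
      then show "real (Suc j) ^ m * (unit_ball_vol (real m) * (real CARD('n) / real j / 2) ^ m)
          \<le> unit_ball_vol (real m) * real CARD('n) ^ m"
        unfolding power_mult_distrib by (simp add: mult_ac)
    qed
    finally show ?thesis .
  qed
  have "inlet_unit TYPE('n) \<le> ennreal (unit_ball_vol (real m) * real CARD('n) ^ m)"
    unfolding inlet_unit_def m_def[symmetric] using bound by (rule hausdorff_outer_le)
  then show ?thesis by (simp add: le_less_trans)
qed

lemma emeasure_lborel_cbox_cart:
  assumes "\<And>i. a $ i \<le> b $ i"
  shows "emeasure lborel (cbox a b :: (real ^ 'n::finite) set) = ennreal (\<Prod>i\<in>UNIV. b $ i - a $ i)"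
proof -
  have "cbox a b \<noteq> {}" using assms by (simp add: interval_ne_empty_cart)
  then have "measure lborel (cbox a b) = (\<Prod>i\<in>UNIV. b $ i - a $ i)" by (rule content_cbox_cart)
  then show ?thesis by (subst emeasure_eq_ennreal_measure) (auto simp: emeasure_lborel_cbox_eq)
qed

text \<open>Thickening a cover of the inlet window in the last coordinate gives a cover of a unit cube by boxes.\<close>

lemma inlet_unit_pos: "0 < inlet_unit TYPE('n::{finite,linorder})"
proof -
  define m where "m = CARD('n) - 1"
  define l :: 'n where "l = Max UNIV"
  let ?W = "H_in_window 1 :: (real, 'n) vec set"
  \<comment> \<open>A set of diameter \<open>d\<close> is thickened to a box of volume
    \<open>(2 * d) ^ m\<close>. As its gauge contains \<open>(d / 2) ^ m\<close>, the factor
    \<open>4 ^ m\<close> over the volume of the unit ball converts the one into the other.\<close>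
  define c where "c = 4 ^ m / unit_ball_vol (real m)"
  have c: "0 < c" by (simp add: c_def)
  define box where "box p d = cbox (\<chi> i. if i = l then 0 else p $ i - d) (\<chi> i. if i = l then 1 else p $ i + d)"
    for p :: "(real, 'n) vec" and d
  have mem_box: "x \<in> box p d \<longleftrightarrow> x $ l \<in> {0..1} \<and> (\<forall>i. i \<noteq> l \<longrightarrow> \<bar>x $ i - p $ i\<bar> \<le> d)" for x p d
  proof -
    have "\<bar>a - b\<bar> \<le> d \<longleftrightarrow> b - d \<le> a \<and> a \<le> b + d" for a b by (auto simp: abs_le_iff)
    then show ?thesis unfolding box_def mem_box_cart by auto
  qed
  have emeasure_box: "emeasure lborel (box p d) = ennreal ((2 * d) ^ m)" if "0 \<le> d" for p d
  proof -
    have "emeasure lborel (box p d) = ennreal (\<Prod>i\<in>UNIV. if i = l then 1 else 2 * d)"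
      unfolding box_def using that
      by (subst emeasure_lborel_cbox_cart) (auto intro!: arg_cong[where f = ennreal] prod.cong)
    also have "(\<Prod>i\<in>UNIV. if i = l then 1 else 2 * d) = (2 * d) ^ m"
      by (subst prod.remove[of _ l]) (auto simp: m_def card_Diff_singleton)
    finally show ?thesis .
  qed
  \<comment> \<open>Any single mesh bounds the outer measure from below, so mesh 1 may be taken. A
    cheaper cover would give the unit box a volume below 1.\<close>
  have "1 \<le> ennreal c * hausdorff_pre m 1 ?W"
  proof (rule ccontr)
    assume "\<not> ?thesis"
    then have "ennreal (inverse c) * (ennreal c * hausdorff_pre m 1 ?W) < ennreal (inverse c) * 1"
      using c by (intro ennreal_mult_strict_left_mono) (auto simp: ennreal_zero_less_mult_iff less_top)
    then have "hausdorff_pre m 1 ?W < ennreal (inverse c)"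
      by (simp add: ennreal_inverse_mult_cancel[OF c])
    then obtain U where U: "?W \<subseteq> (\<Union>i. U i)" "\<And>i. bounded (U i)"
      "\<And>i. diameter (U i) \<le> 1" "(\<Sum>i. hausdorff_gauge m (U i)) < ennreal (inverse c)"
      by (rule hausdorff_pre_lessE) (rule that)
    define p where "p i = (SOME x. x \<in> U i)" for i
    define V where "V i = (if U i = {} then {} else box (p i) (diameter (U i)))" for i
    have p: "p i \<in> U i" if "U i \<noteq> {}" for i
      unfolding p_def using that by (simp add: some_in_eq)
    have cover: "box 0 (1 / 2) \<subseteq> (\<Union>i. V i)"
    proof
      fix x assume x: "x \<in> box 0 (1 / 2)"
      \<comment> \<open>\<open>y\<close> is the foot of \<open>x\<close> on the hyperplane. A
        covering set that contains \<open>y\<close> lies within its diameter of \<open>p i\<close>,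
        and the box above it therefore contains \<open>x\<close>.\<close>
      define y where "y = (\<chi> i. if i = l then 0 else x $ i)"
      have "y \<in> ?W"
        using x by (auto simp: mem_box y_def H_in_window_eq H_in_def last_coord_def l_def)
      then obtain i where i: "y \<in> U i" using U(1) by blast
      then have ne: "U i \<noteq> {}" by blast
      have "\<bar>x $ k - p i $ k\<bar> \<le> diameter (U i)" if "k \<noteq> l" for k
      proof -
        have "\<bar>x $ k - p i $ k\<bar> = \<bar>(y - p i) $ k\<bar>" using that by (simp add: y_def)
        also have "\<dots> \<le> dist y (p i)" unfolding dist_norm by (rule component_le_norm_cart)
        also have "\<dots> \<le> diameter (U i)" using U(2) i p[OF ne] by (rule diameter_bounded_bound)
        finally show ?thesis .
      qed
      then have "x \<in> V i" using x ne by (auto simp: V_def mem_box)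
      then show "x \<in> (\<Union>i. V i)" by blast
    qed
    have "1 = emeasure lborel (box 0 (1 / 2))" by (simp add: emeasure_box)
    also have "\<dots> \<le> emeasure lborel (\<Union>i. V i)"
      by (rule emeasure_mono[OF cover]) (auto simp: V_def box_def)
    also have "\<dots> \<le> (\<Sum>i. emeasure lborel (V i))"
      by (rule emeasure_subadditive_countably) (auto simp: V_def box_def)
    also have "\<dots> \<le> (\<Sum>i. ennreal c * hausdorff_gauge m (U i))"
    proof (intro suminf_le allI)
      fix i
      show "emeasure lborel (V i) \<le> ennreal c * hausdorff_gauge m (U i)"
      proof (cases "U i = {}")
        case False
        define d where "d = diameter (U i)"
        have d: "0 \<le> d" unfolding d_def by (rule diameter_ge_0[OF U(2)])
        have "c * (unit_ball_vol (real m) * (d / 2) ^ m) = (2 * d) ^ m"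
        proof -
          have "(2 * d) ^ m = (4 * (d / 2)) ^ m" by simp
          also have "\<dots> = 4 ^ m * (d / 2) ^ m" by (rule power_mult_distrib)
          moreover have "unit_ball_vol (real m) \<noteq> 0" by (simp add: less_imp_neq[symmetric])
          ultimately show ?thesis by (simp add: c_def)
        qed
        then show ?thesis
          using False c d by (simp add: V_def hausdorff_gauge_def emeasure_box ennreal_mult[symmetric]
              flip: d_def)
      qed (simp add: V_def)
    qed auto
    also have "\<dots> = ennreal c * (\<Sum>i. hausdorff_gauge m (U i))" by simp
    also have "\<dots> < ennreal c * ennreal (inverse c)"
      using U(4) c by (intro ennreal_mult_strict_left_mono) auto
    also have "\<dots> = 1" using c by (simp add: ennreal_mult[symmetric])
    finally show False by simp
  qed
  also have "\<dots> \<le> ennreal c * inlet_unit TYPE('n)"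
    unfolding inlet_unit_def m_def[symmetric]
    by (intro mult_left_mono hausdorff_pre_le_outer) auto
  finally have "inlet_unit TYPE('n) \<noteq> 0" by auto
  then show ?thesis by (simp add: zero_less_iff_neq_zero)
qed

section \<open>Measurability of the geodesic length\<close>

lemma paths_mono: "Q \<subseteq> F \<Longrightarrow> paths Q x F1 \<subseteq> paths F x F1"
  unfolding paths_def using interior_mono[of Q F] by auto

lemma geodesic_length_antimono: "Q \<subseteq> F \<Longrightarrow> geodesic_length F x F1 \<le> geodesic_length Q x F1"
  unfolding geodesic_length_def by (intro INF_superset_mono paths_mono) auto

lemma compact_path_image: "f \<in> paths F x F1 \<Longrightarrow> compact (f ` {0..1})"
  unfolding paths_def by (auto intro!: compact_continuous_image lipschitz_on_continuous_on)

text \<open>Lipschitz paths have finite length, and the infimum over no path is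
  \<open>\<infinity>\<close>. Connectedness thus becomes an event about the geodesic length, and one
  measurability proof serves both.\<close>

lemma connected_points_eq: "connected_points F F1 = {x. geodesic_length F x F1 < \<infinity>}"
proof -
  have "geodesic_length F x F1 < \<infinity>" if f: "f \<in> paths F x F1" for x f
  proof -
    obtain L where "L-lipschitz_on {0..1} f" using f unfolding paths_def by blast
    then have "emeasure (hausdorff_measure 1) (f ` {0..1}) \<le> ennreal (2 * L)"
      by (rule emeasure_hausdorff_1_lipschitz_image)
    then have "geodesic_length F x F1 \<le> ennreal (2 * L)"
      unfolding geodesic_length_def using f by (intro INF_lower2)
    then show ?thesis by (simp add: le_less_trans)
  qed
  moreover have "geodesic_length F x F1 = \<infinity>" if "paths F x F1 = {}" for x
    using that by (simp add: geodesic_length_def)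
  ultimately show ?thesis unfolding connected_points_def by fastforce
qed

text \<open>Traversing the segment in the first half of the time and \<open>f\<close> in the second
  keeps the path Lipschitz. This is the device for moving the starting point.\<close>

lemma paths_prepend_segment:
  fixes x y :: "'a::real_normed_vector"
  assumes f: "f \<in> paths F x F1" and seg: "closed_segment y x \<subseteq> interior F"
  obtains g where "g \<in> paths F y F1" "g ` {0..1} \<subseteq> closed_segment y x \<union> f ` {0..1}"
proof -
  define g where "g t = (if t \<le> 1/2 then linepath y x (2 * t) else f (2 * t - 1))" for t :: real
  obtain L where L: "L-lipschitz_on {0..1} f" using f unfolding paths_def by blast
  have f01: "f ` {0..1} \<subseteq> interior F" "f 0 = x" "f 1 \<in> F1" using f by (auto simp: paths_def)
  have "(2 * dist x y)-lipschitz_on {0..1/2} (\<lambda>t. linepath y x (2 * t))"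
  proof (rule lipschitz_onI)
    fix s t :: real
    have "linepath y x (2 * s) - linepath y x (2 * t) = (2 * (s - t)) *\<^sub>R (x - y)"
      by (simp add: linepath_def algebra_simps)
    then have "dist (linepath y x (2 * s)) (linepath y x (2 * t)) = \<bar>2 * (s - t)\<bar> * norm (x - y)"
      unfolding dist_norm by (simp only: norm_scaleR)
    also have "\<bar>2 * (s - t)\<bar> = 2 * \<bar>s - t\<bar>" by (subst abs_mult) (simp only: abs_numeral)
    finally show "dist (linepath y x (2 * s)) (linepath y x (2 * t)) \<le> 2 * dist x y * dist s t"
      by (simp add: dist_norm)
  qed simp
  moreover have "(2 * L)-lipschitz_on {1/2..1} (\<lambda>t. f (2 * t - 1))"
  proof (rule lipschitz_onI)
    fix s t :: real assume "s \<in> {1/2..1}" "t \<in> {1/2..1}"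
    then have "dist (f (2 * s - 1)) (f (2 * t - 1)) \<le> L * dist (2 * s - 1) (2 * t - 1)"
      by (intro lipschitz_onD[OF L]) auto
    also have "dist (2 * s - 1) (2 * t - 1) = 2 * dist s t"
    proof -
      have "(2 * s - 1) - (2 * t - 1) = 2 * (s - t)" by simp
      then show ?thesis unfolding dist_real_def by (simp only: abs_mult abs_numeral)
    qed
    finally show "dist (f (2 * s - 1)) (f (2 * t - 1)) \<le> 2 * L * dist s t" by simp
  qed (use lipschitz_on_nonneg[OF L] in simp)
  ultimately have lip: "(max (2 * dist x y) (2 * L))-lipschitz_on {0..1} g"
    unfolding g_def by (rule lipschitz_on_concat_max) (simp add: f01 linepath_def)
  have img: "g ` {0..1} \<subseteq> closed_segment y x \<union> f ` {0..1}"
  proof (rule image_subsetI)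
    fix t :: real assume t: "t \<in> {0..1}"
    show "g t \<in> closed_segment y x \<union> f ` {0..1}"
    proof (cases "t \<le> 1/2")
      case True
      then have "2 * t \<in> {0..1}" "g t = linepath y x (2 * t)" using t by (simp_all add: g_def)
      then have "g t \<in> linepath y x ` {0..1}" by (simp only: imageI)
      then show ?thesis unfolding linepath_image_01 by (rule UnI1)
    next
      case False
      then have "2 * t - 1 \<in> {0..1}" using t by auto
      then show ?thesis using False by (auto simp: g_def)
    qed
  qed
  have "g 0 = y" "g 1 = f 1" by (auto simp: g_def linepath_def)
  moreover have "g ` {0..1} \<subseteq> interior F" using img seg f01(1) by (meson Un_least subset_trans)
  ultimately have "g \<in> paths F y F1"
    unfolding paths_def using lip f01(3) by (intro CollectI conjI exI) simp_all
  then show thesis using img by (rule that)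
qed

lemma emeasure_hausdorff_1_segment:
  fixes x y :: "'a::real_normed_vector"
  shows "emeasure (hausdorff_measure 1) (closed_segment x y) \<le> ennreal (2 * dist x y)"
proof -
  have "(dist x y)-lipschitz_on {0..1} (linepath x y)"
  proof (rule lipschitz_onI)
    fix s t :: real
    have "linepath x y s - linepath x y t = (t - s) *\<^sub>R (x - y)"
      by (simp add: linepath_def algebra_simps)
    then show "dist (linepath x y s) (linepath x y t) \<le> dist x y * dist s t"
      by (simp add: dist_norm abs_minus_commute)
  qed simp
  from emeasure_hausdorff_1_lipschitz_image[OF this] show ?thesis
    by (simp add: linepath_image_01)
qed

text \<open>Upper semicontinuity in the starting point: from a nearby \<open>y\<close> one goes
  straight to \<open>x\<close>, inside a ball contained in the interior, and then follows a path
  whose length is below \<open>a\<close>.\<close>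

lemma open_geodesic_length_less:
  fixes F F1 :: "'a::real_normed_vector set"
  shows "open {x. geodesic_length F x F1 < a}"
  unfolding open_dist
proof (intro ballI)
  fix x assume "x \<in> {x. geodesic_length F x F1 < a}"
  then obtain f where f: "f \<in> paths F x F1" "emeasure (hausdorff_measure 1) (f ` {0..1}) < a"
    unfolding geodesic_length_def by (auto simp: INF_less_iff)
  define h where "h = emeasure (hausdorff_measure 1) (f ` {0..1})"
  \<comment> \<open>The allowance for the detour is \<open>2 * e\<close>, because
    \<open>emeasure_hausdorff_1_segment\<close> charges a segment twice its length.\<close>
  have "\<exists>e>0. h + ennreal (2 * e) < a"
  proof (cases a)
    case (real r)
    then obtain s where s: "h = ennreal s" "0 \<le> s" "s < r"
      using f(2) unfolding h_def[symmetric] by (cases h) (auto simp: ennreal_less_iff)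
    then have "s + 2 * ((r - s) / 4) < r" "0 < r" by argo+
    then have "ennreal (s + 2 * ((r - s) / 4)) < ennreal r" by (intro ennreal_lessI)
    then show ?thesis using s real by (intro exI[of _ "(r - s) / 4"]) simp
  next
    case top
    then show ?thesis using f(2) unfolding h_def[symmetric] by (intro exI[of _ 1]) simp
  qed
  then obtain e where e: "0 < e" "h + ennreal (2 * e) < a" by blast
  have "x \<in> interior F" using f(1) by (auto simp: paths_def)
  then obtain r where r: "0 < r" "ball x r \<subseteq> interior F" using open_contains_ball[of "interior F"] by auto
  show "\<exists>e>0. \<forall>y. dist y x < e \<longrightarrow> y \<in> {x. geodesic_length F x F1 < a}"
  proof (intro exI[of _ "min r e"] conjI allI impI)
    fix y assume y: "dist y x < min r e"
    have "closed_segment y x \<subseteq> ball x r"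
      using y r by (intro closed_segment_subset) (auto simp: dist_commute)
    then obtain g where g: "g \<in> paths F y F1" "g ` {0..1} \<subseteq> closed_segment y x \<union> f ` {0..1}"
      using paths_prepend_segment[OF f(1)] r(2) by (metis subset_trans)
    have [measurable]: "closed_segment y x \<in> sets borel" "f ` {0..1} \<in> sets borel"
      using compact_path_image[OF f(1)] by (auto intro: borel_compact)
    have "geodesic_length F y F1 \<le> emeasure (hausdorff_measure 1) (g ` {0..1})"
      unfolding geodesic_length_def using g(1) by (rule INF_lower)
    also have "\<dots> \<le> emeasure (hausdorff_measure 1) (closed_segment y x \<union> f ` {0..1})"
      using g(2) by (rule emeasure_mono) simp
    also have "\<dots> \<le> emeasure (hausdorff_measure 1) (closed_segment y x) + h"
      unfolding h_def by (rule emeasure_subadditive) simp_all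
    also have "\<dots> \<le> ennreal (2 * e) + h"
      using y by (intro add_right_mono order_trans[OF emeasure_hausdorff_1_segment] ennreal_leI) simp
    also have "\<dots> < a" using e(2) by (simp add: add.commute)
    finally show "y \<in> {x. geodesic_length F x F1 < a}" by simp
  qed (use r e in simp)
qed

text \<open>
  Countably many compact sets suffice to separate a compact path from the boundary of the set it runs in.
\<close>

definition rational_ball_unions :: "'a::euclidean_space set set" where
  "rational_ball_unions =
     (\<lambda>S. \<Union>(c, r)\<in>S. cball c r) ` {S. finite S \<and> S \<subseteq> (SOME D. countable D \<and> closure D = UNIV) \<times> \<rat>}"

lemma countable_dense_choice:
  "countable (SOME D. countable D \<and> closure D = (UNIV :: 'a::euclidean_space set))"
  "closure (SOME D. countable D \<and> closure D = (UNIV :: 'a::euclidean_space set)) = UNIV"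
proof -
  obtain D :: "'a set" where "countable D" "closure D = UNIV"
    using separable[of "UNIV :: 'a set"] by (metis top.extremum_uniqueI)
  then have "\<exists>D :: 'a set. countable D \<and> closure D = UNIV" by blast
  from someI_ex[OF this]
  show "countable (SOME D. countable D \<and> closure D = (UNIV :: 'a set))"
    "closure (SOME D. countable D \<and> closure D = (UNIV :: 'a set)) = UNIV" by auto
qed

lemma countable_rational_ball_unions: "countable rational_ball_unions"
  unfolding rational_ball_unions_def
  by (intro countable_image countable_Collect_finite_subset countable_SIGMA countable_dense_choice countable_rat)

text \<open>Compactness gives a finite subcover by open balls. \<open>K\<close> has to lie in the
  interior of \<open>Q\<close>, since paths are required to run in the interior; the open balls
  ensure this.\<close>

lemma rational_ball_union_between:
  fixes K U :: "'a::euclidean_space set"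
  assumes "compact K" "open U" "K \<subseteq> U"
  obtains Q where "Q \<in> rational_ball_unions" "K \<subseteq> interior Q" "Q \<subseteq> U"
proof -
  define D where "D = (SOME D. countable D \<and> closure D = (UNIV :: 'a set))"
  have "\<exists>d q. d \<in> D \<and> q \<in> \<rat> \<and> x \<in> ball d q \<and> cball d q \<subseteq> U" if x: "x \<in> K" for x
  proof -
    obtain e where e: "0 < e" "ball x e \<subseteq> U" using assms x open_contains_ball by blast
    obtain d where d: "d \<in> D" "dist d x < e / 3"
    proof -
      have "x \<in> closure D" unfolding D_def countable_dense_choice(2) by simp
      moreover have "0 < e / 3" using e(1) by simp
      ultimately show ?thesis using that closure_approachable[of x D] by blast
    qed
    \<comment> \<open>\<open>e / 3 < q\<close> puts \<open>x\<close> into the ball about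
      \<open>d\<close>, and \<open>q < e / 2\<close> keeps the closed ball within
      \<open>e / 3 + e / 2 < e\<close> of \<open>x\<close>.\<close>
    obtain q where q: "q \<in> \<rat>" "e / 3 < q" "q < e / 2"
      using Rats_dense_in_real[of "e / 3" "e / 2"] e(1) by auto
    have "cball d q \<subseteq> ball x e"
    proof
      fix z assume "z \<in> cball d q"
      then show "z \<in> ball x e"
        using dist_triangle[of x z d] d(2) q(3) e(1) by (simp add: dist_commute)
    qed
    then show ?thesis using d q e by (intro exI[of _ d] exI[of _ q]) auto
  qed
  then obtain d q where dq: "\<And>x. x \<in> K \<Longrightarrow> d x \<in> D \<and> q x \<in> \<rat> \<and> x \<in> ball (d x) (q x) \<and> cball (d x) (q x) \<subseteq> U"
    by metis
  obtain K' where K': "K' \<subseteq> K" "finite K'" "K \<subseteq> (\<Union>x\<in>K'. ball (d x) (q x))"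
    using compactE_image[OF assms(1), of K "\<lambda>x. ball (d x) (q x)"] dq by blast
  define Q where "Q = (\<Union>(c, r)\<in>(\<lambda>x. (d x, q x)) ` K'. cball c r)"
  show thesis
  proof
    show "Q \<in> rational_ball_unions"
      unfolding rational_ball_unions_def Q_def D_def[symmetric]
      using K' dq by (intro imageI CollectI conjI) auto
    have "(\<Union>x\<in>K'. ball (d x) (q x)) \<subseteq> interior Q"
      by (rule interior_maximal) (auto simp: Q_def intro: ball_subset_cball[THEN subsetD])
    then show "K \<subseteq> interior Q" using K'(3) by blast
    show "Q \<subseteq> U" using dq K'(1) by (fastforce simp: Q_def)
  qed
qed

text \<open>A compact path in the interior of \<open>F\<close> already runs in the interior of some
  \<open>Q\<close> from the countable family. For fixed \<open>Q\<close>, the dependence on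
  \<open>F\<close> is the inclusion \<open>Q \<subseteq> F\<close> and the dependence on
  \<open>x\<close> an open set, so sublevel sets become countable unions of measurable
  rectangles.\<close>

lemma geodesic_length_less_iff:
  fixes F F1 :: "'a::euclidean_space set"
  shows "geodesic_length F x F1 < a \<longleftrightarrow> (\<exists>Q\<in>rational_ball_unions. Q \<subseteq> F \<and> geodesic_length Q x F1 < a)"
proof
  assume "geodesic_length F x F1 < a"
  then obtain f where f: "f \<in> paths F x F1" "emeasure (hausdorff_measure 1) (f ` {0..1}) < a"
    unfolding geodesic_length_def by (auto simp: INF_less_iff)
  have "f ` {0..1} \<subseteq> interior F" using f(1) by (auto simp: paths_def)
  then obtain Q where Q: "Q \<in> rational_ball_unions" "f ` {0..1} \<subseteq> interior Q" "Q \<subseteq> interior F"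
    using rational_ball_union_between[OF compact_path_image[OF f(1)]] by (metis open_interior)
  have "f \<in> paths Q x F1" using f(1) Q(2) by (auto simp: paths_def)
  then have "geodesic_length Q x F1 < a"
    unfolding geodesic_length_def using f(2) by (auto simp: INF_less_iff)
  then show "\<exists>Q\<in>rational_ball_unions. Q \<subseteq> F \<and> geodesic_length Q x F1 < a"
    using Q interior_subset by blast
next
  assume "\<exists>Q\<in>rational_ball_unions. Q \<subseteq> F \<and> geodesic_length Q x F1 < a"
  then show "geodesic_length F x F1 < a" using geodesic_length_antimono le_less_trans by blast
qed

section \<open>The Borel sets of the Fell topology\<close>

lemma topspace_fell_topology: "topspace fell_topology = {F. closed F}"
proof -
  have "{F :: 'a set. closed F} = {F. closed F \<and> F \<inter> {} = {}}" by simp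
  then have "{F :: 'a set. closed F} \<in> {{F. closed F \<and> F \<inter> K = {}} | K. compact K}"
    using compact_empty by blast
  note * = this
  show ?thesis unfolding fell_topology_def topology_generated_by_topspace
  proof (rule antisym)
    show "{F :: 'a set. closed F} \<subseteq> \<Union> ({{F. closed F \<and> F \<inter> K = {}} | K. compact K} \<union>
        {{F. closed F \<and> F \<inter> G \<noteq> {}} | G. open G})"
      by (rule Union_upper, rule UnI1, rule *)
  qed auto
qed

lemma openin_fell_subset: "{\<U>. openin fell_topology \<U>} \<subseteq> Pow {F :: 'a::topological_space set. closed F}"
  using openin_subset[of "fell_topology :: 'a set topology"] by (auto simp: topspace_fell_topology)

lemma space_fell_borel [simp]: "space fell_borel = {F. closed F}"
  unfolding fell_borel_def by (simp add: space_measure_of_conv)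

lemma openin_fell_in_sets: "openin fell_topology \<U> \<Longrightarrow> \<U> \<in> sets fell_borel"
  unfolding fell_borel_def using openin_fell_subset by (subst sets_measure_of) auto

text \<open>A closed set contains \<open>Q\<close> as soon as it contains a countable dense part of
  \<open>Q\<close>. Missing a point is a basic open event, because singletons are compact.\<close>

lemma sets_fell_borel_superset:
  fixes Q :: "'a::{metric_space,second_countable_topology} set"
  shows "{F. closed F \<and> Q \<subseteq> F} \<in> sets fell_borel"
proof -
  obtain D where D: "countable D" "D \<subseteq> Q" "Q \<subseteq> closure D" by (rule separable)
  have "{F :: 'a set. closed F \<and> F \<inter> {q} = {}} \<in> sets fell_borel" for q
    by (intro openin_fell_in_sets) (auto simp: fell_topology_def intro!: topology_generated_by_Basis)
  then have "{F. closed F} - (\<Union>q\<in>D. {F :: 'a set. closed F \<and> F \<inter> {q} = {}}) \<in> sets fell_borel"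
    using D(1) sets.top[of "fell_borel :: 'a set measure"] by (intro sets.Diff sets.countable_UN'') auto
  moreover have "{F. closed F} - (\<Union>q\<in>D. {F. closed F \<and> F \<inter> {q} = {}}) = {F. closed F \<and> Q \<subseteq> F}"
  proof -
    have "Q \<subseteq> F" if "closed F" "D \<subseteq> F" for F
      using closure_minimal[OF that(2,1)] D(3) by blast
    then show ?thesis using D(2) by auto
  qed
  ultimately show ?thesis by simp
qed

lemma borel_measurable_geodesic_length:
  fixes F1 :: "'a::euclidean_space set"
  shows "(\<lambda>(x, F). geodesic_length F x F1) \<in> borel_measurable (borel \<Otimes>\<^sub>M fell_borel)"
proof (rule borel_measurableI_less)
  fix a :: ennreal
  have "{p \<in> space (borel \<Otimes>\<^sub>M fell_borel). (case p of (x, F) \<Rightarrow> geodesic_length F x F1) < a} =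
      (\<Union>Q\<in>rational_ball_unions. {x. geodesic_length Q x F1 < a} \<times> {F. closed F \<and> Q \<subseteq> F})"
  proof (rule set_eqI, unfold split_paired_all)
    fix x :: 'a and F :: "'a set"
    have "(x, F) \<in> {p \<in> space (borel \<Otimes>\<^sub>M fell_borel). (case p of (x, F) \<Rightarrow> geodesic_length F x F1) < a} \<longleftrightarrow>
        closed F \<and> geodesic_length F x F1 < a"
      by (simp add: space_pair_measure)
    also have "\<dots> \<longleftrightarrow> closed F \<and> (\<exists>Q\<in>rational_ball_unions. Q \<subseteq> F \<and> geodesic_length Q x F1 < a)"
      by (subst geodesic_length_less_iff) (rule refl)
    also have "\<dots> \<longleftrightarrow> (x, F) \<in> (\<Union>Q\<in>rational_ball_unions.
        {x. geodesic_length Q x F1 < a} \<times> {F. closed F \<and> Q \<subseteq> F})"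
      by blast
    finally show "(x, F) \<in> {p \<in> space (borel \<Otimes>\<^sub>M fell_borel). (case p of (x, F) \<Rightarrow> geodesic_length F x F1) < a} \<longleftrightarrow>
        (x, F) \<in> (\<Union>Q\<in>rational_ball_unions. {x. geodesic_length Q x F1 < a} \<times> {F. closed F \<and> Q \<subseteq> F})" .
  qed
  also have "\<dots> \<in> sets (borel \<Otimes>\<^sub>M fell_borel)"
    by (intro sets.countable_UN'' countable_rational_ball_unions pair_measureI borel_open
        open_geodesic_length_less sets_fell_borel_superset)
  finally show "{p \<in> space (borel \<Otimes>\<^sub>M fell_borel). (case p of (x, F) \<Rightarrow> geodesic_length F x F1) < a}
      \<in> sets (borel \<Otimes>\<^sub>M fell_borel)" .
qed

section \<open>Translations of closed sets\<close>

lemma shift_eq_plus: "shift x F = (+) (- x) ` F"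
  unfolding shift_def by (intro image_cong) auto

lemma shift_shift: "shift x (shift y F) = shift (x + y) F"
  unfolding shift_def image_image by (intro image_cong) (auto simp: algebra_simps)

lemma shift_0 [simp]: "shift 0 F = F"
  by (simp add: shift_def)

lemma mem_shift: "z \<in> shift x F \<longleftrightarrow> z + x \<in> F"
  unfolding shift_def by force

lemma shift_Int_eq_empty_iff: "shift x F \<inter> A = {} \<longleftrightarrow> F \<inter> shift (- x) A = {}"
proof
  assume "shift x F \<inter> A = {}"
  then show "F \<inter> shift (- x) A = {}" by (force simp: shift_def)
next
  assume "F \<inter> shift (- x) A = {}"
  then show "shift x F \<inter> A = {}" by (force simp: shift_def)
qed

lemma geodesic_length_shift_le:
  fixes F F1 :: "'a::euclidean_space set"
  shows "geodesic_length (shift x F) y (shift x F1) \<le> geodesic_length F (y + x) F1"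
  unfolding geodesic_length_def
proof (rule INF_mono)
  fix f assume f: "f \<in> paths F (y + x) F1"
  define g where "g t = f t - x" for t
  have img: "g ` {0..1} = (+) (- x) ` f ` {0..1}" by (auto simp: g_def image_image)
  obtain L where "L-lipschitz_on {0..1} f" using f by (auto simp: paths_def)
  then have "L-lipschitz_on {0..1} g" by (simp add: lipschitz_on_def g_def dist_norm)
  moreover have "g ` {0..1} \<subseteq> interior (shift x F)"
    unfolding img shift_eq_plus interior_translation using f by (intro image_mono) (auto simp: paths_def)
  ultimately have "g \<in> paths (shift x F) y (shift x F1)"
    using f by (auto simp: paths_def g_def mem_shift)
  moreover have "emeasure (hausdorff_measure 1) (g ` {0..1}) = emeasure (hausdorff_measure 1) (f ` {0..1})"
  proof -
    have "hausdorff_outer 1 (g ` {0..1}) = hausdorff_outer 1 (f ` {0..1})"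
      unfolding img by (rule hausdorff_outer_translate)
    then show ?thesis
      using compact_path_image[OF f] compact_path_image[OF \<open>g \<in> _\<close>]
      by (simp only: emeasure_hausdorff_measure borel_compact)
  qed
  ultimately show "\<exists>g\<in>paths (shift x F) y (shift x F1).
      emeasure (hausdorff_measure 1) (g ` {0..1}) \<le> emeasure (hausdorff_measure 1) (f ` {0..1})"
    by (metis order_refl)
qed

lemma geodesic_length_shift:
  fixes F F1 :: "'a::euclidean_space set"
  shows "geodesic_length (shift x F) y (shift x F1) = geodesic_length F (y + x) F1"
proof (rule antisym[OF geodesic_length_shift_le])
  show "geodesic_length F (y + x) F1 \<le> geodesic_length (shift x F) y (shift x F1)"
    using geodesic_length_shift_le[of "- x" "shift x F" "y + x" "shift x F1"] by (simp add: shift_shift)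
qed

lemma closed_shift: "closed F \<Longrightarrow> closed (shift x (F :: 'a::real_normed_vector set))"
  unfolding shift_eq_plus by (rule closed_translation)

text \<open>Translation is continuous for the Fell topology: pulling back a hitting or missing
  condition replaces the test set by its translate, which is again open or compact.\<close>

lemma shift_measurable [measurable]:
  fixes x :: "'a::euclidean_space"
  shows "shift x \<in> measurable fell_borel fell_borel"
proof -
  have "continuous_map fell_topology fell_topology (shift x)"
    unfolding fell_topology_def[of, where 'a = 'a]
  proof (rule continuous_on_generated_topo, fold fell_topology_def)
    fix U :: "'a set set"
    assume "U \<in> {{F. closed F \<and> F \<inter> K = {}} | K. compact K} \<union> {{F. closed F \<and> F \<inter> G \<noteq> {}} | G. open G}"
    then consider K where "compact K" "U = {F. closed F \<and> F \<inter> K = {}}"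
      | G where "open G" "U = {F. closed F \<and> F \<inter> G \<noteq> {}}" by blast
    then show "openin fell_topology (shift x -` U \<inter> topspace fell_topology)"
    proof cases
      case 1
      have "shift x -` U \<inter> topspace fell_topology = {F. closed F \<and> F \<inter> shift (- x) K = {}}"
        unfolding 1 topspace_fell_topology using closed_shift[of _ x] shift_Int_eq_empty_iff[of x _ K] by auto
      moreover have "compact (shift (- x) K)"
        unfolding shift_eq_plus using 1 by (simp add: compact_translation)
      ultimately show ?thesis
        unfolding fell_topology_def by (auto intro!: topology_generated_by_Basis)
    next
      case 2
      have "shift x -` U \<inter> topspace fell_topology = {F. closed F \<and> F \<inter> shift (- x) G \<noteq> {}}"
        unfolding 2 topspace_fell_topology using closed_shift[of _ x] shift_Int_eq_empty_iff[of x _ G] by auto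
      moreover have "open (shift (- x) G)"
        unfolding shift_eq_plus using 2 by (simp add: open_translation)
      ultimately show ?thesis
        unfolding fell_topology_def by (auto intro!: topology_generated_by_Basis)
    qed
  next
    show "shift x ` topspace fell_topology \<subseteq> \<Union> ({{F. closed F \<and> F \<inter> K = {}} | K. compact K} \<union>
        {{F. closed F \<and> F \<inter> G \<noteq> {}} | G. open G})"
      using topspace_fell_topology[where 'a = 'a] closed_shift[of _ x]
      unfolding fell_topology_def topology_generated_by_topspace by auto
  qed
  then have "openin fell_topology {F \<in> topspace fell_topology. shift x F \<in> \<U>}" if "openin fell_topology \<U>" for \<U>
    using that by (rule openin_continuous_map_preimage)
  then have pre: "shift x -` \<U> \<inter> space fell_borel \<in> sets fell_borel" if "openin fell_topology \<U>" for \<U>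
    using openin_fell_in_sets[of "{F \<in> topspace fell_topology. shift x F \<in> \<U>}"] that
    by (simp add: topspace_fell_topology vimage_def Int_def conj_commute)
  show ?thesis
    unfolding fell_borel_def[of, where 'a = 'a]
    by (rule measurable_measure_of[OF openin_fell_subset])
      (use pre closed_shift in \<open>auto simp flip: fell_borel_def\<close>)
qed

section \<open>A pointwise ergodic theorem for multiparameter actions\<close>

text \<open>An abstraction of cubes in a hyperplane, with a measure living on the hyperplane.
  \<open>norm_W_le\<close> and \<open>in_W_if_norm_le\<close> compare windows with Euclidean balls,
  to which the Vitali lemma applies; the latter presupposes membership in some window because balls
  also leave the hyperplane.\<close>

locale averaging_windows =
  fixes \<nu> :: "'a::euclidean_space measure" and W :: "nat \<Rightarrow> 'a set" and c :: real and m \<kappa> :: nat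
  assumes sets_nu [simp, measurable_cong]: "sets \<nu> = sets borel"
    and W_measurable [measurable]: "W N \<in> sets borel"
    and emeasure_W: "emeasure \<nu> (W N) = ennreal (c * real N ^ m)"
    and c_pos: "0 < c"
    and kappa_pos: "0 < \<kappa>"
    and zero_W: "0 \<in> W 0"
    and W_add: "x \<in> W M \<Longrightarrow> y \<in> W N \<Longrightarrow> x + y \<in> W (M + N)"
    and W_uminus: "x \<in> W N \<Longrightarrow> - x \<in> W N"
    and norm_W_le: "x \<in> W N \<Longrightarrow> norm x \<le> real \<kappa> * real N"
    and in_W_if_norm_le: "x \<in> W M \<Longrightarrow> norm x \<le> real N / 2 \<Longrightarrow> x \<in> W N"
    and distr_translate: "x \<in> W N \<Longrightarrow> distr \<nu> borel ((+) x) = \<nu>"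
    and emeasure_outside_W: "emeasure \<nu> (- (\<Union>N. W N)) = 0"
begin

lemma space_nu [simp]: "space \<nu> = UNIV"
  using sets_eq_imp_space_eq[OF sets_nu] by simp

lemma W_mono:
  assumes "M \<le> N"
  shows "W M \<subseteq> W N"
proof
  fix x assume "x \<in> W M"
  moreover have "0 \<in> W (N - M)" using in_W_if_norm_le[OF zero_W] by simp
  ultimately show "x \<in> W N" using W_add[of x M 0 "N - M"] assms by simp
qed

sublocale nu: sigma_finite_measure \<nu>
proof
  show "\<exists>A. countable A \<and> A \<subseteq> sets \<nu> \<and> \<Union> A = space \<nu> \<and> (\<forall>a\<in>A. emeasure \<nu> a \<noteq> \<infinity>)"
    by (rule exI[of _ "insert (- (\<Union>N. W N)) (range W)"])
      (use emeasure_outside_W in \<open>auto simp: emeasure_W\<close>)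
qed

abbreviation V :: "nat \<Rightarrow> ennreal" where
  "V N \<equiv> ennreal (c * real N ^ m)"

lemma V_pos: "0 < N \<Longrightarrow> 0 < c * real N ^ m"
  using c_pos by simp

lemma V_mult_divide: "0 < N \<Longrightarrow> a * V N / V N = a"
  using V_pos[of N] by (intro mult_divide_eq_ennreal) (auto simp: ennreal_eq_0_iff not_le)

lemma V_times_divide: "0 < N \<Longrightarrow> V N * (a / V N) = a"
  using V_mult_divide[of N a] by (simp add: ennreal_times_divide mult.commute)

lemma nn_integral_translate:
  assumes "x \<in> W N" "f \<in> borel_measurable borel"
  shows "(\<integral>\<^sup>+ y. f (x + y) \<partial>\<nu>) = (\<integral>\<^sup>+ y. f y \<partial>\<nu>)"
proof -
  have "(\<integral>\<^sup>+ y. f y \<partial>\<nu>) = (\<integral>\<^sup>+ y. f y \<partial>distr \<nu> borel ((+) x))"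
    using distr_translate[OF assms(1)] by simp
  also have "\<dots> = (\<integral>\<^sup>+ y. f (x + y) \<partial>\<nu>)"
    using assms(2) by (subst nn_integral_distr) auto
  finally show ?thesis ..
qed

lemma emeasure_translate_W:
  assumes "x \<in> W M"
  shows "emeasure \<nu> {y. y - x \<in> W N} = V N"
proof -
  have "emeasure \<nu> {y. y - x \<in> W N} = (\<integral>\<^sup>+ y. indicator (W N) (y - x) \<partial>\<nu>)"
  proof -
    have "{y. y - x \<in> W N} \<in> sets \<nu>" by measurable
    then have "emeasure \<nu> {y. y - x \<in> W N} = (\<integral>\<^sup>+ y. indicator {y. y - x \<in> W N} y \<partial>\<nu>)"
      by simp
    also have "\<dots> = (\<integral>\<^sup>+ y. indicator (W N) (y - x) \<partial>\<nu>)"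
      by (intro nn_integral_cong) (simp split: split_indicator)
    finally show ?thesis .
  qed
  also have "\<dots> = (\<integral>\<^sup>+ y. indicator (W N) ((x + y) - x) \<partial>\<nu>)"
    by (rule nn_integral_translate[OF assms, symmetric]) measurable
  also have "\<dots> = V N" by (simp add: emeasure_W)
  finally show ?thesis .
qed

text \<open>Hardy-Littlewood argument along one orbit: each point of \<open>E\<close> carries a
  window with large integral, the Vitali lemma selects disjoint ones, and enlargements of these
  still cover \<open>E\<close>. The radius bound \<open>n\<close> confines all windows used to
  \<open>W (R + n)\<close>.\<close>

lemma vitali_maximal_inequality:
  fixes \<phi> :: "'a \<Rightarrow> ennreal" and t :: ennreal and R n :: nat
  assumes [measurable]: "\<phi> \<in> borel_measurable borel"
  defines "E \<equiv> {x \<in> W R. \<exists>N\<in>{1..n}. t * V N < (\<integral>\<^sup>+ y. \<phi> (x + y) * indicator (W N) y \<partial>\<nu>)}"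
  shows "t * emeasure \<nu> E \<le> ennreal ((10 * real \<kappa>) ^ m) * (\<integral>\<^sup>+ y. \<phi> y * indicator (W (R + n)) y \<partial>\<nu>)"
proof -
  have [measurable]: "E \<in> sets borel" unfolding E_def by measurable
  define r where "r x = (SOME N. N \<in> {1..n} \<and> t * V N < (\<integral>\<^sup>+ y. \<phi> (x + y) * indicator (W N) y \<partial>\<nu>))" for x
  have r: "r x \<in> {1..n}" "t * V (r x) < (\<integral>\<^sup>+ y. \<phi> (x + y) * indicator (W (r x)) y \<partial>\<nu>)" if "x \<in> E" for x
    using that someI_ex[of "\<lambda>N. N \<in> {1..n} \<and> t * V N < (\<integral>\<^sup>+ y. \<phi> (x + y) * indicator (W N) y \<partial>\<nu>)"]
    unfolding E_def r_def by blast+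
  have ER: "x \<in> W R" if "x \<in> E" for x using that by (simp add: E_def)
  define \<rho> where "\<rho> x = real \<kappa> * real (r x)" for x
  have \<rho>: "0 < \<rho> x \<and> \<rho> x \<le> real \<kappa> * real n" if "x \<in> E" for x
    using r(1)[OF that] kappa_pos by (auto simp: \<rho>_def)
  obtain C where C: "countable C" "C \<subseteq> E"
    "pairwise (\<lambda>i j. disjnt (cball i (\<rho> i)) (cball j (\<rho> j))) C"
    "\<And>i. i \<in> E \<Longrightarrow> \<exists>j. j \<in> C \<and> \<not> disjnt (cball i (\<rho> i)) (cball j (\<rho> j)) \<and> cball i (\<rho> i) \<subseteq> ball j (5 * \<rho> j)"
    by (rule Vitali_covering_lemma_cballs_balls[of E \<rho> "real \<kappa> * real n" "\<lambda>x. x"])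
      (use \<rho> in blast, rule that)
  \<comment> \<open>The radius \<open>\<rho> x\<close> makes the ball about \<open>x\<close> contain
    the translated window \<open>D x\<close>. The fivefold ball has radius
    \<open>5 * \<rho> x\<close>, half of \<open>10 * \<kappa> * r x\<close> as
    \<open>in_W_if_norm_le\<close> demands; hence the factor 10 and the volume ratio
    \<open>(10 * \<kappa>) ^ m\<close>.\<close>
  define A where "A x = {y. y - x \<in> W (10 * \<kappa> * r x)}" for x
  define D where "D x = {y. y - x \<in> W (r x)}" for x
  have [measurable]: "A x \<in> sets borel" "D x \<in> sets borel" for x unfolding A_def D_def by measurable
  have EA: "E \<subseteq> (\<Union>x\<in>C. A x)"
  proof
    fix y assume y: "y \<in> E"
    then obtain x where x: "x \<in> C" "cball y (\<rho> y) \<subseteq> ball x (5 * \<rho> x)" using C(4) by blast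
    have "y \<in> cball y (\<rho> y)" using \<rho>[OF y] by simp
    then have "y \<in> ball x (5 * \<rho> x)" using x(2) by blast
    then have "norm (y - x) \<le> real (10 * \<kappa> * r x) / 2"
      by (simp add: \<rho>_def dist_norm norm_minus_commute)
    \<comment> \<open>A small norm places a vector in a window only if it lies in some window
      already; here \<open>W (R + R)\<close> serves.\<close>
    moreover have "y - x \<in> W (R + R)"
      using W_add[OF ER[OF y] W_uminus[OF ER[of x]]] x(1) C(2) by auto
    ultimately have "y \<in> A x" unfolding A_def using in_W_if_norm_le by blast
    then show "y \<in> (\<Union>x\<in>C. A x)" using x(1) by blast
  qed
  \<comment> \<open>Writing the sum over the countable set \<open>C\<close> as an integral for
    counting measure lets Tonelli's theorem give countable subadditivity.\<close>
  have indE: "indicator E y \<le> (\<integral>\<^sup>+ x. indicator (A x) y \<partial>count_space C)" for y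
  proof (cases "y \<in> E")
    case True
    then obtain x where x: "x \<in> C" "y \<in> A x" using EA by blast
    have "(1::ennreal) = (\<integral>\<^sup>+ z. indicator {x} z \<partial>count_space C)"
      using x by simp
    also have "\<dots> \<le> (\<integral>\<^sup>+ x. indicator (A x) y \<partial>count_space C)"
      using x by (intro nn_integral_mono) (auto simp: indicator_def)
    finally show ?thesis using True by simp
  qed simp
  have disj: "disjoint_family_on D C"
    unfolding disjoint_family_on_def
  proof (intro ballI impI)
    fix i j assume ij: "i \<in> C" "j \<in> C" "i \<noteq> j"
    have "D x \<subseteq> cball x (\<rho> x)" for x
      using norm_W_le by (auto simp: D_def \<rho>_def dist_norm norm_minus_commute)
    then show "D i \<inter> D j = {}"
      using C(3) ij unfolding pairwise_def disjnt_def by blast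
  qed
  have DR: "D x \<subseteq> W (R + n)" if "x \<in> C" for x
  proof
    fix y assume "y \<in> D x"
    then have "x + (y - x) \<in> W (R + r x)"
      using ER[of x] that C(2) by (intro W_add) (auto simp: D_def)
    moreover have "R + r x \<le> R + n" using r(1)[of x] that C(2) by auto
    ultimately show "y \<in> W (R + n)" using W_mono[of "R + r x" "R + n"] by auto
  qed
  have intD: "(\<integral>\<^sup>+ y. \<phi> (x + y) * indicator (W (r x)) y \<partial>\<nu>) = (\<integral>\<^sup>+ y. \<phi> y * indicator (D x) y \<partial>\<nu>)"
    if "x \<in> C" for x
  proof -
    have "(\<integral>\<^sup>+ y. \<phi> y * indicator (D x) y \<partial>\<nu>) = (\<integral>\<^sup>+ y. \<phi> (x + y) * indicator (D x) (x + y) \<partial>\<nu>)"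
      using that C(2) ER by (intro nn_integral_translate[symmetric, of _ R]) auto
    also have "\<dots> = (\<integral>\<^sup>+ y. \<phi> (x + y) * indicator (W (r x)) y \<partial>\<nu>)"
      by (intro nn_integral_cong) (simp add: D_def indicator_def)
    finally show ?thesis ..
  qed
  have VA: "t * emeasure \<nu> (A x) \<le> ennreal ((10 * real \<kappa>) ^ m) * (\<integral>\<^sup>+ y. \<phi> y * indicator (D x) y \<partial>\<nu>)"
    if "x \<in> C" for x
  proof -
    have x: "x \<in> E" using that C(2) by blast
    have "emeasure \<nu> (A x) = V (10 * \<kappa> * r x)"
      unfolding A_def using ER[OF x] by (rule emeasure_translate_W)
    also have "\<dots> = ennreal ((10 * real \<kappa>) ^ m) * V (r x)"
      using c_pos by (simp add: ennreal_mult[symmetric] power_mult_distrib mult_ac)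
    finally have "t * emeasure \<nu> (A x) = ennreal ((10 * real \<kappa>) ^ m) * (t * V (r x))"
      by (simp add: mult_ac)
    also have "\<dots> \<le> ennreal ((10 * real \<kappa>) ^ m) * (\<integral>\<^sup>+ y. \<phi> (x + y) * indicator (W (r x)) y \<partial>\<nu>)"
      using r(2)[OF x] by (intro mult_left_mono) auto
    finally show ?thesis using intD[OF that] by simp
  qed
  have "emeasure \<nu> E = (\<integral>\<^sup>+ y. indicator E y \<partial>\<nu>)" by simp
  also have "\<dots> \<le> (\<integral>\<^sup>+ y. \<integral>\<^sup>+ x. indicator (A x) y \<partial>count_space C \<partial>\<nu>)"
    using indE by (intro nn_integral_mono)
  also have "\<dots> = (\<integral>\<^sup>+ x. \<integral>\<^sup>+ y. indicator (A x) y \<partial>\<nu> \<partial>count_space C)"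
    by (intro nn_integral_count_space_nn_integral C(1)) simp
  also have "\<dots> = (\<integral>\<^sup>+ x. emeasure \<nu> (A x) \<partial>count_space C)" by simp
  finally have "t * emeasure \<nu> E \<le> t * (\<integral>\<^sup>+ x. emeasure \<nu> (A x) \<partial>count_space C)"
    by (intro mult_left_mono) auto
  also have "\<dots> = (\<integral>\<^sup>+ x. t * emeasure \<nu> (A x) \<partial>count_space C)"
    by (simp add: nn_integral_cmult)
  also have "\<dots> \<le> (\<integral>\<^sup>+ x. ennreal ((10 * real \<kappa>) ^ m) * (\<integral>\<^sup>+ y. \<phi> y * indicator (D x) y \<partial>\<nu>) \<partial>count_space C)"
    using VA by (intro nn_integral_mono) auto
  also have "\<dots> = ennreal ((10 * real \<kappa>) ^ m) * (\<integral>\<^sup>+ x. (\<integral>\<^sup>+ y. \<phi> y * indicator (D x) y \<partial>\<nu>) \<partial>count_space C)"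
    by (simp add: nn_integral_cmult)
  also have "(\<integral>\<^sup>+ x. (\<integral>\<^sup>+ y. \<phi> y * indicator (D x) y \<partial>\<nu>) \<partial>count_space C) =
      (\<integral>\<^sup>+ x. emeasure (density \<nu> \<phi>) (D x) \<partial>count_space C)"
    by (simp add: emeasure_density)
  also have "\<dots> = emeasure (density \<nu> \<phi>) (\<Union>x\<in>C. D x)"
    using disj C(1) by (intro emeasure_UN_countable[symmetric]) auto
  also have "\<dots> \<le> emeasure (density \<nu> \<phi>) (W (R + n))"
    using DR by (intro emeasure_mono) auto
  also have "\<dots> = (\<integral>\<^sup>+ y. \<phi> y * indicator (W (R + n)) y \<partial>\<nu>)"
    by (simp add: emeasure_density)
  finally show ?thesis by (simp add: mult_left_mono)
qed

end

section \<open>Averages along the orbits of a measure preserving action\<close>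

locale ergodic_action = averaging_windows \<nu> W c m \<kappa> + prob_space P
  for \<nu> :: "'a::euclidean_space measure" and W c m \<kappa> and P :: "'s measure" +
  fixes T :: "'a \<Rightarrow> 's \<Rightarrow> 's"
  assumes T_measurable [measurable]: "T x \<in> measurable P P"
    and T_distr: "distr P P (T x) = P"
    and T_add: "F \<in> space P \<Longrightarrow> T (x + y) F = T x (T y F)"
    and ergodic: "B \<in> sets P \<Longrightarrow> (\<And>N x. x \<in> W N \<Longrightarrow> T x -` B \<inter> space P = B) \<Longrightarrow> prob B = 0 \<or> prob B = 1"
begin

lemma T_space: "F \<in> space P \<Longrightarrow> T x F \<in> space P"
  using measurable_space[OF T_measurable] .

text \<open>Tonelli's theorem needs measurability in vector and point together, whereas
  \<open>T x\<close> is assumed measurable for each fixed \<open>x\<close> only. The second conjunct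
  is kept because \<open>T 0\<close> is not assumed to be the identity.\<close>

definition joint :: "('s \<Rightarrow> 'b::topological_space) \<Rightarrow> bool" where
  "joint g \<longleftrightarrow> (\<lambda>(x, F). g (T x F)) \<in> borel_measurable (borel \<Otimes>\<^sub>M P) \<and> g \<in> borel_measurable P"

lemma joint_measurable: "joint g \<Longrightarrow> g \<in> borel_measurable P"
  by (simp add: joint_def)

lemma joint_compose:
  "joint g \<Longrightarrow> f \<in> borel_measurable borel \<Longrightarrow> joint (\<lambda>F. f (g F))"
  by (auto simp: joint_def case_prod_unfold)

lemma joint_const: "joint (\<lambda>_. a)"
  by (simp add: joint_def)

lemma joint_add:
  fixes f g :: "'s \<Rightarrow> ennreal"
  shows "joint f \<Longrightarrow> joint g \<Longrightarrow> joint (\<lambda>F. f F + g F)"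
  by (auto simp: joint_def case_prod_unfold)

lemma joint_section:
  assumes "joint g" "F \<in> space P"
  shows "(\<lambda>x. g (T x F)) \<in> borel_measurable borel"
proof -
  have [measurable]: "(\<lambda>(x, F). g (T x F)) \<in> borel_measurable (borel \<Otimes>\<^sub>M P)"
    using assms(1) by (simp add: joint_def)
  have "(\<lambda>x. (\<lambda>(x, F). g (T x F)) (x, F)) \<in> borel_measurable borel"
    using assms(2) by measurable
  then show ?thesis by simp
qed

definition window_integral :: "nat \<Rightarrow> ('s \<Rightarrow> ennreal) \<Rightarrow> 's \<Rightarrow> ennreal" where
  "window_integral N g F = (\<integral>\<^sup>+ x. g (T x F) * indicator (W N) x \<partial>\<nu>)"

definition avg :: "nat \<Rightarrow> ('s \<Rightarrow> ennreal) \<Rightarrow> 's \<Rightarrow> ennreal" where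
  "avg N g F = window_integral N g F / V N"

text \<open>By \<open>T_add\<close>, the window integral at \<open>T x F\<close> integrates
  \<open>g (T (y + x) F)\<close> over \<open>y\<close>, a composition of the joint function with
  addition; averages may therefore be averaged again.\<close>

lemma joint_window_integral:
  assumes "joint g"
  shows "joint (window_integral N g)"
proof -
  have [measurable]: "(\<lambda>(x, F). g (T x F)) \<in> borel_measurable (borel \<Otimes>\<^sub>M P)"
    using assms by (simp add: joint_def)
  have "(\<lambda>(p, y). (\<lambda>(x, F). g (T x F)) (y + fst p, snd p) * indicator (W N) y)
      \<in> borel_measurable ((borel \<Otimes>\<^sub>M P) \<Otimes>\<^sub>M \<nu>)"
    by measurable
  from nu.borel_measurable_nn_integral[OF this]
  have "(\<lambda>p. \<integral>\<^sup>+ y. g (T (y + fst p) (snd p)) * indicator (W N) y \<partial>\<nu>) \<in> borel_measurable (borel \<Otimes>\<^sub>M P)"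
    by simp
  moreover have "(\<integral>\<^sup>+ y. g (T (y + fst p) (snd p)) * indicator (W N) y \<partial>\<nu>) =
      (case p of (x, F) \<Rightarrow> window_integral N g (T x F))" if "p \<in> space (borel \<Otimes>\<^sub>M P)" for p
    using that by (auto simp: space_pair_measure window_integral_def T_add split: prod.split)
  ultimately have 1: "(\<lambda>(x, F). window_integral N g (T x F)) \<in> borel_measurable (borel \<Otimes>\<^sub>M P)"
    by (subst measurable_cong[symmetric])
  have "(\<lambda>(F, y). (\<lambda>(x, F). g (T x F)) (y, F) * indicator (W N) y) \<in> borel_measurable (P \<Otimes>\<^sub>M \<nu>)"
    by measurable
  from nu.borel_measurable_nn_integral[OF this]
  have "window_integral N g \<in> borel_measurable P" by (simp add: window_integral_def[abs_def])
  with 1 show ?thesis by (simp add: joint_def)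
qed

lemma joint_avg: "joint g \<Longrightarrow> joint (avg N g)"
  unfolding avg_def[abs_def] by (rule joint_compose[OF joint_window_integral]) auto

lemma nn_integral_window_integral:
  assumes "joint g"
  shows "(\<integral>\<^sup>+ F. window_integral N g F \<partial>P) = V N * (\<integral>\<^sup>+ F. g F \<partial>P)"
proof -
  interpret pair_sigma_finite \<nu> P ..
  have [measurable]: "(\<lambda>(x, F). g (T x F)) \<in> borel_measurable (borel \<Otimes>\<^sub>M P)"
    and [measurable]: "g \<in> borel_measurable P"
    using assms by (auto simp: joint_def)
  have "(\<lambda>(x, F). (\<lambda>(x, F). g (T x F)) (x, F) * indicator (W N) x) \<in> borel_measurable (\<nu> \<Otimes>\<^sub>M P)"
    by measurable
  then have "(\<lambda>(x, F). g (T x F) * indicator (W N) x) \<in> borel_measurable (\<nu> \<Otimes>\<^sub>M P)"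
    by simp
  from Fubini'[OF this]
  have "(\<integral>\<^sup>+ F. window_integral N g F \<partial>P) = (\<integral>\<^sup>+ x. \<integral>\<^sup>+ F. g (T x F) * indicator (W N) x \<partial>P \<partial>\<nu>)"
    by (simp add: window_integral_def)
  also have "\<dots> = (\<integral>\<^sup>+ x. (\<integral>\<^sup>+ F. g F \<partial>P) * indicator (W N) x \<partial>\<nu>)"
  proof (rule nn_integral_cong)
    fix x
    have "(\<integral>\<^sup>+ F. g F \<partial>P) = (\<integral>\<^sup>+ F. g F \<partial>distr P P (T x))" by (simp add: T_distr)
    also have "\<dots> = (\<integral>\<^sup>+ F. g (T x F) \<partial>P)" by (subst nn_integral_distr) auto
    finally show "(\<integral>\<^sup>+ F. g (T x F) * indicator (W N) x \<partial>P) = (\<integral>\<^sup>+ F. g F \<partial>P) * indicator (W N) x"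
      by (simp split: split_indicator)
  qed
  also have "\<dots> = V N * (\<integral>\<^sup>+ F. g F \<partial>P)"
    by (simp add: nn_integral_cmult emeasure_W mult.commute)
  finally show ?thesis .
qed

lemma nn_integral_avg:
  assumes "joint g" "0 < N"
  shows "(\<integral>\<^sup>+ F. avg N g F \<partial>P) = (\<integral>\<^sup>+ F. g F \<partial>P)"
proof -
  have [measurable]: "window_integral N g \<in> borel_measurable P"
    using joint_window_integral[OF assms(1)] by (rule joint_measurable)
  have "(\<integral>\<^sup>+ F. avg N g F \<partial>P) = V N * (\<integral>\<^sup>+ F. g F \<partial>P) / V N"
    unfolding avg_def by (simp add: nn_integral_divide nn_integral_window_integral[OF assms(1)])
  also have "\<dots> = (\<integral>\<^sup>+ F. g F \<partial>P)"
    using V_mult_divide[OF assms(2)] by (simp add: mult.commute)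
  finally show ?thesis .
qed

lemma V_mult_avg: "0 < N \<Longrightarrow> V N * avg N g F = window_integral N g F"
  unfolding avg_def by (rule V_times_divide)

lemma avg_le:
  assumes "0 < N" "\<And>x. x \<in> W N \<Longrightarrow> g (T x F) \<le> b"
  shows "avg N g F \<le> b"
proof -
  have "window_integral N g F \<le> (\<integral>\<^sup>+ x. b * indicator (W N) x \<partial>\<nu>)"
    unfolding window_integral_def using assms(2) by (intro nn_integral_mono) (auto split: split_indicator)
  also have "\<dots> = b * V N" by (simp add: nn_integral_cmult emeasure_W)
  finally have "avg N g F \<le> b * V N / V N" unfolding avg_def by (rule divide_right_mono_ennreal)
  then show ?thesis unfolding V_mult_divide[OF assms(1)] .
qed

lemma avg_ge:
  assumes "0 < N" "\<And>x. x \<in> W N \<Longrightarrow> b \<le> g (T x F)"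
  shows "b \<le> avg N g F"
proof -
  have "b * V N = (\<integral>\<^sup>+ x. b * indicator (W N) x \<partial>\<nu>)" by (simp add: nn_integral_cmult emeasure_W)
  also have "\<dots> \<le> window_integral N g F"
    unfolding window_integral_def using assms(2) by (intro nn_integral_mono) (auto split: split_indicator)
  finally have "b * V N / V N \<le> avg N g F" unfolding avg_def by (rule divide_right_mono_ennreal)
  then show ?thesis unfolding V_mult_divide[OF assms(1)] .
qed

lemma avg_mono:
  assumes "\<And>F. F \<in> space P \<Longrightarrow> g F \<le> h F" "F \<in> space P"
  shows "avg N g F \<le> avg N h F"
  unfolding avg_def window_integral_def using assms T_space
  by (intro divide_right_mono_ennreal nn_integral_mono mult_right_mono) auto

lemma avg_add:
  assumes "joint g" "joint h" "F \<in> space P"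
  shows "avg N (\<lambda>F. g F + h F) F = avg N g F + avg N h F"
proof -
  note [measurable] = joint_section[OF assms(1,3)] joint_section[OF assms(2,3)]
  show ?thesis
    unfolding avg_def window_integral_def
    by (simp add: distrib_right nn_integral_add add_divide_distrib_ennreal)
qed

lemma avg_const: "0 < N \<Longrightarrow> avg N (\<lambda>_. a) F = a"
  by (intro antisym avg_le avg_ge) auto

text \<open>Windows are symmetric and additive, so translating \<open>W N\<close> by
  \<open>y\<close> or by \<open>- y\<close> stays inside \<open>W (N + K)\<close>.\<close>

lemma window_integral_shift_le:
  assumes g: "joint g" and y: "y \<in> W K" and F: "F \<in> space P"
  shows "window_integral N g (T y F) \<le> window_integral (N + K) g F"
    and "window_integral N g F \<le> window_integral (N + K) g (T y F)"
proof -
  note [measurable] = joint_section[OF g F]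
  have "window_integral N g (T y F) = (\<integral>\<^sup>+ x. g (T (y + x) F) * indicator (W N) ((y + x) - y) \<partial>\<nu>)"
    unfolding window_integral_def using F by (intro nn_integral_cong) (simp add: T_add[symmetric] add.commute)
  also have "\<dots> = (\<integral>\<^sup>+ z. g (T z F) * indicator (W N) (z - y) \<partial>\<nu>)"
    using y by (rule nn_integral_translate) measurable
  also have "\<dots> \<le> window_integral (N + K) g F"
    unfolding window_integral_def
  proof (intro nn_integral_mono mult_left_mono)
    fix z
    have "z \<in> W (N + K)" if "z - y \<in> W N" using W_add[OF that y] by simp
    then show "(indicator (W N) (z - y) :: ennreal) \<le> indicator (W (N + K)) z"
      by (auto simp: indicator_def)
  qed simp
  finally show "window_integral N g (T y F) \<le> window_integral (N + K) g F" .
  have "window_integral N g F = (\<integral>\<^sup>+ x. g (T (y + x) F) * indicator (W N) (y + x) \<partial>\<nu>)"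
    unfolding window_integral_def using y by (intro nn_integral_translate[symmetric]) measurable
  also have "\<dots> \<le> (\<integral>\<^sup>+ x. g (T x (T y F)) * indicator (W (N + K)) x \<partial>\<nu>)"
  proof (intro nn_integral_mono mult_mono)
    fix x
    show "g (T (y + x) F) \<le> g (T x (T y F))" using F by (simp add: T_add[symmetric] add.commute)
    have "x \<in> W (N + K)" if "y + x \<in> W N" using W_add[OF that W_uminus[OF y]] by simp
    then show "(indicator (W N) (y + x) :: ennreal) \<le> indicator (W (N + K)) x"
      by (auto simp: indicator_def)
  qed auto
  finally show "window_integral N g F \<le> window_integral (N + K) g (T y F)"
    unfolding window_integral_def .
qed

lemma window_integral_commute:
  assumes g: "joint g" and F: "F \<in> space P"
  shows "window_integral N (window_integral K g) F = window_integral K (window_integral N g) F"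
proof -
  interpret pair_sigma_finite \<nu> \<nu> ..
  note [measurable] = joint_section[OF g F]
  have eq: "window_integral N' (window_integral K' g) F =
      (\<integral>\<^sup>+ x. \<integral>\<^sup>+ y. g (T (x + y) F) * indicator (W K') y * indicator (W N') x \<partial>\<nu> \<partial>\<nu>)" for N' K'
    unfolding window_integral_def
  proof (rule nn_integral_cong)
    fix x
    have "(\<integral>\<^sup>+ y. g (T y (T x F)) * indicator (W K') y \<partial>\<nu>) * indicator (W N') x =
        (\<integral>\<^sup>+ y. g (T (x + y) F) * indicator (W K') y \<partial>\<nu>) * indicator (W N') x"
      using F by (simp add: T_add[symmetric] add.commute)
    also have "\<dots> = (\<integral>\<^sup>+ y. g (T (x + y) F) * indicator (W K') y * indicator (W N') x \<partial>\<nu>)"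
      by (rule nn_integral_multc[symmetric]) measurable
    finally show "(\<integral>\<^sup>+ y. g (T y (T x F)) * indicator (W K') y \<partial>\<nu>) * indicator (W N') x = \<dots>" .
  qed
  have "window_integral N (window_integral K g) F =
      (\<integral>\<^sup>+ y. \<integral>\<^sup>+ x. g (T (x + y) F) * indicator (W K) y * indicator (W N) x \<partial>\<nu> \<partial>\<nu>)"
    unfolding eq by (rule Fubini'[symmetric]) measurable
  also have "\<dots> = window_integral K (window_integral N g) F"
    unfolding eq by (simp add: mult_ac add.commute)
  finally show ?thesis .
qed

lemma avg_commute:
  assumes "joint g" "F \<in> space P"
  shows "avg N (avg K g) F = avg K (avg N g) F"
proof -
  have *: "window_integral N' (avg K' g) F = window_integral N' (window_integral K' g) F / V K'" for N' K'
  proof -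
    note [measurable] = joint_section[OF joint_window_integral[OF assms(1)] assms(2)]
    have "window_integral N' (avg K' g) F =
        (\<integral>\<^sup>+ x. window_integral K' g (T x F) * indicator (W N') x / V K' \<partial>\<nu>)"
      unfolding window_integral_def[of N'] avg_def
      by (intro nn_integral_cong) (simp split: split_indicator)
    also have "\<dots> = window_integral N' (window_integral K' g) F / V K'"
      unfolding window_integral_def[of N'] by (rule nn_integral_divide) measurable
    finally show ?thesis .
  qed
  show ?thesis
    unfolding avg_def[of N] avg_def[of K "avg N g"] * window_integral_commute[OF assms, of N K]
    by (simp add: divide_ennreal_def mult_ac)
qed

text \<open>After exchanging the averages, the outer one runs over \<open>W K\<close>, and each
  shifted window integral is compared with the unshifted one by enlarging the window by
  \<open>K\<close>. Keeping the volumes as factors leaves the growth of the window as the only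
  loss.\<close>

lemma avg_avg_bounds:
  assumes "joint g" "F \<in> space P" "0 < N" "0 < K"
  shows "V N * avg N (avg K g) F \<le> window_integral (N + K) g F"
    and "window_integral N g F \<le> V (N + K) * avg (N + K) (avg K g) F"
proof -
  have "avg K (avg N g) F \<le> window_integral (N + K) g F / V N"
    by (rule avg_le[OF assms(4)])
      (auto simp: avg_def[of N] intro!: divide_right_mono_ennreal window_integral_shift_le assms)
  then have "V N * avg N (avg K g) F \<le> V N * (window_integral (N + K) g F / V N)"
    unfolding avg_commute[OF assms(1,2), of N K] by (rule mult_left_mono) simp
  then show "V N * avg N (avg K g) F \<le> window_integral (N + K) g F"
    unfolding V_times_divide[OF assms(3)] .
  have "window_integral N g F / V (N + K) \<le> avg K (avg (N + K) g) F"
    by (rule avg_ge[OF assms(4)])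
      (auto simp: avg_def[of "N + K"] intro!: divide_right_mono_ennreal window_integral_shift_le assms)
  then have "V (N + K) * (window_integral N g F / V (N + K)) \<le> V (N + K) * avg (N + K) (avg K g) F"
    unfolding avg_commute[OF assms(1,2), of "N + K" K] by (rule mult_left_mono) simp
  then show "window_integral N g F \<le> V (N + K) * avg (N + K) (avg K g) F"
    using assms(3) by (subst (asm) V_times_divide) auto
qed

text \<open>Transference: the inequality along orbits is applied on a large window
  \<open>W R\<close> and integrated over \<open>P\<close>. Invariance turns both sides into volumes
  times expectations, and the quotient of the volumes of \<open>W (R + n)\<close> and
  \<open>W R\<close> tends to 1.\<close>

lemma maximal_inequality:
  assumes h: "joint h" and e: "(\<integral>\<^sup>+ F. h F \<partial>P) = ennreal e" "0 \<le> e" and t: "0 < t"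
  shows "t * prob {F \<in> space P. \<exists>N>0. ennreal t < avg N h F} \<le> (10 * real \<kappa>) ^ m * e"
proof -
  \<comment> \<open>Only windows up to \<open>n\<close> are inspected, so that \<open>R\<close> can
    tend to infinity while \<open>n\<close> is fixed; the events increase with \<open>n\<close>, and
    \<open>n\<close> tends to infinity last.\<close>
  define Bad where "Bad n = {F \<in> space P. \<exists>N\<in>{1..n}. ennreal t * V N < window_integral N h F}" for n
  define ind where "ind n F = (if \<exists>N\<in>{1..n}. ennreal t * V N < window_integral N h F then 1 else 0 :: ennreal)" for n F
  have [measurable]: "(\<lambda>(x, F). window_integral N h (T x F)) \<in> borel_measurable (borel \<Otimes>\<^sub>M P)"
    "window_integral N h \<in> borel_measurable P" for N
    using joint_window_integral[OF h] by (auto simp: joint_def)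
  have [measurable]: "Bad n \<in> events" for n unfolding Bad_def by measurable
  have joint_ind: "joint (ind n)" for n
  proof -
    have "(\<lambda>p. if \<exists>N\<in>{1..n}. ennreal t * V N < (\<lambda>(x, F). window_integral N h (T x F)) p then 1 else 0 :: ennreal)
        \<in> borel_measurable (borel \<Otimes>\<^sub>M P)" by measurable
    moreover have "ind n \<in> borel_measurable P" unfolding ind_def[abs_def] by measurable
    ultimately show ?thesis unfolding joint_def ind_def case_prod_unfold by simp
  qed
  have int_ind: "(\<integral>\<^sup>+ F. ind n F \<partial>P) = ennreal (prob (Bad n))" for n
  proof -
    have "(\<integral>\<^sup>+ F. ind n F \<partial>P) = (\<integral>\<^sup>+ F. indicator (Bad n) F \<partial>P)"
      by (intro nn_integral_cong) (auto simp: ind_def Bad_def)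
    then show ?thesis by (simp add: emeasure_eq_measure)
  qed
  have step: "ennreal t * window_integral R (ind n) F \<le> ennreal ((10 * real \<kappa>) ^ m) * window_integral (R + n) h F"
    if F: "F \<in> space P" for R n F
  proof -
    define \<phi> where "\<phi> y = h (T y F)" for y
    have \<phi>[measurable]: "\<phi> \<in> borel_measurable borel" unfolding \<phi>_def using h F by (rule joint_section)
    let ?E = "{x \<in> W R. \<exists>N\<in>{1..n}. ennreal t * V N < (\<integral>\<^sup>+ y. \<phi> (x + y) * indicator (W N) y \<partial>\<nu>)}"
    have wi: "window_integral N h (T x F) = (\<integral>\<^sup>+ y. \<phi> (x + y) * indicator (W N) y \<partial>\<nu>)" for N x
      unfolding window_integral_def \<phi>_def using F by (simp add: T_add[symmetric] add.commute)
    have "window_integral R (ind n) F = (\<integral>\<^sup>+ x. indicator ?E x \<partial>\<nu>)"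
      unfolding window_integral_def[of R] ind_def wi
      by (intro nn_integral_cong) (auto split: split_indicator)
    also have "\<dots> = emeasure \<nu> ?E" by (rule nn_integral_indicator) measurable
    finally show ?thesis
      using vitali_maximal_inequality[OF \<phi>, of "ennreal t" R n] by (simp add: window_integral_def \<phi>_def)
  qed
  have bound_R: "t * prob (Bad n) \<le> (10 * real \<kappa>) ^ m * e * (real (R + n) / real R) ^ m" if "0 < R" for R n
  proof -
    have [measurable]: "window_integral R (ind n) \<in> borel_measurable P" "window_integral (R + n) h \<in> borel_measurable P"
      using joint_window_integral joint_ind h joint_measurable by blast+
    have "ennreal t * (V R * ennreal (prob (Bad n))) = (\<integral>\<^sup>+ F. ennreal t * window_integral R (ind n) F \<partial>P)"
      using nn_integral_window_integral[OF joint_ind] by (simp add: nn_integral_cmult int_ind)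
    also have "\<dots> \<le> (\<integral>\<^sup>+ F. ennreal ((10 * real \<kappa>) ^ m) * window_integral (R + n) h F \<partial>P)"
      using step by (intro nn_integral_mono)
    also have "\<dots> = ennreal ((10 * real \<kappa>) ^ m) * (V (R + n) * ennreal e)"
      using nn_integral_window_integral[OF h] e by (simp add: nn_integral_cmult)
    finally have "ennreal (t * (c * real R ^ m * prob (Bad n))) \<le> ennreal ((10 * real \<kappa>) ^ m * (c * real (R + n) ^ m * e))"
      using t e c_pos by (simp add: ennreal_mult)
    then have "t * (c * real R ^ m * prob (Bad n)) \<le> (10 * real \<kappa>) ^ m * (c * real (R + n) ^ m * e)"
      using e c_pos by (subst (asm) ennreal_le_iff) auto
    then have "real R ^ m * (t * prob (Bad n)) \<le> real R ^ m * ((10 * real \<kappa>) ^ m * e * (real (R + n) / real R) ^ m)"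
      using c_pos that by (simp add: power_divide mult_ac)
    then show ?thesis using that by simp
  qed
  have bound: "t * prob (Bad n) \<le> (10 * real \<kappa>) ^ m * e" for n
  proof (rule LIMSEQ_le_const)
    have "(\<lambda>R. (10 * real \<kappa>) ^ m * e * (real (R + n) / real R) ^ m) \<longlonglongrightarrow> (10 * real \<kappa>) ^ m * e * 1 ^ m"
      by (intro tendsto_intros) real_asymp
    then show "(\<lambda>R. (10 * real \<kappa>) ^ m * e * (real (R + n) / real R) ^ m) \<longlonglongrightarrow> (10 * real \<kappa>) ^ m * e"
      by simp
    show "\<exists>N. \<forall>R\<ge>N. t * prob (Bad n) \<le> (10 * real \<kappa>) ^ m * e * (real (R + n) / real R) ^ m"
      using bound_R by (intro exI[of _ 1]) auto
  qed
  have "(\<lambda>n. t * prob (Bad n)) \<longlonglongrightarrow> t * prob (\<Union>n. Bad n)"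
    by (intro tendsto_mult_left finite_Lim_measure_incseq) (auto simp: incseq_def Bad_def)
  then have "t * prob (\<Union>n. Bad n) \<le> (10 * real \<kappa>) ^ m * e"
    by (rule LIMSEQ_le_const2) (use bound in auto)
  moreover have "{F \<in> space P. \<exists>N>0. ennreal t < avg N h F} \<subseteq> (\<Union>n. Bad n)"
  proof
    fix F assume "F \<in> {F \<in> space P. \<exists>N>0. ennreal t < avg N h F}"
    then obtain N where N: "F \<in> space P" "0 < N" "ennreal t < avg N h F" by blast
    have "ennreal t * V N < avg N h F * V N"
      using N(2,3) V_pos[OF N(2)] by (intro ennreal_mult_strict_right_mono) auto
    then have "ennreal t * V N < window_integral N h F"
      using V_mult_avg[OF N(2)] by (simp add: mult.commute)
    then have "F \<in> Bad N" using N by (auto simp: Bad_def)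
    then show "F \<in> (\<Union>n. Bad n)" by blast
  qed
  then have "prob {F \<in> space P. \<exists>N>0. ennreal t < avg N h F} \<le> prob (\<Union>n. Bad n)"
    by (intro finite_measure_mono) auto
  ultimately show ?thesis using t by (meson mult_left_mono less_imp_le order_trans)
qed

text \<open>Cauchy-Schwarz against the indicator of the window. Together with invariance it makes
  averaging a contraction in mean square.\<close>

lemma avg_square_le:
  assumes h: "joint h" and F: "F \<in> space P" and N: "0 < N"
  shows "(avg N h F)\<^sup>2 \<le> avg N (\<lambda>F. (h F)\<^sup>2) F"
proof -
  note [measurable] = joint_section[OF h F]
  have "(window_integral N h F)\<^sup>2 = (\<integral>\<^sup>+ x. (h (T x F) * indicator (W N) x) * indicator (W N) x \<partial>\<nu>)\<^sup>2"
    unfolding window_integral_def by (intro arg_cong[where f = "\<lambda>x. x\<^sup>2"] nn_integral_cong) (simp split: split_indicator)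
  also have "\<dots> \<le> (\<integral>\<^sup>+ x. (h (T x F) * indicator (W N) x)\<^sup>2 \<partial>\<nu>) * (\<integral>\<^sup>+ x. (indicator (W N) x)\<^sup>2 \<partial>\<nu>)"
    by (rule Cauchy_Schwarz_nn_integral) measurable
  also have "(\<integral>\<^sup>+ x. (h (T x F) * indicator (W N) x)\<^sup>2 \<partial>\<nu>) = window_integral N (\<lambda>F. (h F)\<^sup>2) F"
    unfolding window_integral_def by (intro nn_integral_cong) (simp split: split_indicator)
  also have "(\<integral>\<^sup>+ x. (indicator (W N) x)\<^sup>2 \<partial>\<nu>) = (\<integral>\<^sup>+ x. indicator (W N) x \<partial>\<nu>)"
    by (intro nn_integral_cong) (simp split: split_indicator)
  finally have "(V N * avg N h F)\<^sup>2 \<le> V N * avg N (\<lambda>F. (h F)\<^sup>2) F * V N"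
    using N by (simp add: V_mult_avg emeasure_W)
  then have "V N * V N * (avg N h F)\<^sup>2 \<le> V N * V N * avg N (\<lambda>F. (h F)\<^sup>2) F"
    by (simp add: power2_eq_square mult_ac)
  then show ?thesis
    using V_pos[OF N] by (subst (asm) ennreal_mult_le_mult_iff) (auto simp: ennreal_mult_eq_top_iff ennreal_eq_0_iff not_le)
qed

lemma nn_integral_bounded:
  assumes "f \<in> borel_measurable P" "\<And>F. F \<in> space P \<Longrightarrow> 0 \<le> f F \<and> f F \<le> (b::real)"
  shows "integrable P f" "(\<integral>\<^sup>+ F. ennreal (f F) \<partial>P) = ennreal (\<integral>F. f F \<partial>P)" "0 \<le> (\<integral>F. f F \<partial>P)"
proof -
  show int: "integrable P f"
    using assms by (intro integrable_const_bound[of _ b]) auto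
  show "(\<integral>\<^sup>+ F. ennreal (f F) \<partial>P) = ennreal (\<integral>F. f F \<partial>P)"
    using assms by (intro nn_integral_eq_integral int) auto
  show "0 \<le> (\<integral>F. f F \<partial>P)" using assms by (intro integral_nonneg_AE) auto
qed

section \<open>The mean ergodic theorem for bounded functions\<close>

context
  fixes u :: "'s \<Rightarrow> real" and b :: real
  assumes joint_u: "joint u" and u_bounds: "\<forall>F\<in>space P. 0 \<le> u F \<and> u F \<le> b"
begin

lemmas u_bounded = u_bounds[rule_format]

definition bavg :: "nat \<Rightarrow> 's \<Rightarrow> real" where
  "bavg N F = enn2real (avg N (\<lambda>F. ennreal (u F)) F)"

text \<open>The bound \<open>b\<close> times the relative volume of the shell between
  \<open>W N\<close> and \<open>W (N + K)\<close>: the most an average over \<open>W N\<close> can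
  change when the base point moves by a vector of \<open>W K\<close>.\<close>

definition drift :: "nat \<Rightarrow> nat \<Rightarrow> real" where
  "drift K N = b * ((real (N + K) / real N) ^ m - 1)"

lemma b_nonneg: "0 \<le> b"
  using u_bounded not_empty by fastforce

lemma joint_ennreal_u: "joint (\<lambda>F. ennreal (u F))"
  by (rule joint_compose[OF joint_u]) simp

lemma ennreal_bavg:
  assumes "0 < N" "F \<in> space P"
  shows "ennreal (bavg N F) = avg N (\<lambda>F. ennreal (u F)) F" "0 \<le> bavg N F" "bavg N F \<le> b"
proof -
  have le: "avg N (\<lambda>F. ennreal (u F)) F \<le> ennreal b"
    using assms u_bounded T_space by (intro avg_le ennreal_leI) auto
  then show "ennreal (bavg N F) = avg N (\<lambda>F. ennreal (u F)) F"
    unfolding bavg_def by (intro ennreal_enn2real) (simp add: le_less_trans)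
  then show "0 \<le> bavg N F" "bavg N F \<le> b"
    using le b_nonneg by (auto simp: bavg_def enn2real_leI)
qed

lemma joint_bavg: "joint (bavg N)"
  unfolding bavg_def[abs_def] by (intro joint_compose[OF joint_avg[OF joint_ennreal_u]]) simp

lemma bavg_measurable [measurable]: "bavg N \<in> borel_measurable P"
  using joint_bavg by (rule joint_measurable)

lemma drift_tendsto: "(\<lambda>N. drift K N) \<longlonglongrightarrow> 0"
proof -
  have "(\<lambda>N. drift K N) \<longlonglongrightarrow> b * (1 ^ m - 1)"
    unfolding drift_def by (intro tendsto_intros) real_asymp
  then show ?thesis by simp
qed

lemma drift_nonneg: "0 < N \<Longrightarrow> 0 \<le> drift K N"
  unfolding drift_def using b_nonneg by (intro mult_nonneg_nonneg) (auto simp: one_le_power)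

lemma window_integral_extend:
  assumes F: "F \<in> space P"
  shows "window_integral (N + K) (\<lambda>F. ennreal (u F)) F \<le>
    window_integral N (\<lambda>F. ennreal (u F)) F + ennreal (b * (c * real (N + K) ^ m - c * real N ^ m))"
proof -
  note [measurable] = joint_section[OF joint_ennreal_u F]
  have sub: "W N \<subseteq> W (N + K)" by (rule W_mono) simp
  have "window_integral (N + K) (\<lambda>F. ennreal (u F)) F \<le>
      (\<integral>\<^sup>+ x. ennreal (u (T x F)) * indicator (W N) x + ennreal b * indicator (W (N + K) - W N) x \<partial>\<nu>)"
    unfolding window_integral_def using u_bounded T_space[OF F]
    by (intro nn_integral_mono) (auto split: split_indicator intro!: ennreal_leI)
  also have "\<dots> = window_integral N (\<lambda>F. ennreal (u F)) F + ennreal b * emeasure \<nu> (W (N + K) - W N)"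
    unfolding window_integral_def by (simp add: nn_integral_add nn_integral_cmult)
  also have "emeasure \<nu> (W (N + K) - W N) = V (N + K) - V N"
    using sub by (subst emeasure_Diff) (auto simp: emeasure_W)
  also have "\<dots> = ennreal (c * real (N + K) ^ m - c * real N ^ m)"
    using c_pos by (intro ennreal_minus) simp
  also have "ennreal b * \<dots> = ennreal (b * (c * real (N + K) ^ m - c * real N ^ m))"
    by (rule ennreal_mult''[symmetric]) (use c_pos in \<open>simp add: power_mono\<close>)
  finally show ?thesis .
qed

text \<open>The shifted window lies in \<open>W (N + K)\<close>, where the integral exceeds that
  over \<open>W N\<close> by at most \<open>b\<close> times the volume of the shell; dividing by the
  volume of \<open>W N\<close> gives the drift.\<close>

lemma bavg_shift:
  assumes N: "0 < N" and y: "y \<in> W K" and F: "F \<in> space P"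
  shows "bavg N F \<le> bavg N (T y F) + drift K N" and "bavg N (T y F) \<le> bavg N F + drift K N"
proof -
  have *: "bavg N F1 \<le> bavg N F2 + drift K N"
    if F12: "F1 \<in> space P" "F2 \<in> space P"
      and le: "window_integral N (\<lambda>F. ennreal (u F)) F1 \<le> window_integral (N + K) (\<lambda>F. ennreal (u F)) F2" for F1 F2
  proof -
    have nn: "0 \<le> b * (c * real (N + K) ^ m - c * real N ^ m)"
      using b_nonneg c_pos by (intro mult_nonneg_nonneg) (auto simp: power_mono)
    have "V N * ennreal (bavg N F1) \<le> V N * ennreal (bavg N F2) + ennreal (b * (c * real (N + K) ^ m - c * real N ^ m))"
      using le window_integral_extend[OF F12(2), of N K] N F12 by (simp add: ennreal_bavg V_mult_avg)
    then have "ennreal (c * real N ^ m * bavg N F1) \<le>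
        ennreal (c * real N ^ m * bavg N F2 + b * (c * real (N + K) ^ m - c * real N ^ m))"
      using nn c_pos ennreal_bavg(2)[OF N] F12 by (simp add: ennreal_mult ennreal_plus)
    then have "c * real N ^ m * bavg N F1 \<le> c * real N ^ m * bavg N F2 + b * (c * real (N + K) ^ m - c * real N ^ m)"
      using nn c_pos ennreal_bavg(2)[OF N F12(2)] by (subst (asm) ennreal_le_iff) auto
    also have "\<dots> = c * real N ^ m * (bavg N F2 + drift K N)"
      using N by (simp add: drift_def power_divide field_simps)
    finally show ?thesis using V_pos[OF N] by (simp only: mult_le_cancel_left_pos)
  qed
  show "bavg N F \<le> bavg N (T y F) + drift K N"
    using window_integral_shift_le(2)[OF joint_ennreal_u y F] F T_space by (intro *) auto
  show "bavg N (T y F) \<le> bavg N F + drift K N"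
    using window_integral_shift_le(1)[OF joint_ennreal_u y F] F T_space by (intro *) auto
qed

definition energy :: "nat \<Rightarrow> real" where
  "energy N = (\<integral>F. (bavg N F)\<^sup>2 \<partial>P)"

lemma integrable_bavg_products:
  assumes "0 < r" "0 < s"
  shows "integrable P (\<lambda>F. bavg r F * bavg s F)"
proof (rule nn_integral_bounded(1)[where b = "b * b"])
  fix F assume "F \<in> space P"
  then show "0 \<le> bavg r F * bavg s F \<and> bavg r F * bavg s F \<le> b * b"
    using ennreal_bavg[OF assms(1)] ennreal_bavg[OF assms(2)] b_nonneg by (auto intro!: mult_mono)
qed measurable

lemma energy_nonneg: "0 \<le> energy N"
  unfolding energy_def by simp

text \<open>
  Averaging over a large window \<open>S\<close> almost absorbs the averages over \<open>r\<close> and \<open>s\<close>, and it is a contraction in the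
  mean square.
\<close>

lemma energy_le:
  assumes "0 < r" "0 < s" "0 < S"
  shows "4 * energy S \<le> (\<integral>F. (bavg r F + bavg s F)\<^sup>2 \<partial>P) + (8 * b * drift (r + s) S + 4 * (drift (r + s) S)\<^sup>2)"
proof -
  let ?h = "\<lambda>F. ennreal (bavg r F) + ennreal (bavg s F)"
  define \<epsilon> where "\<epsilon> = drift (r + s) S"
  have \<epsilon>: "0 \<le> \<epsilon>" unfolding \<epsilon>_def using assms(3) by (rule drift_nonneg)
  have joint_h: "joint ?h" by (intro joint_add joint_compose[OF joint_bavg]) auto
  have joint_h2: "joint (\<lambda>F. (?h F)\<^sup>2)" by (rule joint_compose[OF joint_h]) auto
  define a where "a F = enn2real (avg S ?h F)" for F
  have hb: "?h F \<le> ennreal (2 * b)" if "F \<in> space P" for F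
    using ennreal_bavg(2,3)[OF assms(1) that] ennreal_bavg(2,3)[OF assms(2) that] b_nonneg
    by (simp add: ennreal_plus[symmetric] ennreal_leI del: ennreal_plus)
  have a: "ennreal (a F) = avg S ?h F" "0 \<le> a F" "a F \<le> 2 * b" if "F \<in> space P" for F
  proof -
    have "avg S ?h F \<le> ennreal (2 * b)" using hb that T_space assms(3) by (intro avg_le) auto
    then show "ennreal (a F) = avg S ?h F" "0 \<le> a F" "a F \<le> 2 * b"
      using b_nonneg unfolding a_def
      by (auto intro!: ennreal_enn2real enn2real_leI simp: le_less_trans)
  qed
  have [measurable]: "a \<in> borel_measurable P"
    unfolding a_def[abs_def] using joint_measurable[OF joint_avg[OF joint_h]] by measurable
  have approx: "2 * bavg S F \<le> a F + 2 * \<epsilon>" if F: "F \<in> space P" for F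
  proof -
    \<comment> \<open>Exchanging the averages leaves a mean over \<open>W k\<close> of shifted
      values of \<open>bavg S\<close>, each at least \<open>bavg S F - \<epsilon>\<close>. Taking
      \<open>k \<le> r + s\<close> lets one drift serve for both \<open>r\<close> and
      \<open>s\<close>.\<close>
    have part: "ennreal (bavg S F - \<epsilon>) \<le> avg S (\<lambda>F. ennreal (bavg k F)) F" if "0 < k" "k \<le> r + s" for k
    proof -
      have "ennreal (bavg S F - \<epsilon>) \<le> avg k (avg S (\<lambda>F. ennreal (u F))) F"
      proof (rule avg_ge[OF \<open>0 < k\<close>])
        fix y assume "y \<in> W k"
        then have y: "y \<in> W (r + s)" using W_mono[OF \<open>k \<le> r + s\<close>] by blast
        have "bavg S F - \<epsilon> \<le> bavg S (T y F)"
          using bavg_shift(1)[OF assms(3) y F] by (simp add: \<epsilon>_def)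
        then show "ennreal (bavg S F - \<epsilon>) \<le> avg S (\<lambda>F. ennreal (u F)) (T y F)"
          using assms(3) F T_space by (simp add: ennreal_bavg(1)[symmetric] ennreal_leI)
      qed
      also have "\<dots> = avg S (avg k (\<lambda>F. ennreal (u F))) F"
        by (rule avg_commute[OF joint_ennreal_u F])
      also have "\<dots> \<le> avg S (\<lambda>F. ennreal (bavg k F)) F"
        using F ennreal_bavg(1)[OF \<open>0 < k\<close>] by (intro avg_mono) auto
      finally show ?thesis .
    qed
    \<comment> \<open>\<open>ennreal\<close> sends negative numbers to 0, so the case where
      \<open>bavg S F\<close> is below \<open>\<epsilon>\<close> is trivial.\<close>
    have "ennreal (2 * (bavg S F - \<epsilon>)) \<le> ennreal (bavg S F - \<epsilon>) + ennreal (bavg S F - \<epsilon>)"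
      by (cases "bavg S F - \<epsilon> \<ge> 0") (auto simp: ennreal_plus[symmetric] ennreal_neg simp del: ennreal_plus)
    also have "\<dots> \<le> avg S ?h F"
      using assms by (subst avg_add)
        (auto intro!: add_mono part joint_compose[OF joint_bavg] F)
    finally have "ennreal (2 * (bavg S F - \<epsilon>)) \<le> ennreal (a F)" using a(1)[OF F] by simp
    then have "2 * (bavg S F - \<epsilon>) \<le> a F" using a(2)[OF F] by (simp add: ennreal_le_iff2) argo
    then show ?thesis by simp
  qed
  have a2: "0 \<le> (a F)\<^sup>2 \<and> (a F)\<^sup>2 \<le> (2 * b)\<^sup>2" if "F \<in> space P" for F
    using a(2,3)[OF that] by (intro conjI power_mono zero_le_power2)
  have int_a2: "integrable P (\<lambda>F. (a F)\<^sup>2)"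
    by (rule nn_integral_bounded(1)[where b = "(2 * b)\<^sup>2", OF _ a2]) measurable
  have h2: "0 \<le> (bavg r F + bavg s F)\<^sup>2 \<and> (bavg r F + bavg s F)\<^sup>2 \<le> (2 * b)\<^sup>2" if "F \<in> space P" for F
    using ennreal_bavg(2,3)[OF assms(1) that] ennreal_bavg(2,3)[OF assms(2) that]
    by (intro conjI power_mono zero_le_power2) auto
  have "ennreal (\<integral>F. (a F)\<^sup>2 \<partial>P) = (\<integral>\<^sup>+ F. ennreal ((a F)\<^sup>2) \<partial>P)"
    by (rule nn_integral_bounded(2)[symmetric, where b = "(2 * b)\<^sup>2", OF _ a2]) measurable
  also have "\<dots> = (\<integral>\<^sup>+ F. (avg S ?h F)\<^sup>2 \<partial>P)"
    using a by (intro nn_integral_cong) (simp add: ennreal_power[symmetric])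
  also have "\<dots> \<le> (\<integral>\<^sup>+ F. avg S (\<lambda>F. (?h F)\<^sup>2) F \<partial>P)"
    using assms(3) by (intro nn_integral_mono avg_square_le joint_h)
  also have "\<dots> = (\<integral>\<^sup>+ F. (?h F)\<^sup>2 \<partial>P)"
    using joint_h2 assms(3) by (rule nn_integral_avg)
  also have "\<dots> = (\<integral>\<^sup>+ F. ennreal ((bavg r F + bavg s F)\<^sup>2) \<partial>P)"
    using ennreal_bavg(2)[OF assms(1)] ennreal_bavg(2)[OF assms(2)]
    by (intro nn_integral_cong) (simp add: ennreal_power[symmetric])
  also have "\<dots> = ennreal (\<integral>F. (bavg r F + bavg s F)\<^sup>2 \<partial>P)"
    by (rule nn_integral_bounded(2)[where b = "(2 * b)\<^sup>2", OF _ h2]) measurable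
  finally have int_le: "(\<integral>F. (a F)\<^sup>2 \<partial>P) \<le> (\<integral>F. (bavg r F + bavg s F)\<^sup>2 \<partial>P)"
    by (subst (asm) ennreal_le_iff) auto
  have "4 * energy S = (\<integral>F. 4 * (bavg S F)\<^sup>2 \<partial>P)" by (simp add: energy_def)
  also have "\<dots> \<le> (\<integral>F. (a F)\<^sup>2 + (8 * b * \<epsilon> + 4 * \<epsilon>\<^sup>2) \<partial>P)"
  proof (rule integral_mono)
    show "integrable P (\<lambda>F. 4 * (bavg S F)\<^sup>2)"
      using integrable_bavg_products[OF assms(3,3)] by (simp add: power2_eq_square)
    fix F assume F: "F \<in> space P"
    \<comment> \<open>In the expansion of the right-hand square, \<open>a F \<le> 2 * b\<close>
      bounds the mixed term by \<open>8 * b * \<epsilon>\<close>; this is the origin of the error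
      term.\<close>
    have "(2 * bavg S F)\<^sup>2 \<le> (a F + 2 * \<epsilon>)\<^sup>2"
      using approx[OF F] ennreal_bavg(2)[OF assms(3) F] by (intro power_mono) auto
    moreover have "4 * a F * \<epsilon> \<le> 8 * b * \<epsilon>" using a(3)[OF F] \<epsilon> by (simp add: mult_right_mono)
    ultimately show "4 * (bavg S F)\<^sup>2 \<le> (a F)\<^sup>2 + (8 * b * \<epsilon> + 4 * \<epsilon>\<^sup>2)"
      by (simp add: power2_eq_square algebra_simps)
  qed (use int_a2 in simp)
  also have "\<dots> = (\<integral>F. (a F)\<^sup>2 \<partial>P) + (8 * b * \<epsilon> + 4 * \<epsilon>\<^sup>2)"
    using int_a2 by (simp add: prob_space)
  finally show ?thesis using int_le by (simp add: \<epsilon>_def)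
qed

definition energy_inf :: real where
  "energy_inf = (INF N\<in>{0<..}. energy N)"

lemma energy_inf_le: "0 < N \<Longrightarrow> energy_inf \<le> energy N"
  unfolding energy_inf_def using energy_nonneg by (intro cINF_lower) (auto intro!: bdd_belowI[of _ 0])

lemma error_tendsto: "(\<lambda>S. 8 * b * drift K S + 4 * (drift K S)\<^sup>2) \<longlonglongrightarrow> 0"
proof -
  have "(\<lambda>S. 8 * b * drift K S + 4 * (drift K S)\<^sup>2) \<longlonglongrightarrow> 8 * b * 0 + 4 * 0\<^sup>2"
    by (intro tendsto_intros drift_tendsto)
  then show ?thesis by simp
qed

text \<open>Half the sum of two averages need not be an average over a window, but by
  \<open>energy_le\<close> large windows have at most its energy up to a vanishing error. This
  replaces convexity in the projection theorem.\<close>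

lemma energy_inf_le_sum:
  assumes "0 < r" "0 < s"
  shows "4 * energy_inf \<le> (\<integral>F. (bavg r F + bavg s F)\<^sup>2 \<partial>P)"
proof (rule LIMSEQ_le_const)
  show "(\<lambda>S. (\<integral>F. (bavg r F + bavg s F)\<^sup>2 \<partial>P) + (8 * b * drift (r + s) S + 4 * (drift (r + s) S)\<^sup>2))
      \<longlonglongrightarrow> (\<integral>F. (bavg r F + bavg s F)\<^sup>2 \<partial>P)"
    using tendsto_add[OF tendsto_const error_tendsto] by simp
  show "\<exists>N. \<forall>S\<ge>N. 4 * energy_inf \<le> (\<integral>F. (bavg r F + bavg s F)\<^sup>2 \<partial>P) +
      (8 * b * drift (r + s) S + 4 * (drift (r + s) S)\<^sup>2)"
  proof (intro exI[of _ 1] allI impI)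
    fix S :: nat assume "1 \<le> S"
    then show "4 * energy_inf \<le> (\<integral>F. (bavg r F + bavg s F)\<^sup>2 \<partial>P) +
        (8 * b * drift (r + s) S + 4 * (drift (r + s) S)\<^sup>2)"
      using energy_le[OF assms, of S] energy_inf_le[of S] by linarith
  qed
qed

text \<open>The case \<open>r = s\<close> of \<open>energy_le\<close> shows that the energy is
  almost decreasing: one nearly minimal window forces all sufficiently large ones to be nearly
  minimal. The shares \<open>\<epsilon> / 2\<close> and \<open>2 * \<epsilon>\<close> fit the factor
  4.\<close>

lemma energy_eventually_le:
  assumes "0 < \<epsilon>"
  shows "\<exists>R>0. \<forall>S\<ge>R. energy S \<le> energy_inf + \<epsilon>"
proof -
  have "\<exists>r\<in>{0<..}. energy r < energy_inf + \<epsilon> / 2"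
    unfolding energy_inf_def using assms energy_nonneg
    by (subst cINF_less_iff[symmetric]) (auto intro!: bdd_belowI[of _ 0])
  then obtain r where r: "0 < r" "energy r < energy_inf + \<epsilon> / 2" by auto
  have "(\<integral>F. (bavg r F + bavg r F)\<^sup>2 \<partial>P) = 4 * energy r"
    by (simp add: energy_def mult_2[symmetric] power_mult_distrib del: mult_2)
  moreover have "eventually (\<lambda>S. 8 * b * drift (r + r) S + 4 * (drift (r + r) S)\<^sup>2 < 2 * \<epsilon>) sequentially"
    using error_tendsto assms by (intro order_tendstoD) auto
  then obtain R where R: "\<And>S. R \<le> S \<Longrightarrow> 8 * b * drift (r + r) S + 4 * (drift (r + r) S)\<^sup>2 < 2 * \<epsilon>"
    by (auto simp: eventually_sequentially)
  ultimately have "energy S \<le> energy_inf + \<epsilon>" if "S \<ge> Suc R" for S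
    using energy_le[OF r(1) r(1), of S] R[OF Suc_leD[OF that]] r(2) that by linarith
  then show ?thesis by (intro exI[of _ "Suc R"]) auto
qed

text \<open>Parallelogram law, with the mean square of the sum bounded below by
  \<open>energy_inf_le_sum\<close>.\<close>

lemma square_distance_le:
  assumes "0 < r" "0 < s"
  shows "(\<integral>F. (bavg r F - bavg s F)\<^sup>2 \<partial>P) \<le> 2 * (energy r - energy_inf) + 2 * (energy s - energy_inf)"
proof -
  note int = integrable_bavg_products[OF assms(1,1)] integrable_bavg_products[OF assms(2,2)]
    integrable_bavg_products[OF assms]
  have "(\<integral>F. (bavg r F - bavg s F)\<^sup>2 \<partial>P) = energy r + energy s - 2 * (\<integral>F. bavg r F * bavg s F \<partial>P)"
    using int by (simp add: energy_def power2_eq_square algebra_simps mult.commute)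
  moreover have "(\<integral>F. (bavg r F + bavg s F)\<^sup>2 \<partial>P) = energy r + energy s + 2 * (\<integral>F. bavg r F * bavg s F \<partial>P)"
    using int by (simp add: energy_def power2_eq_square algebra_simps mult.commute)
  ultimately show ?thesis using energy_inf_le_sum[OF assms] by simp
qed

lemma integral_bavg:
  assumes "0 < N"
  shows "(\<integral>F. bavg N F \<partial>P) = (\<integral>F. u F \<partial>P)"
proof -
  have [measurable]: "u \<in> borel_measurable P" using joint_u by (rule joint_measurable)
  have "ennreal (\<integral>F. bavg N F \<partial>P) = (\<integral>\<^sup>+ F. ennreal (bavg N F) \<partial>P)"
    using ennreal_bavg[OF assms] by (intro nn_integral_bounded(2)[symmetric]) auto
  also have "\<dots> = (\<integral>\<^sup>+ F. avg N (\<lambda>F. ennreal (u F)) F \<partial>P)"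
    using ennreal_bavg[OF assms] by (intro nn_integral_cong) auto
  also have "\<dots> = (\<integral>\<^sup>+ F. ennreal (u F) \<partial>P)" by (rule nn_integral_avg[OF joint_ennreal_u assms])
  also have "\<dots> = ennreal (\<integral>F. u F \<partial>P)" using u_bounded by (intro nn_integral_bounded(2)) auto
  finally show ?thesis
    using nn_integral_bounded(3)[of "bavg N" b] nn_integral_bounded(3)[of u b] ennreal_bavg[OF assms] u_bounded
    by (subst (asm) ennreal_inj) auto
qed

end

context
  fixes u :: "'s \<Rightarrow> real" and b :: real
  assumes joint_u: "joint u" and u_bounds: "\<forall>F\<in>space P. 0 \<le> u F \<and> u F \<le> b"
begin

text \<open>
  Along a subsequence the averages converge almost everywhere; the limit is constant because
  the sets where it lies strictly on one side of the mean are invariant.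
\<close>

lemma mean_ergodic_subsequence:
  obtains r :: "nat \<Rightarrow> nat" where "\<And>j. 0 < r j"
    "AE F in P. (\<lambda>j. bavg u (r j) F) \<longlonglongrightarrow> (\<integral>F. u F \<partial>P)"
proof -
  note [measurable] = bavg_measurable[OF joint_u u_bounds]
  note ebavg = ennreal_bavg[OF joint_u u_bounds]
  define e where "e = (\<integral>F. u F \<partial>P)"
  define v where "v = energy_inf u"
  \<comment> \<open>A quarter of \<open>(1/4)^j\<close> above the infimum at two successive indices
    gives a squared distance of at most \<open>(1/4)^j\<close>.\<close>
  have "\<forall>j. \<exists>R>0. \<forall>S\<ge>R. energy u S \<le> v + (1/4)^j / 4"
    unfolding v_def using energy_eventually_le[OF joint_u u_bounds] by auto
  then obtain R where R: "\<And>j. 0 < R j" "\<And>j S. R j \<le> S \<Longrightarrow> energy u S \<le> v + (1/4)^j / 4"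
    by metis
  \<comment> \<open>Adding \<open>j\<close> forces the window sizes to infinity, so that the drift
    vanishes along the subsequence.\<close>
  define r where "r j = R j + j" for j
  have r_pos: "0 < r j" for j using R(1)[of j] by (simp add: r_def)
  define a where "a j = bavg u (r j)" for j
  have a_meas [measurable]: "a j \<in> borel_measurable P" for j by (simp add: a_def)
  have a_bounds: "0 \<le> a j F" "a j F \<le> b" if "F \<in> space P" for j F
    using ebavg(2,3)[OF r_pos that] by (auto simp: a_def)
  have int_a: "integrable P (a j)" for j
    using a_bounds by (intro nn_integral_bounded(1)[of _ b]) auto
  have E: "energy u (r j) \<le> v + (1/4)^j / 4" for j using R(2)[of j "r j"] by (simp add: r_def)
  have sq: "(\<integral>F. (a j F - a (Suc j) F)\<^sup>2 \<partial>P) \<le> (1/4)^j" for j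
  proof -
    have "(1/4 :: real) ^ Suc j \<le> (1/4)^j" by (rule power_decreasing) auto
    moreover have "x \<le> p" if "x \<le> 2 * (e1 - v) + 2 * (e2 - v)" "e1 \<le> v + p / 4" "e2 \<le> v + q / 4" "q \<le> p"
      for x p q e1 e2 :: real
      using that by argo
    ultimately show ?thesis
      using square_distance_le[OF joint_u u_bounds r_pos[of j] r_pos[of "Suc j"], folded v_def] E
      unfolding a_def by blast
  qed
  have dist: "(\<integral>\<^sup>+ F. ennreal \<bar>a j F - a (Suc j) F\<bar> \<partial>P) \<le> ennreal (2 * (1/2)^j)" for j
  proof -
    define d where "d F = a j F - a (Suc j) F" for F
    have [measurable]: "d \<in> borel_measurable P" unfolding d_def by measurable
    have d_le: "\<bar>d F\<bar> \<le> b" if "F \<in> space P" for F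
      using a_bounds[OF that, of j] a_bounds[OF that, of "Suc j"] by (auto simp: d_def)
    have int_d: "integrable P (\<lambda>F. \<bar>d F\<bar>)"
      using d_le by (intro nn_integral_bounded(1)[of _ b]) auto
    have int_d2: "integrable P (\<lambda>F. (d F)\<^sup>2)"
      using d_le by (intro nn_integral_bounded(1)[of _ "b\<^sup>2"]) (auto simp: abs_le_square_iff[symmetric] intro: order_trans[OF _ abs_ge_self])
    \<comment> \<open>A completed square with weight \<open>2^j\<close> passes from mean squares to
      absolute means: against \<open>(1/4)^j\<close> it makes both terms \<open>(1/2)^j\<close>,
      which is summable.\<close>
    have "(\<integral>F. \<bar>d F\<bar> \<partial>P) \<le> (\<integral>F. (1/2)^j + 2^j * (d F)\<^sup>2 \<partial>P)"
    proof (rule integral_mono[OF int_d])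
      fix F
      have "0 \<le> ((1/2)^j - \<bar>d F\<bar>)\<^sup>2" by simp
      then have "2 * (1/2)^j * \<bar>d F\<bar> \<le> ((1/2)^j)\<^sup>2 + (d F)\<^sup>2" by (simp add: power2_diff)
      then have "2^j * (2 * (1/2)^j * \<bar>d F\<bar>) \<le> 2^j * (((1/2)^j)\<^sup>2 + (d F)\<^sup>2)" by (rule mult_left_mono) simp
      moreover have "(2::real)^j * (1/2)^j = 1" by (simp add: power_mult_distrib[symmetric])
      ultimately have "2 * \<bar>d F\<bar> \<le> (1/2)^j + 2^j * (d F)\<^sup>2"
        by (simp add: algebra_simps power2_eq_square) (simp add: mult.assoc[symmetric])
      then show "\<bar>d F\<bar> \<le> (1/2)^j + 2^j * (d F)\<^sup>2" by (smt (verit) abs_ge_zero)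
    qed (use int_d2 in simp)
    also have "\<dots> = (1/2)^j + 2^j * (\<integral>F. (d F)\<^sup>2 \<partial>P)" using int_d2 by (simp add: prob_space)
    also have "\<dots> \<le> (1/2)^j + 2^j * (1/4)^j" using sq[of j] by (simp add: d_def)
    also have "(2::real)^j * (1/4)^j = (1/2)^j" by (simp add: power_mult_distrib[symmetric])
    finally have "(\<integral>F. \<bar>d F\<bar> \<partial>P) \<le> 2 * (1/2)^j" by simp
    moreover have "(\<integral>\<^sup>+ F. ennreal \<bar>d F\<bar> \<partial>P) = ennreal (\<integral>F. \<bar>d F\<bar> \<partial>P)"
      using d_le by (intro nn_integral_bounded(2)[of _ b]) auto
    ultimately show ?thesis by (simp add: d_def ennreal_leI)
  qed
  have "(\<integral>\<^sup>+ F. (\<Sum>j. ennreal \<bar>a j F - a (Suc j) F\<bar>) \<partial>P) = (\<Sum>j. \<integral>\<^sup>+ F. ennreal \<bar>a j F - a (Suc j) F\<bar> \<partial>P)"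
    by (rule nn_integral_suminf) measurable
  also have "\<dots> \<le> (\<Sum>j. ennreal (2 * (1/2)^j))" using dist by (intro suminf_le) auto
  also have "\<dots> < \<infinity>"
    by (subst suminf_ennreal2) (auto intro!: summable_mult summable_geometric)
  finally have "AE F in P. (\<Sum>j. ennreal \<bar>a j F - a (Suc j) F\<bar>) \<noteq> \<infinity>"
    by (intro nn_integral_PInf_AE) auto
  then have conv: "AE F in P. (\<lambda>j. a j F) \<longlonglongrightarrow> lim (\<lambda>j. a j F)"
  proof eventually_elim
    case (elim F)
    then have "summable (\<lambda>j. \<bar>a j F - a (Suc j) F\<bar>)"
      by (intro summable_suminf_not_top) auto
    then have "summable (\<lambda>j. a j F - a (Suc j) F)" by (rule summable_rabs_cancel)
    then have "convergent (\<lambda>n. \<Sum>j<n. a j F - a (Suc j) F)" by (simp add: summable_iff_convergent)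
    then have "convergent (\<lambda>n. a 0 F - (\<Sum>j<n. a j F - a (Suc j) F))"
      by (intro convergent_diff convergent_const)
    moreover have "a 0 F - (\<Sum>j<n. a j F - a (Suc j) F) = a n F" for n
      by (induction n) auto
    ultimately show ?case by (simp add: convergent_LIMSEQ_iff)
  qed
  have lim_meas [measurable]: "(\<lambda>F. lim (\<lambda>j. a j F)) \<in> borel_measurable P" by measurable
  have lim_bound: "AE F in P. norm (a j F) \<le> b" for j using a_bounds by (intro AE_I2) auto
  have int_lim: "integrable P (\<lambda>F. lim (\<lambda>j. a j F))"
    by (rule integrable_dominated_convergence[where w = "\<lambda>_. b" and s = a, OF _ _ _ conv lim_bound]) simp_all
  have lim_int: "(\<lambda>j. \<integral>F. a j F \<partial>P) \<longlonglongrightarrow> (\<integral>F. lim (\<lambda>j. a j F) \<partial>P)"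
    by (rule integral_dominated_convergence[where w = "\<lambda>_. b" and s = a, OF _ _ _ conv lim_bound]) simp_all
  have "(\<integral>F. a j F \<partial>P) = e" for j
    unfolding a_def e_def by (rule integral_bavg[OF joint_u u_bounds r_pos])
  then have lim_e: "(\<integral>F. lim (\<lambda>j. a j F) \<partial>P) = e" using lim_int by (simp add: LIMSEQ_const_iff)
  \<comment> \<open>Ergodicity asks for sets invariant at every point. Eventual inequalities with a
    margin are meaningful even where the averages diverge, and they survive a vanishing drift;
    conditions on \<open>lim\<close> would be controlled only almost everywhere.\<close>
  define Lo where "Lo = {F \<in> space P. \<exists>k n. \<forall>j\<ge>n. a j F \<le> e - 1 / real (Suc k)}"
  define Hi where "Hi = {F \<in> space P. \<exists>k n. \<forall>j\<ge>n. e + 1 / real (Suc k) \<le> a j F}"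
  have [measurable]: "Lo \<in> events" "Hi \<in> events" unfolding Lo_def Hi_def by measurable
  \<comment> \<open>The drift is eventually smaller than the step from the margin
    \<open>1 / (k + 1)\<close> to \<open>1 / (k + 2)\<close>; the existential quantifier over
    \<open>k\<close> absorbs this loss.\<close>
  have drift_small: "\<exists>n. \<forall>j\<ge>n. drift b K (r j) \<le> 1 / real (Suc k) - 1 / real (Suc (Suc k))" for K k
  proof -
    have "filterlim r at_top sequentially"
      by (rule filterlim_at_top_mono[OF filterlim_ident]) (simp add: r_def)
    then have "(\<lambda>j. drift b K (r j)) \<longlonglongrightarrow> 0"
      using filterlim_compose[OF drift_tendsto[OF joint_u u_bounds]] by blast
    moreover have "0 < 1 / real (Suc k) - 1 / real (Suc (Suc k))"
      using divide_strict_left_mono[of "real (Suc k)" "real (Suc (Suc k))" 1] by simp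
    ultimately have "eventually (\<lambda>j. drift b K (r j) < 1 / real (Suc k) - 1 / real (Suc (Suc k))) sequentially"
      by (intro order_tendstoD)
    then show ?thesis unfolding eventually_sequentially by (meson less_imp_le)
  qed
  have shift: "a j F \<le> a j (T y F) + drift b K (r j)" "a j (T y F) \<le> a j F + drift b K (r j)"
    if "y \<in> W K" "F \<in> space P" for j y K F
    unfolding a_def using bavg_shift[OF joint_u u_bounds r_pos that] by auto
  have Lo_transfer: "F1 \<in> Lo"
    if F2: "F2 \<in> Lo" and F1: "F1 \<in> space P" and close: "\<And>j. a j F1 \<le> a j F2 + drift b K (r j)" for F1 F2 K
  proof -
    obtain k n where n: "\<And>j. j \<ge> n \<Longrightarrow> a j F2 \<le> e - 1 / real (Suc k)" using F2 unfolding Lo_def by blast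
    obtain n' where n': "\<And>j. j \<ge> n' \<Longrightarrow> drift b K (r j) \<le> 1 / real (Suc k) - 1 / real (Suc (Suc k))"
      using drift_small by blast
    have "a j F1 \<le> e - 1 / real (Suc (Suc k))" if "j \<ge> max n n'" for j
    proof -
      have "n \<le> j" "n' \<le> j" using that by auto
      then show ?thesis using n[of j] n'[of j] close[of j] by linarith
    qed
    then show ?thesis using F1 unfolding Lo_def by blast
  qed
  have Hi_transfer: "F1 \<in> Hi"
    if F2: "F2 \<in> Hi" and F1: "F1 \<in> space P" and close: "\<And>j. a j F2 \<le> a j F1 + drift b K (r j)" for F1 F2 K
  proof -
    obtain k n where n: "\<And>j. j \<ge> n \<Longrightarrow> e + 1 / real (Suc k) \<le> a j F2" using F2 unfolding Hi_def by blast
    obtain n' where n': "\<And>j. j \<ge> n' \<Longrightarrow> drift b K (r j) \<le> 1 / real (Suc k) - 1 / real (Suc (Suc k))"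
      using drift_small by blast
    have "e + 1 / real (Suc (Suc k)) \<le> a j F1" if "j \<ge> max n n'" for j
    proof -
      have "n \<le> j" "n' \<le> j" using that by auto
      then show ?thesis using n[of j] n'[of j] close[of j] by linarith
    qed
    then show ?thesis using F1 unfolding Hi_def by blast
  qed
  have "T y -` Lo \<inter> space P = Lo" if "y \<in> W K" for y K
  proof (intro equalityI subsetI)
    fix F assume "F \<in> T y -` Lo \<inter> space P"
    then show "F \<in> Lo" using shift(1)[OF that] by (intro Lo_transfer[of "T y F" F K]) auto
  next
    fix F assume F: "F \<in> Lo"
    then have sp: "F \<in> space P" by (simp add: Lo_def)
    have "T y F \<in> Lo" using shift(2)[OF that sp] T_space[OF sp] by (intro Lo_transfer[OF F, of _ K]) auto
    then show "F \<in> T y -` Lo \<inter> space P" using sp by simp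
  qed
  then have Lo_01: "prob Lo = 0 \<or> prob Lo = 1" by (intro ergodic) auto
  have "T y -` Hi \<inter> space P = Hi" if "y \<in> W K" for y K
  proof (intro equalityI subsetI)
    fix F assume "F \<in> T y -` Hi \<inter> space P"
    then show "F \<in> Hi" using shift(2)[OF that] by (intro Hi_transfer[of "T y F" F K]) auto
  next
    fix F assume F: "F \<in> Hi"
    then have sp: "F \<in> space P" by (simp add: Hi_def)
    have "T y F \<in> Hi" using shift(1)[OF that sp] T_space[OF sp] by (intro Hi_transfer[OF F, of _ K]) auto
    then show "F \<in> T y -` Hi \<inter> space P" using sp by simp
  qed
  then have Hi_01: "prob Hi = 0 \<or> prob Hi = 1" by (intro ergodic) auto
  have below: "lim (\<lambda>j. a j F) < e" if F: "F \<in> Lo" and cv: "(\<lambda>j. a j F) \<longlonglongrightarrow> lim (\<lambda>j. a j F)" for F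
  proof -
    obtain k n where "\<And>j. j \<ge> n \<Longrightarrow> a j F \<le> e - 1 / real (Suc k)" using F unfolding Lo_def by blast
    then have "lim (\<lambda>j. a j F) \<le> e - 1 / real (Suc k)" by (intro LIMSEQ_le_const2[OF cv]) auto
    moreover have "0 < 1 / real (Suc k)" by simp
    ultimately show ?thesis by linarith
  qed
  have above: "e < lim (\<lambda>j. a j F)" if F: "F \<in> Hi" and cv: "(\<lambda>j. a j F) \<longlonglongrightarrow> lim (\<lambda>j. a j F)" for F
  proof -
    obtain k n where "\<And>j. j \<ge> n \<Longrightarrow> e + 1 / real (Suc k) \<le> a j F" using F unfolding Hi_def by blast
    then have "e + 1 / real (Suc k) \<le> lim (\<lambda>j. a j F)" by (intro LIMSEQ_le_const[OF cv]) auto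
    moreover have "0 < 1 / real (Suc k)" by simp
    ultimately show ?thesis by linarith
  qed
  \<comment> \<open>Otherwise the limit would lie almost everywhere strictly below \<open>e\<close>,
    which is its integral.\<close>
  have "prob Lo \<noteq> 1"
  proof
    assume "prob Lo = 1"
    then have "AE F in P. F \<in> Lo" by (subst (asm) prob_eq_1) auto
    with conv have "AE F in P. lim (\<lambda>j. a j F) < e" by eventually_elim (rule below)
    then have "(\<integral>F. lim (\<lambda>j. a j F) \<partial>P) < (\<integral>F. e \<partial>P)"
      using int_lim by (intro integral_less_AE_space) (auto simp: emeasure_space_1)
    then show False using lim_e by (simp add: prob_space)
  qed
  then have "prob Lo = 0" using Lo_01 by blast
  then have Lo_null: "AE F in P. F \<notin> Lo" by (subst (asm) prob_eq_0) auto
  have "prob Hi \<noteq> 1"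
  proof
    assume "prob Hi = 1"
    then have "AE F in P. F \<in> Hi" by (subst (asm) prob_eq_1) auto
    with conv have "AE F in P. e < lim (\<lambda>j. a j F)" by eventually_elim (rule above)
    then have "(\<integral>F. e \<partial>P) < (\<integral>F. lim (\<lambda>j. a j F) \<partial>P)"
      using int_lim by (intro integral_less_AE_space) (auto simp: emeasure_space_1)
    then show False using lim_e by (simp add: prob_space)
  qed
  then have "prob Hi = 0" using Hi_01 by blast
  then have Hi_null: "AE F in P. F \<notin> Hi" by (subst (asm) prob_eq_0) auto
  have "AE F in P. (\<lambda>j. a j F) \<longlonglongrightarrow> e"
    using conv Lo_null Hi_null AE_space
  proof eventually_elim
    case (elim F)
    let ?l = "lim (\<lambda>j. a j F)"
    have "\<not> ?l < e"
    proof
      assume "?l < e"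
      then obtain k where k: "1 / real (Suc k) < e - ?l" using nat_approx_posE[of "e - ?l"] by auto
      then have "eventually (\<lambda>j. a j F < e - 1 / real (Suc k)) sequentially"
        by (intro order_tendstoD(2)[OF elim(1)]) simp
      then have "F \<in> Lo" using elim(4) unfolding Lo_def eventually_sequentially by (auto intro: less_imp_le)
      then show False using elim(2) by blast
    qed
    moreover have "\<not> e < ?l"
    proof
      assume "e < ?l"
      then obtain k where k: "1 / real (Suc k) < ?l - e" using nat_approx_posE[of "?l - e"] by auto
      then have "eventually (\<lambda>j. e + 1 / real (Suc k) < a j F) sequentially"
        by (intro order_tendstoD(1)[OF elim(1)]) simp
      then have "F \<in> Hi" using elim(4) unfolding Hi_def eventually_sequentially by (auto intro: less_imp_le)
      then show False using elim(3) by blast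
    qed
    ultimately have "?l = e" by simp
    then show ?case using elim(1) by simp
  qed
  then show ?thesis using that[of r] r_pos unfolding a_def e_def by blast
qed

text \<open>Dominated convergence along the subsequence. The smoothing argument asks for a single
  good window, so convergence of the full sequence in mean can be bypassed.\<close>

lemma mean_ergodic_bounded:
  assumes "0 < \<delta>"
  obtains K where "0 < K" "(\<integral>F. \<bar>bavg u K F - (\<integral>F. u F \<partial>P)\<bar> \<partial>P) < \<delta>"
proof -
  note [measurable] = bavg_measurable[OF joint_u u_bounds]
  note ebavg = ennreal_bavg[OF joint_u u_bounds]
  define e where "e = (\<integral>F. u F \<partial>P)"
  obtain r where r: "\<And>j::nat. 0 < r j" "AE F in P. (\<lambda>j. bavg u (r j) F) \<longlonglongrightarrow> (\<integral>F. u F \<partial>P)"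
    by (rule mean_ergodic_subsequence) (rule that)
  have "(\<lambda>j. \<integral>F. \<bar>bavg u (r j) F - e\<bar> \<partial>P) \<longlonglongrightarrow> (\<integral>F. 0 \<partial>P)"
  proof (rule integral_dominated_convergence[where w = "\<lambda>_. b + \<bar>e\<bar>"])
    show "AE F in P. (\<lambda>j. \<bar>bavg u (r j) F - e\<bar>) \<longlonglongrightarrow> 0"
      using r(2)[folded e_def] by eventually_elim (simp add: tendsto_rabs_zero LIM_zero)
    fix j
    show "AE F in P. norm \<bar>bavg u (r j) F - e\<bar> \<le> b + \<bar>e\<bar>"
      using ebavg(2,3)[OF r(1)[of j]] by (intro AE_I2) (force simp: abs_le_iff)
  qed auto
  then have "eventually (\<lambda>j. (\<integral>F. \<bar>bavg u (r j) F - e\<bar> \<partial>P) < \<delta>) sequentially"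
    using assms by (intro order_tendstoD) auto
  then obtain j where "(\<integral>F. \<bar>bavg u (r j) F - e\<bar> \<partial>P) < \<delta>" by (auto simp: eventually_sequentially)
  then show ?thesis using that[of "r j"] r(1) by (simp add: e_def)
qed

end

section \<open>From mean convergence to almost sure convergence\<close>

lemma window_ratio_tendsto: "(\<lambda>N. (real (N + K) / real N) ^ m) \<longlonglongrightarrow> 1"
proof -
  have "(\<lambda>N. (real (N + K) / real N) ^ m) \<longlonglongrightarrow> 1 ^ m" by (intro tendsto_intros) real_asymp
  then show ?thesis by simp
qed

lemma V_add: "0 < N \<Longrightarrow> V (N + K) = V N * ennreal ((real (N + K) / real N) ^ m)"
  using c_pos by (simp add: ennreal_mult[symmetric] power_divide)

lemma V_mult_le_iff:
  assumes "0 < N"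
  shows "V N * x \<le> V N * y \<longleftrightarrow> x \<le> (y::ennreal)"
  using V_pos[OF assms] by (intro ennreal_mult_le_mult_iff) (auto simp: ennreal_eq_0_iff not_le)

text \<open>
  Smoothing with a window \<open>K\<close> does not change the asymptotic averages, and for large \<open>K\<close> the
  smoothed function is close to its mean up to a function \<open>D\<close> of small integral, to which the maximal
  inequality applies.
\<close>

lemma smoothing_decomposition:
  assumes g: "joint g" and e: "(\<integral>\<^sup>+ F. g F \<partial>P) = ennreal e" "0 \<le> e" and \<delta>: "0 < \<delta>"
  obtains K D d where "0 < K" "joint D" "(\<integral>\<^sup>+ F. D F \<partial>P) = ennreal d" "0 \<le> d" "d \<le> 2 * \<delta>"
    "\<And>F. F \<in> space P \<Longrightarrow> avg K g F \<le> ennreal e + D F"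
    "\<And>F. F \<in> space P \<Longrightarrow> ennreal e \<le> avg K g F + D F + ennreal \<delta>"
proof -
  have [measurable]: "g \<in> borel_measurable P" using g by (rule joint_measurable)
  have "(\<integral>\<^sup>+ F. (SUP n. min (g F) (ennreal (real n))) \<partial>P) = (SUP n. \<integral>\<^sup>+ F. min (g F) (ennreal (real n)) \<partial>P)"
    by (rule nn_integral_monotone_convergence_SUP) (auto simp: incseq_def le_fun_def min.coboundedI2 ennreal_leI)
  moreover have "(SUP n. min (g F) (ennreal (real n))) = g F" for F
  proof -
    have "(SUP n. min (g F) (ennreal (real n))) = inf (g F) (SUP n. ennreal (real n))"
      unfolding inf_min[symmetric] by (rule inf_SUP[symmetric])
    also have "(SUP n. ennreal (real n)) = top"
      using ennreal_SUP_of_nat_eq_top by (simp add: ennreal_of_nat_eq_real_of_nat)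
    finally show ?thesis by simp
  qed
  ultimately have sup: "ennreal e = (SUP n. \<integral>\<^sup>+ F. min (g F) (ennreal (real n)) \<partial>P)" using e by simp
  have "ennreal e < ennreal e + ennreal \<delta>" using e \<delta> by (simp add: ennreal_plus[symmetric] ennreal_less_iff del: ennreal_plus)
  then have "ennreal e < (SUP n. (\<integral>\<^sup>+ F. min (g F) (ennreal (real n)) \<partial>P) + ennreal \<delta>)"
    by (subst ennreal_SUP_add_left) (auto simp: sup[symmetric])
  then have "\<exists>n. ennreal e < (\<integral>\<^sup>+ F. min (g F) (ennreal (real n)) \<partial>P) + ennreal \<delta>"
    by (auto simp: less_SUP_iff)
  then obtain n where n: "ennreal e < (\<integral>\<^sup>+ F. min (g F) (ennreal (real n)) \<partial>P) + ennreal \<delta>" by blast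
  \<comment> \<open>The level \<open>n\<close> comes from monotone convergence and leaves a
    remainder \<open>G\<close> of integral below \<open>\<delta>\<close>, which is controlled by
    that integral alone; the mean ergodic theorem applies to the bounded part.\<close>
  define U where "U F = min (g F) (ennreal (real n))" for F
  define u where "u F = enn2real (U F)" for F
  have u: "ennreal (u F) = U F" "0 \<le> u F" "u F \<le> real n" for F
    by (auto simp: u_def U_def intro!: ennreal_enn2real enn2real_leI min.strict_coboundedI2)
  have joint_u: "joint u" unfolding u_def U_def by (rule joint_compose[OF g]) measurable
  have bounds: "\<forall>F\<in>space P. 0 \<le> u F \<and> u F \<le> real n" using u by auto
  define G where "G F = g F - U F" for F
  have joint_G: "joint G" unfolding G_def U_def by (rule joint_compose[OF g]) measurable
  have gUG: "g F = U F + G F" for F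
    unfolding G_def U_def by (rule add_diff_inverse_ennreal[symmetric]) simp
  define e1 where "e1 = (\<integral>F. u F \<partial>P)"
  have [measurable]: "u \<in> borel_measurable P" "G \<in> borel_measurable P" "U \<in> borel_measurable P"
    using joint_measurable joint_u joint_G unfolding U_def by auto
  have e1: "(\<integral>\<^sup>+ F. U F \<partial>P) = ennreal e1" "0 \<le> e1"
    using nn_integral_bounded(2,3)[of u "real n"] bounds u by (auto simp: e1_def)
  have "ennreal e = (\<integral>\<^sup>+ F. U F + G F \<partial>P)" using e gUG by simp
  also have "\<dots> = ennreal e1 + (\<integral>\<^sup>+ F. G F \<partial>P)" by (subst nn_integral_add) (auto simp: e1)
  finally have e_split: "ennreal e = ennreal e1 + (\<integral>\<^sup>+ F. G F \<partial>P)" .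
  define d2 where "d2 = e - e1"
  have "ennreal e1 \<le> ennreal e" unfolding e_split by simp
  then have d2: "0 \<le> d2" using e by (simp add: d2_def)
  have "ennreal e1 + (\<integral>\<^sup>+ F. G F \<partial>P) = ennreal e1 + ennreal d2"
    using d2 e1 e_split by (simp add: d2_def ennreal_plus[symmetric] del: ennreal_plus)
  then have intG: "(\<integral>\<^sup>+ F. G F \<partial>P) = ennreal d2" by simp
  have "ennreal e < ennreal (e1 + \<delta>)"
    using n e1 \<delta> by (simp add: U_def)
  then have d2_less: "d2 < \<delta>" using e by (simp add: ennreal_less_iff d2_def)
  obtain K where K: "0 < K" "(\<integral>F. \<bar>bavg u K F - e1\<bar> \<partial>P) < \<delta>"
    by (rule mean_ergodic_bounded[OF joint_u bounds \<delta>, folded e1_def]) (rule that)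
  note bav = ennreal_bavg[OF joint_u bounds K(1)]
  \<comment> \<open>Two errors, each of integral below \<open>\<delta>\<close>: the distance of the
    averaged truncation from its mean \<open>e1\<close>, and the averaged remainder. The lower
    estimate carries a further \<open>\<delta>\<close> because \<open>e\<close> exceeds
    \<open>e1\<close> by \<open>d2 < \<delta>\<close>.\<close>
  define D1 where "D1 F = ennreal \<bar>bavg u K F - e1\<bar>" for F
  define D where "D F = D1 F + avg K G F" for F
  have joint_D1: "joint D1"
    unfolding D1_def by (rule joint_compose[OF joint_bavg[OF joint_u bounds]]) measurable
  have joint_D: "joint D"
    unfolding D_def by (intro joint_add joint_D1 joint_avg joint_G)
  have [measurable]: "bavg u K \<in> borel_measurable P" by (rule bavg_measurable[OF joint_u bounds])
  have "0 \<le> \<bar>bavg u K F - e1\<bar> \<and> \<bar>bavg u K F - e1\<bar> \<le> real n + e1" if "F \<in> space P" for F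
    using bav(2,3)[OF that] e1(2) by auto
  then have intD1: "(\<integral>\<^sup>+ F. D1 F \<partial>P) = ennreal (\<integral>F. \<bar>bavg u K F - e1\<bar> \<partial>P)"
    unfolding D1_def by (intro nn_integral_bounded(2)[of _ "real n + e1"]) auto
  define d1 where "d1 = (\<integral>F. \<bar>bavg u K F - e1\<bar> \<partial>P)"
  have d1: "0 \<le> d1" unfolding d1_def by simp
  have "(\<integral>\<^sup>+ F. D F \<partial>P) = (\<integral>\<^sup>+ F. D1 F \<partial>P) + (\<integral>\<^sup>+ F. avg K G F \<partial>P)"
    unfolding D_def using joint_measurable[OF joint_D1] joint_measurable[OF joint_avg[OF joint_G]]
    by (rule nn_integral_add)
  also have "(\<integral>\<^sup>+ F. avg K G F \<partial>P) = ennreal d2" using nn_integral_avg[OF joint_G K(1)] intG by simp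
  finally have intD: "(\<integral>\<^sup>+ F. D F \<partial>P) = ennreal (d1 + d2)"
    using d1 d2 by (simp add: intD1 d1_def)
  have avg_split: "avg K g F = ennreal (bavg u K F) + avg K G F" if F: "F \<in> space P" for F
  proof -
    have "avg K g F = avg K (\<lambda>F. ennreal (u F) + G F) F" by (simp add: gUG[symmetric] u(1))
    also have "\<dots> = avg K (\<lambda>F. ennreal (u F)) F + avg K G F"
      by (rule avg_add[OF joint_ennreal_u[OF joint_u bounds] joint_G F])
    finally show ?thesis using bav(1)[OF F] by simp
  qed
  show thesis
  proof (rule that[OF K(1) joint_D intD])
    show "0 \<le> d1 + d2" using d1 d2 by simp
    show "d1 + d2 \<le> 2 * \<delta>" using K(2) d2_less by (simp add: d1_def)
    fix F assume F: "F \<in> space P"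
    have "ennreal (bavg u K F) \<le> ennreal (e + \<bar>bavg u K F - e1\<bar>)"
      using d2 by (intro ennreal_leI) (simp add: d2_def)
    also have "\<dots> = ennreal e + D1 F" using e(2) by (simp add: D1_def)
    finally show "avg K g F \<le> ennreal e + D F"
      unfolding avg_split[OF F] D_def by (simp add: add.assoc[symmetric] add_right_mono)
    have "ennreal e \<le> ennreal (bavg u K F + \<bar>bavg u K F - e1\<bar> + \<delta>)"
      using d2_less by (intro ennreal_leI) (simp add: d2_def)
    also have "\<dots> = ennreal (bavg u K F) + D1 F + ennreal \<delta>"
      using bav(2)[OF F] \<delta> by (simp add: D1_def)
    also have "\<dots> \<le> (ennreal (bavg u K F) + avg K G F) + (D1 F + avg K G F) + ennreal \<delta>"
      by (intro add_mono order_refl) auto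
    finally show "ennreal e \<le> avg K g F + D F + ennreal \<delta>"
      unfolding avg_split[OF F] D_def .
  qed
qed

text \<open>The smoothed averages are off by at most \<open>t\<close> above, from \<open>D\<close>,
  and by \<open>2 * t\<close> below, from \<open>D\<close> and \<open>\<delta>\<close>. Undoing the
  smoothing costs the volume ratio \<open>q N\<close>, which tends to 1; the slack up to
  \<open>4 * t\<close> leaves room for this.\<close>

lemma avg_close_if_maximal_small:
  assumes g: "joint g" and D: "joint D" and F: "F \<in> space P" and K: "0 < K" and e: "0 \<le> e"
    and t: "0 < t" and \<delta>: "\<delta> \<le> t" "0 < \<delta>"
    and upper: "\<And>F. F \<in> space P \<Longrightarrow> avg K g F \<le> ennreal e + D F"
    and lower: "\<And>F. F \<in> space P \<Longrightarrow> ennreal e \<le> avg K g F + D F + ennreal \<delta>"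
    and small: "\<And>N. 0 < N \<Longrightarrow> avg N D F \<le> ennreal t"
  shows "eventually (\<lambda>N. avg N g F \<le> ennreal (e + 4 * t) \<and> ennreal e \<le> avg N g F + ennreal (4 * t)) sequentially"
proof -
  define q where "q N = (real (N + K) / real N) ^ m" for N
  have q: "q \<longlonglongrightarrow> 1" unfolding q_def[abs_def] by (rule window_ratio_tendsto)
  have q0: "0 \<le> q N" for N by (simp add: q_def)
  have up1: "avg N (avg K g) F \<le> ennreal (e + t)" if N: "0 < N" for N
  proof -
    have "avg N (avg K g) F \<le> avg N (\<lambda>F. ennreal e + D F) F" using F upper by (intro avg_mono) auto
    also have "\<dots> = avg N (\<lambda>_. ennreal e) F + avg N D F" by (rule avg_add[OF joint_const D F])
    also have "\<dots> \<le> ennreal e + ennreal t" using small[OF N] avg_const[OF N] by (simp add: add_left_mono)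
    finally show ?thesis using e t by simp
  qed
  have lo1: "ennreal e \<le> avg N (avg K g) F + ennreal (2 * t)" if N: "0 < N" for N
  proof -
    have j1: "joint (\<lambda>F. avg K g F + D F)" by (intro joint_add joint_avg g D)
    have "ennreal e = avg N (\<lambda>_. ennreal e) F" using avg_const[OF N] by simp
    also have "\<dots> \<le> avg N (\<lambda>F. (avg K g F + D F) + ennreal \<delta>) F" using F lower by (intro avg_mono) auto
    also have "\<dots> = avg N (\<lambda>F. avg K g F + D F) F + avg N (\<lambda>_. ennreal \<delta>) F" by (rule avg_add[OF j1 joint_const F])
    also have "avg N (\<lambda>F. avg K g F + D F) F = avg N (avg K g) F + avg N D F"
      by (rule avg_add[OF joint_avg[OF g] D F])
    also have "avg N (avg K g) F + avg N D F + avg N (\<lambda>_. ennreal \<delta>) F \<le> avg N (avg K g) F + ennreal t + ennreal t"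
      using small[OF N] avg_const[OF N] \<delta> by (intro add_mono) (auto intro: ennreal_leI)
    also have "\<dots> = avg N (avg K g) F + ennreal (2 * t)"       using t by (subst add.assoc, subst ennreal_plus[symmetric]) auto
    finally show ?thesis .
  qed
  have up2: "avg N g F \<le> ennreal (q N * (e + t))" if N: "0 < N" for N
  proof -
    have "V N * avg N g F \<le> V (N + K) * avg (N + K) (avg K g) F"
      using avg_avg_bounds(2)[OF g F N K] N by (simp add: V_mult_avg)
    also have "\<dots> \<le> V (N + K) * ennreal (e + t)" using up1[of "N + K"] N by (intro mult_left_mono) auto
    also have "\<dots> = V N * ennreal (q N * (e + t))"
      unfolding V_add[OF N] q_def[symmetric] mult.assoc using q0[of N] e t by (subst ennreal_mult) auto
    finally show ?thesis using V_mult_le_iff[OF N] by blast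
  qed
  have lo2: "ennreal e \<le> ennreal (q N) * avg (N + K) g F + ennreal (2 * t)" if N: "0 < N" for N
  proof -
    have "V N * avg N (avg K g) F \<le> V (N + K) * avg (N + K) g F"
      using avg_avg_bounds(1)[OF g F N K] N by (subst V_mult_avg) auto
    also have "\<dots> = V N * (ennreal (q N) * avg (N + K) g F)"
      unfolding V_add[OF N] q_def by (rule mult.assoc)
    finally have "avg N (avg K g) F \<le> ennreal (q N) * avg (N + K) g F" using V_mult_le_iff[OF N] by blast
    then show ?thesis using lo1[OF N] by (meson add_right_mono order_trans)
  qed
  have "(\<lambda>N. q N * (e + t)) \<longlonglongrightarrow> 1 * (e + t)" by (intro tendsto_intros q)
  then have "eventually (\<lambda>N. q N * (e + t) < e + 4 * t) sequentially" using t by (intro order_tendstoD) auto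
  then have ev_up: "eventually (\<lambda>N. avg N g F \<le> ennreal (e + 4 * t)) sequentially"
    using eventually_gt_at_top[of 0]
  proof eventually_elim
    case (elim N)
    then show ?case using up2[of N] order_trans ennreal_leI by (meson less_imp_le)
  qed
  \<comment> \<open>In the lower estimate the average is multiplied by \<open>q N\<close>. The upper
    bound just proved keeps the excess, \<open>q N - 1\<close> times the average, below
    \<open>t\<close>.\<close>
  have "(\<lambda>N. (q N - 1) * (e + 4 * t)) \<longlonglongrightarrow> (1 - 1) * (e + 4 * t)" by (intro tendsto_intros q)
  then have "eventually (\<lambda>N. (q N - 1) * (e + 4 * t) < t) sequentially" using t by (intro order_tendstoD) auto
  moreover have "eventually (\<lambda>N. avg (N + K) g F \<le> ennreal (e + 4 * t)) sequentially"
    using ev_up by (rule eventually_all_ge_at_top[THEN eventually_mono, THEN eventually_mono]) auto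
  ultimately have "eventually (\<lambda>N. ennreal e \<le> avg (N + K) g F + ennreal (4 * t)) sequentially"
    using eventually_gt_at_top[of 0]
  proof eventually_elim
    case (elim N)
    define \<beta> where "\<beta> = enn2real (avg (N + K) g F)"
    have \<beta>: "avg (N + K) g F = ennreal \<beta>" "0 \<le> \<beta>" "\<beta> \<le> e + 4 * t"
      using elim(2) e t unfolding \<beta>_def
      by (auto simp: enn2real_leI le_less_trans intro!: ennreal_enn2real[symmetric])
    have q1: "1 \<le> q N" using elim(3) by (simp add: q_def one_le_power)
    have "ennreal e \<le> ennreal (q N * \<beta> + 2 * t)"
      using lo2[OF elim(3)] \<beta> q0[of N] t by (simp add: ennreal_mult)
    then have "e \<le> q N * \<beta> + 2 * t" using q0[of N] \<beta> t by (subst (asm) ennreal_le_iff) auto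
    also have "q N * \<beta> = \<beta> + (q N - 1) * \<beta>" by (simp add: algebra_simps)
    also have "(q N - 1) * \<beta> \<le> (q N - 1) * (e + 4 * t)" using q1 \<beta>(3) by (intro mult_left_mono) auto
    finally have "e \<le> \<beta> + 4 * t" using elim(1) t by linarith
    then show ?case using \<beta> t by (simp add: ennreal_leI flip: ennreal_plus)
  qed
  then have "eventually (\<lambda>N. ennreal e \<le> avg N g F + ennreal (4 * t)) sequentially"
    by (subst (asm) eventually_sequentially_seg)
  with ev_up show ?thesis by eventually_elim simp
qed

text \<open>For a tolerance \<open>t\<close> the event \<open>Bad\<close> is fixed while the
  decomposition varies: \<open>t * prob Bad\<close> is at most a constant times
  \<open>\<delta>\<close> for all small \<open>\<delta>\<close>, hence 0. Countably many tolerances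
  suffice. Closeness is stated with sums because subtraction in \<open>ennreal\<close> is
  truncated.\<close>

theorem pointwise_ergodic:
  assumes g: "joint g" and e: "(\<integral>\<^sup>+ F. g F \<partial>P) = ennreal e" "0 \<le> e"
  shows "AE F in P. (\<lambda>N. avg N g F) \<longlonglongrightarrow> ennreal e"
proof -
  have [measurable]: "avg N h \<in> borel_measurable P" if "joint h" for h N
    using joint_avg[OF that] by (rule joint_measurable)
  note [measurable] = g
  define close where "close t F \<longleftrightarrow> (\<exists>n. \<forall>N\<ge>n. avg N g F \<le> ennreal (e + 4 * t) \<and> ennreal e \<le> avg N g F + ennreal (4 * t))"
    for t :: real and F
  have AE_close: "AE F in P. close t F" if t: "0 < t" for t
  proof -
    define Bad where "Bad = {F \<in> space P. \<not> close t F}"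
    have [measurable]: "Bad \<in> events" unfolding Bad_def close_def using g by measurable
    have bound: "t * prob Bad \<le> (10 * real \<kappa>) ^ m * (2 * \<delta>)" if \<delta>: "0 < \<delta>" "\<delta> \<le> t" for \<delta>
    proof -
      obtain K D d where D: "0 < K" "joint D" "(\<integral>\<^sup>+ F. D F \<partial>P) = ennreal d" "0 \<le> d" "d \<le> 2 * \<delta>"
        "\<And>F. F \<in> space P \<Longrightarrow> avg K g F \<le> ennreal e + D F"
        "\<And>F. F \<in> space P \<Longrightarrow> ennreal e \<le> avg K g F + D F + ennreal \<delta>"
        using smoothing_decomposition[OF g e \<delta>(1)] by blast
      have "Bad \<subseteq> {F \<in> space P. \<exists>N>0. ennreal t < avg N D F}"
      proof
        fix F assume "F \<in> Bad"
        then have F: "F \<in> space P" "\<not> close t F" by (auto simp: Bad_def)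
        have "\<exists>N>0. ennreal t < avg N D F"
        proof (rule ccontr)
          assume "\<not> ?thesis"
          then have "\<And>N. 0 < N \<Longrightarrow> avg N D F \<le> ennreal t" by (meson not_le)
          from avg_close_if_maximal_small[OF g D(2) F(1) D(1) e(2) t \<delta>(2,1) D(6,7) this]
          show False using F(2) by (simp add: close_def eventually_sequentially)
        qed
        then show "F \<in> {F \<in> space P. \<exists>N>0. ennreal t < avg N D F}" using F by blast
      qed
      then have "prob Bad \<le> prob {F \<in> space P. \<exists>N>0. ennreal t < avg N D F}"
        using D(2) by (intro finite_measure_mono) measurable
      then have "t * prob Bad \<le> t * prob {F \<in> space P. \<exists>N>0. ennreal t < avg N D F}"
        using t by (intro mult_left_mono) auto
      also have "\<dots> \<le> (10 * real \<kappa>) ^ m * d" by (rule maximal_inequality[OF D(2,3,4) t])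
      also have "\<dots> \<le> (10 * real \<kappa>) ^ m * (2 * \<delta>)" using D(5) by (intro mult_left_mono) auto
      finally show ?thesis .
    qed
    have "t * prob Bad \<le> 0"
    proof (rule tendsto_lowerbound)
      have "((\<lambda>\<delta>. (10 * real \<kappa>) ^ m * (2 * \<delta>)) \<longlongrightarrow> (10 * real \<kappa>) ^ m * (2 * 0)) (at_right 0)"
        by (intro tendsto_intros)
      then show "((\<lambda>\<delta>. (10 * real \<kappa>) ^ m * (2 * \<delta>)) \<longlongrightarrow> 0) (at_right 0)" by simp
      show "eventually (\<lambda>\<delta>. t * prob Bad \<le> (10 * real \<kappa>) ^ m * (2 * \<delta>)) (at_right 0)"
        by (rule eventually_mono[OF eventually_at_right_real[OF t]]) (rule bound, auto)
    qed simp
    then have "prob Bad = 0" using t by (simp add: mult_le_0_iff measure_le_0_iff)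
    then have "AE F in P. F \<notin> Bad" by (subst (asm) prob_eq_0) auto
    then show ?thesis using AE_space by eventually_elim (simp add: Bad_def)
  qed
  have "AE F in P. \<forall>k. close (1 / real (Suc k)) F"
    by (subst AE_all_countable) (intro allI AE_close, simp)
  then show ?thesis
  proof eventually_elim
    case (elim F)
    show ?case
    proof (rule order_tendstoI)
      fix a assume "a < ennreal e"
      have "\<exists>t>0. a + ennreal (4 * t) < ennreal e"
      proof -
        obtain r where r: "a = ennreal r" "0 \<le> r" "r < e"
          using \<open>a < ennreal e\<close> by (cases a) (auto simp: ennreal_less_iff)
        then show ?thesis
          by (intro exI[of _ "(e - r) / 8"]) (simp add: ennreal_less_iff field_simps flip: ennreal_plus)
      qed
      then obtain t where t: "0 < t" "a + ennreal (4 * t) < ennreal e" by blast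
      obtain k where "1 / real (Suc k) < t" using nat_approx_posE[OF t(1)] by blast
      then have k: "ennreal (4 * (1 / real (Suc k))) \<le> ennreal (4 * t)" by (intro ennreal_leI) simp
      obtain n where n: "\<And>N. N \<ge> n \<Longrightarrow> ennreal e \<le> avg N g F + ennreal (4 * (1 / real (Suc k)))"
        using elim unfolding close_def by blast
      show "eventually (\<lambda>N. a < avg N g F) sequentially"
        unfolding eventually_sequentially
      proof (intro exI allI impI)
        fix N assume "n \<le> N"
        show "a < avg N g F"
        proof (rule ccontr)
          assume "\<not> ?thesis"
          then have "ennreal e \<le> a + ennreal (4 * t)"
            using n[OF \<open>n \<le> N\<close>] add_mono[OF _ k, of "avg N g F" a] by (auto simp: not_less intro: order_trans)
          then show False using t by simp
        qed
      qed
    next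
      fix a assume "ennreal e < a"
      have "\<exists>t>0. ennreal (e + 4 * t) < a"
      proof (cases a)
        case (real r)
        then have "e < r" using \<open>ennreal e < a\<close> e by (simp add: ennreal_less_iff)
        then have "e + 4 * ((r - e) / 8) < r" "0 < r" using e by argo+
        then have "ennreal (e + 4 * ((r - e) / 8)) < a" using real by (simp only: ennreal_lessI)
        then show ?thesis using \<open>e < r\<close> by (intro exI[of _ "(r - e) / 8"]) simp
      qed (auto intro!: exI[of _ "1::real"])
      then obtain t where t: "0 < t" "ennreal (e + 4 * t) < a" by blast
      obtain k where "1 / real (Suc k) < t" using nat_approx_posE[OF t(1)] by blast
      then have k: "ennreal (e + 4 * (1 / real (Suc k))) \<le> ennreal (e + 4 * t)" by (intro ennreal_leI) simp
      obtain n where "\<And>N. N \<ge> n \<Longrightarrow> avg N g F \<le> ennreal (e + 4 * (1 / real (Suc k)))"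
        using elim unfolding close_def by blast
      then show "eventually (\<lambda>N. avg N g F < a) sequentially"
        unfolding eventually_sequentially using k t(2) by (meson le_less_trans)
    qed
  qed
qed

end

section \<open>The tortuosity estimator\<close>

text \<open>The Hausdorff measure of codimension 1 is not sigma-finite on the whole space; its
  restriction to the hyperplane is, and Tonelli's theorem becomes available.\<close>

definition inlet_measure :: "(real ^ 'n::{finite,linorder}) measure" where
  "inlet_measure = density (hausdorff_measure (CARD('n) - 1)) (indicator H_in)"

text \<open>
  Projecting the shift vectors to the inlet hyperplane yields an action of the whole space, so that the ergodic
  theorem needs no restricted domain for the action.
\<close>

definition inlet_proj :: "real ^ 'n::{finite,linorder} \<Rightarrow> real ^ 'n::{finite,linorder}" where
  "inlet_proj x = x - last_coord x *\<^sub>R axis (Max UNIV) 1"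

lemma inlet_proj_in: "inlet_proj x \<in> H_in"
  by (simp add: inlet_proj_def H_in_def last_coord_def axis_def)

lemma inlet_proj_eq: "x \<in> H_in \<Longrightarrow> inlet_proj x = x"
  by (simp add: inlet_proj_def H_in_def)

lemma inlet_proj_add: "inlet_proj (x + y) = inlet_proj x + inlet_proj y"
  by (simp add: inlet_proj_def last_coord_def algebra_simps)

lemma inlet_proj_measurable [measurable]: "inlet_proj \<in> borel_measurable borel"
  unfolding inlet_proj_def[abs_def] last_coord_def
  by (intro borel_measurable_continuous_onI continuous_intros)

lemma H_in_measurable [measurable]: "H_in \<in> sets borel"
  by (simp add: borel_closed)

lemma sets_inlet_measure [simp, measurable_cong]: "sets inlet_measure = sets borel"
  by (simp add: inlet_measure_def)

lemma emeasure_inlet_measure: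
  assumes "A \<in> sets borel"
  shows "emeasure inlet_measure (A :: (real ^ 'n::{finite,linorder}) set) =
    hausdorff_outer (CARD('n) - 1) (H_in \<inter> A)"
  unfolding inlet_measure_def using assms
  by (subst emeasure_density)
    (auto simp: indicator_inter_arith[symmetric] emeasure_hausdorff_measure)

lemma hausdorff_measure_density_inlet:
  assumes "f \<in> borel_measurable borel"
  shows "(\<integral>\<^sup>+ x. f x \<partial>(inlet_measure :: (real ^ 'n::{finite,linorder}) measure)) =
    (\<integral>\<^sup>+ x. f x * indicator H_in x \<partial>hausdorff_measure (CARD('n) - 1))"
  unfolding inlet_measure_def using assms
  by (subst nn_integral_density) (auto simp: mult.commute)

lemma H_in_add: "x \<in> H_in \<Longrightarrow> y \<in> H_in \<Longrightarrow> x + y \<in> H_in"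
  by (simp add: H_in_def last_coord_def)

lemma H_in_diff: "x \<in> H_in \<Longrightarrow> y \<in> H_in \<Longrightarrow> x - y \<in> H_in"
  by (simp add: H_in_def last_coord_def)

lemma inlet_measure_translate:
  assumes x: "x \<in> (H_in :: (real ^ 'n::{finite,linorder}) set)"
  shows "distr inlet_measure borel ((+) x) = inlet_measure"
proof (rule measure_eqI)
  fix A assume "A \<in> sets (distr inlet_measure borel ((+) x))"
  then have [measurable]: "A \<in> sets borel" by simp
  have meas: "(+) x -` A \<in> sets borel" by (rule measurable_sets_borel) measurable
  have "emeasure (distr inlet_measure borel ((+) x)) A = emeasure inlet_measure ((+) x -` A)"
    by (subst emeasure_distr) (auto simp: inlet_measure_def)
  also have "\<dots> = hausdorff_outer (CARD('n) - 1) (H_in \<inter> (+) x -` A)"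
    using meas by (rule emeasure_inlet_measure)
  also have "\<dots> = hausdorff_outer (CARD('n) - 1) ((+) x ` (H_in \<inter> (+) x -` A))"
    by (rule hausdorff_outer_translate[symmetric])
  also have "(+) x ` (H_in \<inter> (+) x -` A) = H_in \<inter> A"
  proof (intro equalityI subsetI)
    fix y assume "y \<in> H_in \<inter> A"
    then show "y \<in> (+) x ` (H_in \<inter> (+) x -` A)"
      using H_in_diff[OF _ x] by (intro image_eqI[of _ _ "y - x"]) auto
  qed (use H_in_add[OF x] in auto)
  finally show "emeasure (distr inlet_measure borel ((+) x)) A = emeasure inlet_measure A"
    by (simp add: emeasure_inlet_measure)
qed simp

text \<open>The constants are the measure of the unit window, the dimension of the hyperplane and,
  as \<open>\<kappa>\<close>, the factor from estimating the Euclidean norm by the sum of the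
  coordinates.\<close>

lemma averaging_windows_inlet:
  assumes "CARD('n::{finite,linorder}) \<ge> 2"
  shows "averaging_windows (inlet_measure :: (real ^ 'n::{finite,linorder}) measure) H_in_window
    (enn2real (inlet_unit TYPE('n))) (CARD('n) - 1) CARD('n)"
proof -
  have unit: "inlet_unit TYPE('n) = ennreal (enn2real (inlet_unit TYPE('n)))"
    using inlet_unit_finite[where 'n = 'n] by simp
  show ?thesis
  proof
    show "emeasure inlet_measure (H_in_window N :: (real, 'n) vec set) =
        ennreal (enn2real (inlet_unit TYPE('n)) * real N ^ (CARD('n) - 1))" for N
    proof -
      have "H_in \<inter> H_in_window N = (H_in_window N :: (real, 'n) vec set)" by (auto simp: H_in_window_def)
      then have "emeasure inlet_measure (H_in_window N :: (real, 'n) vec set) =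
          ennreal (real N ^ (CARD('n) - 1)) * inlet_unit TYPE('n)"
        by (simp only: emeasure_inlet_measure borel_closed closed_H_in_window hausdorff_outer_H_in_window[OF assms])
      then show ?thesis by (subst (asm) unit) (simp add: ennreal_mult mult.commute)
    qed
    show "0 < enn2real (inlet_unit TYPE('n))"
      using inlet_unit_pos[where 'n = 'n] inlet_unit_finite[where 'n = 'n] by (simp add: enn2real_positive_iff)
    show "emeasure inlet_measure (- (\<Union>N. H_in_window N) :: (real, 'n) vec set) = 0"
      unfolding H_in_eq_Union_windows[symmetric] by (subst emeasure_inlet_measure) (auto simp: borel_closed)
    show "distr inlet_measure borel ((+) x) = inlet_measure" if "x \<in> H_in_window N" for N and x :: "(real, 'n) vec"
      using that by (intro inlet_measure_translate) (simp add: H_in_window_def)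
    show "x \<in> H_in_window N" if "x \<in> H_in_window M" "norm x \<le> real N / 2" for M N and x :: "(real, 'n) vec"
      using that by (intro H_in_window_if_norm_le) (auto simp: H_in_window_def)
    show "0 \<in> (H_in_window 0 :: (real, 'n) vec set)"
      by (simp add: H_in_window_eq H_in_def last_coord_def)
  qed (use norm_le_H_in_window in \<open>auto simp: borel_closed H_in_window_add H_in_window_uminus\<close>)
qed

lemma shift_H_out: "x \<in> H_in \<Longrightarrow> shift x H_out = H_out"
  by (auto simp: set_eq_iff mem_shift H_in_def H_out_def last_coord_def)

text \<open>Inlet translations preserve the outlet hyperplane. Integrals over starting points
  therefore become orbit integrals of a function of the translated set.\<close>

lemma geodesic_length_origin_shift:
  assumes "x \<in> H_in"
  shows "geodesic_length (shift x F) 0 H_out = geodesic_length F x H_out"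
  using geodesic_length_shift[of x F 0 H_out] by (simp add: shift_H_out[OF assms])

text \<open>Invariance of the law is stationarity. The locale expresses invariant sets by preimages
  and \<open>ergodic_along\<close> by images; as \<open>shift x\<close> and
  \<open>shift (- x)\<close> are inverse to each other and the windows exhaust the hyperplane, the
  former invariance yields the latter.\<close>

lemma ergodic_action_shifts:
  fixes M :: "'w measure" and \<Xi> :: "'w \<Rightarrow> (real ^ 'n::{finite,linorder}) set"
  assumes card: "CARD('n) \<ge> 2" and M: "prob_space M" and \<Xi>: "random_closed_set M \<Xi>"
    and stat: "stationary_ergodic M \<Xi>"
  shows "ergodic_action (inlet_measure :: (real ^ 'n::{finite,linorder}) measure) H_in_window
    (enn2real (inlet_unit TYPE('n))) (CARD('n) - 1) CARD('n) (distr M fell_borel \<Xi>) (\<lambda>x. shift (inlet_proj x))"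
proof -
  let ?P = "distr M fell_borel \<Xi>"
  have \<Xi>_meas [measurable]: "\<Xi> \<in> measurable M fell_borel" using \<Xi> by (simp add: random_closed_set_def)
  interpret averaging_windows "inlet_measure :: (real, 'n) vec measure" H_in_window
    "enn2real (inlet_unit TYPE('n))" "CARD('n) - 1" "CARD('n)"
    by (rule averaging_windows_inlet[OF card])
  interpret M: prob_space M by (rule M)
  interpret P: prob_space ?P by (rule M.prob_space_distr) measurable
  show ?thesis
  proof
    fix x y :: "(real, 'n) vec"
    show "shift (inlet_proj x) \<in> measurable ?P ?P" by measurable
    have "distr ?P ?P (shift (inlet_proj x)) = distr ?P fell_borel (shift (inlet_proj x))"
      by (rule distr_cong) auto
    also have "\<dots> = distr M fell_borel (shift (inlet_proj x) \<circ> \<Xi>)"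
      by (rule distr_distr) measurable
    also have "\<dots> = ?P"
      using stat inlet_proj_in[of x] by (simp add: stationary_ergodic_def stationary_along_def o_def)
    finally show "distr ?P ?P (shift (inlet_proj x)) = ?P" .
    fix F
    show "shift (inlet_proj (x + y)) F = shift (inlet_proj x) (shift (inlet_proj y) F)"
      by (simp add: shift_shift inlet_proj_add)
  next
    fix B assume B: "B \<in> sets ?P"
      and inv: "\<And>N x. x \<in> H_in_window N \<Longrightarrow> shift (inlet_proj x) -` B \<inter> space ?P = B"
    have B': "B \<in> sets fell_borel" using B by simp
    have inv': "shift x -` B \<inter> {F. closed F} = B" if x: "x \<in> H_in" for x
    proof -
      obtain N where "x \<in> H_in_window N" using x H_in_eq_Union_windows by blast
      from inv[OF this] show ?thesis using x by (simp add: inlet_proj_eq)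
    qed
    have "shift x ` B = B" if x: "x \<in> H_in" for x
    proof (intro equalityI subsetI)
      fix G assume "G \<in> shift x ` B"
      then show "G \<in> B" using inv'[OF x] by blast
    next
      fix G assume G: "G \<in> B"
      have "- x \<in> H_in" using x by (simp add: H_in_def last_coord_def)
      then have "shift (- x) G \<in> B" using inv' G by blast
      moreover have "G = shift x (shift (- x) G)" by (simp add: shift_shift)
      ultimately show "G \<in> shift x ` B" by blast
    qed
    then have "measure M {\<omega> \<in> space M. \<Xi> \<omega> \<in> B} \<in> {0, 1}"
      using stat B' by (auto simp: stationary_ergodic_def ergodic_along_def)
    moreover have "P.prob B = measure M {\<omega> \<in> space M. \<Xi> \<omega> \<in> B}"
      using B' by (subst measure_distr) (auto intro!: arg_cong[where f = "measure M"])
    ultimately show "P.prob B = 0 \<or> P.prob B = 1" by auto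
  qed
qed

text \<open>Both integrals have a common form with a function \<open>h\<close> of the geodesic
  length, the constant 1 below and the identity above. Restricting to finite lengths amounts to
  restricting to the connected points.\<close>

lemma tortuosity_estimator_eq:
  fixes F :: "(real ^ 'n::{finite,linorder}) set" and N :: nat
  defines "I \<equiv> \<lambda>g :: (real ^ 'n::{finite,linorder}) set \<Rightarrow> ennreal.
    (\<integral>\<^sup>+ x. g (shift (inlet_proj x) F) * indicator (H_in_window N) x \<partial>inlet_measure)"
  shows "tortuosity_estimator N F =
    (let I1 = I (\<lambda>G. if geodesic_length G 0 H_out < \<infinity> then 1 else 0);
         I2 = I (\<lambda>G. if geodesic_length G 0 H_out < \<infinity> then geodesic_length G 0 H_out else 0)
     in if I1 = 0 then \<infinity> else I2 / I1)"
proof -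
  let ?H = "hausdorff_measure (CARD('n) - 1) :: (real, 'n) vec measure"
  let ?l = "\<lambda>x. geodesic_length F x H_out"
  let ?A = "connected_points F H_out \<inter> H_in_window N"
  have WH: "x \<in> H_in" if "x \<in> H_in_window N" for x :: "(real, 'n) vec" using that by (simp add: H_in_window_def)
  have [measurable]: "?l \<in> borel_measurable borel"
    by (rule borel_measurableI_less) (simp add: borel_open open_geodesic_length_less)
  have [measurable]: "(H_in_window N :: (real, 'n) vec set) \<in> sets borel" by (simp add: borel_closed)
  have "?A \<in> sets borel"
    unfolding connected_points_eq by (rule sets.Int[OF borel_open[OF open_geodesic_length_less]]) measurable
  note [measurable] = this
  have key: "I (\<lambda>G. if geodesic_length G 0 H_out < \<infinity> then h (geodesic_length G 0 H_out) else 0) =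
      (\<integral>\<^sup>+ x\<in>?A. h (?l x) \<partial>?H)" if [measurable]: "h \<in> borel_measurable borel" for h :: "ennreal \<Rightarrow> ennreal"
  proof -
    have "I (\<lambda>G. if geodesic_length G 0 H_out < \<infinity> then h (geodesic_length G 0 H_out) else 0) =
        (\<integral>\<^sup>+ x. h (?l x) * indicator ?A x \<partial>inlet_measure)"
      unfolding I_def using WH
      by (intro nn_integral_cong)
        (auto simp: geodesic_length_origin_shift inlet_proj_eq connected_points_eq split: split_indicator)
    also have "\<dots> = (\<integral>\<^sup>+ x. h (?l x) * indicator ?A x * indicator H_in x \<partial>?H)"
      by (rule hausdorff_measure_density_inlet) measurable
    also have "\<dots> = (\<integral>\<^sup>+ x\<in>?A. h (?l x) \<partial>?H)"
      using WH by (intro nn_integral_cong) (auto split: split_indicator)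
    finally show ?thesis .
  qed
  have "I (\<lambda>G. if geodesic_length G 0 H_out < \<infinity> then 1 else 0) = emeasure ?H ?A"
    using key[of "\<lambda>_. 1"] by simp
  moreover have "I (\<lambda>G. if geodesic_length G 0 H_out < \<infinity> then geodesic_length G 0 H_out else 0) =
      (\<integral>\<^sup>+ x\<in>?A. ?l x \<partial>?H)"
    using key[of "\<lambda>a. a"] by simp
  ultimately show ?thesis unfolding tortuosity_estimator_def Let_def by simp
qed

text \<open>Division in \<open>ennreal\<close> is not continuous everywhere, but finite limits with
  a positive denominator allow a passage through the reals.\<close>

lemma tendsto_divide_ennreal:
  assumes f: "(f \<longlongrightarrow> ennreal a) A" and g: "(g \<longlongrightarrow> ennreal b) A" and "0 \<le> a" "0 < b"
  shows "((\<lambda>x. f x / g x) \<longlongrightarrow> ennreal a / ennreal b) A"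
proof -
  have "((\<lambda>x. ennreal (enn2real (f x) / enn2real (g x))) \<longlongrightarrow> ennreal (a / b)) A"
    using tendsto_enn2real[OF f] tendsto_enn2real[OF g] assms(3,4)
    by (intro tendsto_ennrealI tendsto_divide) auto
  moreover have "eventually (\<lambda>x. f x < top) A" "eventually (\<lambda>x. g x < top) A" "eventually (\<lambda>x. 0 < g x) A"
    using assms by (auto intro!: order_tendstoD[OF f] order_tendstoD[OF g])
  then have "eventually (\<lambda>x. ennreal (enn2real (f x) / enn2real (g x)) = f x / g x) A"
    by eventually_elim (simp add: divide_ennreal[symmetric] enn2real_positive_iff)
  ultimately have "((\<lambda>x. f x / g x) \<longlongrightarrow> ennreal (a / b)) A" by (rule Lim_transform_eventually)
  then show ?thesis using assms(3,4) by (simp add: divide_ennreal)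
qed

theorem theorem3:
  fixes M :: "'w measure" and \<Xi> :: "'w \<Rightarrow> (real ^ 'n::{finite,linorder}) set"
  assumes "CARD('n) \<ge> 2"
    and "prob_space M" and "complete_measure M"
    and "random_closed_set M \<Xi>"
    and "stationary_ergodic M \<Xi>"
    and "(\<integral>\<^sup>+ \<omega>. geodesic_length (\<Xi> \<omega>) 0 H_out * indicator (origin_connected M \<Xi>) \<omega> \<partial>M) < \<infinity>"
  shows "AE \<omega> in M. (\<lambda>N. tortuosity_estimator N (\<Xi> \<omega>)) \<longlonglongrightarrow> mean_tortuosity M \<Xi>"
proof -
  let ?P = "distr M fell_borel \<Xi>"
  let ?O = "origin_connected M \<Xi>"
  have \<Xi>_meas [measurable]: "\<Xi> \<in> measurable M fell_borel"
    using assms(4) by (simp add: random_closed_set_def)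
  interpret M: prob_space M by (rule assms(2))
  interpret E: ergodic_action "inlet_measure :: (real, 'n) vec measure" H_in_window
    "enn2real (inlet_unit TYPE('n))" "CARD('n) - 1" "CARD('n)" ?P "\<lambda>x. shift (inlet_proj x)"
    by (rule ergodic_action_shifts) (rule assms)+
  define l where "l G = geodesic_length G (0 :: (real, 'n) vec) H_out" for G
  note [measurable] = borel_measurable_geodesic_length
  \<comment> \<open>By covariance, \<open>l\<close> of the shifted set is the geodesic length in the
    unshifted \<open>F\<close> from \<open>inlet_proj x\<close>, which is known to be jointly
    measurable.\<close>
  have joint_l: "E.joint l"
  proof -
    have "(\<lambda>p. (\<lambda>(x, F). geodesic_length F x H_out) (inlet_proj (fst p), snd p)) \<in>
        borel_measurable (borel \<Otimes>\<^sub>M ?P)" by measurable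
    moreover have "l (shift (inlet_proj x) F) = geodesic_length F (inlet_proj x) H_out" for x F
      unfolding l_def by (rule geodesic_length_origin_shift[OF inlet_proj_in])
    ultimately have "(\<lambda>(x, F). l (shift (inlet_proj x) F)) \<in> borel_measurable (borel \<Otimes>\<^sub>M ?P)"
      by (simp add: case_prod_unfold)
    moreover have "(\<lambda>F. (\<lambda>(x, F). geodesic_length F x H_out) (0 :: (real, 'n) vec, F)) \<in> borel_measurable ?P"
      by measurable
    ultimately show ?thesis unfolding E.joint_def l_def by simp
  qed
  \<comment> \<open>The origin is connected exactly when \<open>l\<close> is finite. Setting
    \<open>g2\<close> to 0 elsewhere makes its integral the quantity that is assumed finite.\<close>
  define g1 where "g1 G = (if l G < \<infinity> then 1 else 0 :: ennreal)" for G
  define g2 where "g2 G = (if l G < \<infinity> then l G else 0)" for G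
  have joint1: "E.joint g1" unfolding g1_def[abs_def]
    by (rule E.joint_compose[OF joint_l, of "\<lambda>a. if a < \<infinity> then 1 else 0"]) measurable
  have joint2: "E.joint g2" unfolding g2_def[abs_def]
    by (rule E.joint_compose[OF joint_l, of "\<lambda>a. if a < \<infinity> then a else 0"]) measurable
  have [measurable]: "l \<in> borel_measurable fell_borel" "g1 \<in> borel_measurable fell_borel" "g2 \<in> borel_measurable fell_borel"
    using E.joint_measurable[OF joint_l] E.joint_measurable[OF joint1] E.joint_measurable[OF joint2] by simp_all
  have O_eq: "?O = {\<omega> \<in> space M. l (\<Xi> \<omega>) < \<infinity>}"
    unfolding origin_connected_def connected_points_eq l_def by simp
  have [measurable]: "?O \<in> sets M" unfolding O_eq by measurable
  define p where "p = measure M ?O"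
  have int1: "(\<integral>\<^sup>+ F. g1 F \<partial>?P) = ennreal p"
  proof -
    have "(\<integral>\<^sup>+ F. g1 F \<partial>?P) = (\<integral>\<^sup>+ \<omega>. g1 (\<Xi> \<omega>) \<partial>M)" by (rule nn_integral_distr) measurable
    also have "\<dots> = (\<integral>\<^sup>+ \<omega>. indicator ?O \<omega> \<partial>M)"
      by (intro nn_integral_cong) (auto simp: g1_def O_eq split: split_indicator)
    finally show ?thesis by (simp add: p_def M.emeasure_eq_measure)
  qed
  have int2: "(\<integral>\<^sup>+ F. g2 F \<partial>?P) = (\<integral>\<^sup>+ \<omega>. geodesic_length (\<Xi> \<omega>) 0 H_out * indicator ?O \<omega> \<partial>M)"
  proof -
    have "(\<integral>\<^sup>+ F. g2 F \<partial>?P) = (\<integral>\<^sup>+ \<omega>. g2 (\<Xi> \<omega>) \<partial>M)" by (rule nn_integral_distr) measurable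
    also have "\<dots> = (\<integral>\<^sup>+ \<omega>. geodesic_length (\<Xi> \<omega>) 0 H_out * indicator ?O \<omega> \<partial>M)"
      by (intro nn_integral_cong) (auto simp: g2_def O_eq l_def split: split_indicator)
    finally show ?thesis .
  qed
  define e2 where "e2 = enn2real (\<integral>\<^sup>+ F. g2 F \<partial>?P)"
  have e2: "(\<integral>\<^sup>+ F. g2 F \<partial>?P) = ennreal e2" "0 \<le> e2"
    using assms(6) unfolding e2_def int2[symmetric] by simp_all
  have estimator: "tortuosity_estimator N F = (if E.window_integral N g1 F = 0 then \<infinity>
      else E.window_integral N g2 F / E.window_integral N g1 F)" for N F
    unfolding tortuosity_estimator_eq Let_def E.window_integral_def g1_def g2_def l_def ..
  have "AE F in ?P. (\<lambda>N. tortuosity_estimator N F) \<longlonglongrightarrow> mean_tortuosity M \<Xi>"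
  proof (cases "0 < p")
    case True
    have mean: "mean_tortuosity M \<Xi> = ennreal e2 / ennreal p"
    proof -
      have "mean_tortuosity M \<Xi> = (\<integral>\<^sup>+ \<omega>. geodesic_length (\<Xi> \<omega>) 0 H_out \<partial>uniform_measure M ?O)"
        using True by (simp add: mean_tortuosity_def p_def)
      also have "\<dots> = (\<integral>\<^sup>+ \<omega>. geodesic_length (\<Xi> \<omega>) 0 H_out * indicator ?O \<omega> \<partial>M) / emeasure M ?O"
      proof (rule nn_integral_uniform_measure)
        have "(\<lambda>\<omega>. l (\<Xi> \<omega>)) \<in> borel_measurable M" by measurable
        then show "(\<lambda>\<omega>. geodesic_length (\<Xi> \<omega>) 0 H_out) \<in> borel_measurable M" by (simp add: l_def)
      qed measurable
      finally show ?thesis using e2 int2 by (simp add: p_def M.emeasure_eq_measure)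
    qed
    have "AE F in ?P. (\<lambda>N. E.avg N g1 F) \<longlonglongrightarrow> ennreal p"
      using True by (intro E.pointwise_ergodic joint1 int1) simp
    moreover have "AE F in ?P. (\<lambda>N. E.avg N g2 F) \<longlonglongrightarrow> ennreal e2"
      by (intro E.pointwise_ergodic joint2 e2)
    ultimately show ?thesis
    proof eventually_elim
      case (elim F)
      have "(\<lambda>N. E.avg N g2 F / E.avg N g1 F) \<longlonglongrightarrow> ennreal e2 / ennreal p"
        using elim(1,2) True e2(2) by (intro tendsto_divide_ennreal) auto
      \<comment> \<open>Eventually the denominator is positive, so the estimator is given by its
        quotient and not by the default value.\<close>
      moreover have "eventually (\<lambda>N. 0 < E.avg N g1 F) sequentially"
        using elim(1) True by (intro order_tendstoD) auto
      then have "eventually (\<lambda>N. E.avg N g2 F / E.avg N g1 F = tortuosity_estimator N F) sequentially"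
        using eventually_gt_at_top[of 0]
      proof eventually_elim
        case (elim N)
        have "E.window_integral N g1 F \<noteq> 0"
        proof
          assume "E.window_integral N g1 F = 0"
          then have "E.avg N g1 F = 0" unfolding E.avg_def by simp
          then show False using elim(1) by (simp only: less_irrefl)
        qed
        \<comment> \<open>The normalisation by the window volume cancels; the volume is finite, and
          positive because \<open>N > 0\<close>.\<close>
        moreover have "E.window_integral N g2 F / E.window_integral N g1 F = E.avg N g2 F / E.avg N g1 F"
          unfolding E.V_mult_avg[OF elim(2), symmetric] mult.commute[of "E.V N"]
          using E.V_pos[OF elim(2)] by (intro divide_mult_eq) (auto simp: ennreal_eq_0_iff not_le)
        ultimately show ?case unfolding estimator by simp
      qed
      ultimately show ?case unfolding mean by (rule Lim_transform_eventually)
    qed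
  next
    case False
    then have "p = 0" by (simp add: p_def zero_less_measure_iff measure_nonneg order.antisym)
    have mean: "mean_tortuosity M \<Xi> = \<infinity>" using False by (simp add: mean_tortuosity_def p_def)
    \<comment> \<open>The window integrals of \<open>g1\<close> are nonnegative with expectation 0.
      Almost surely all of them vanish at once, so the estimator is \<open>\<infinity>\<close> for
      every \<open>N\<close>, the same default as in the definition of the mean.\<close>
    have "AE F in ?P. E.window_integral N g1 F = 0" for N
    proof -
      have "E.window_integral N g1 \<in> borel_measurable ?P"
        by (rule E.joint_measurable[OF E.joint_window_integral[OF joint1]])
      moreover have "(\<integral>\<^sup>+ F. E.window_integral N g1 F \<partial>?P) = 0"
        using E.nn_integral_window_integral[OF joint1] int1 \<open>p = 0\<close> by simp
      ultimately show ?thesis by (simp add: nn_integral_0_iff_AE)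
    qed
    then have "AE F in ?P. \<forall>N. E.window_integral N g1 F = 0" by (simp add: AE_all_countable)
    then show ?thesis unfolding mean by eventually_elim (simp add: estimator)
  qed
  from AE_distrD[OF \<Xi>_meas this] show ?thesis .
qed

end
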